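(* Let $X$ be any of the following spaces: $\mathrm{BMOA}$, $H^p$ (with $0<p<\infty$), $\mathcal{N}^+$ or $\mathcal{N}$. Then, for every integer $m\ge0$, one has $$\mathcal{Z}_{m+1}(X_m)=\mathcal{Z}(\mathrm{BMOA}').$$
   Context: $\mathbb{D}$ is the open unit disk, $\mathbb{T}=\partial\mathbb{D}$, $\mathcal{H}(\mathbb{D})$ is the set of holomorphic functions on $\mathbb{D}$, $H^p$ are the usual holomorphic Hardy spaces on $\mathbb{D}$, and $H^\infty$ is the space of bounded holomorphic functions. $\mathrm{BMOA}:=H^1\cap\mathrm{BMO}$, where $\mathrm{BMO}$ is the space of functions of bounded mean oscillation on $\mathbb{T}$ (functions in $H^1$ being identified with their boundary values). $\mathcal{N}$ (the Nevanlinna class) is the set of quotients $u/v$ with $u,v\in H^\infty$, $v$ zero-free in $\mathbb{D}$; $\mathcal{N}^+$ (the Smirnov class) is the set of quotients $u/v$ with $u,v\in H^\infty$, $v$ outer. For $X\subset\mathcal{H}(\mathbb{D})$: $X':=\{f':f\in X\}$; $X_m$ is the set of $f\in\mathcal{H}(\mathbb{D})$ with $f^{(k)}\in X$ for $k=0,\dots,m$; $\mathcal{Z}(X)$ is the collection of zero sets $g^{-1}(0)\subset\mathbb{D}$ (without multiplicities) of non-null functions $g\in X$. A zero of a holomorphic function is $n$-deep if its multiplicity is at least $n+1$. For linearly independent $f_0,\dots,f_n\in\mathcal{H}(\mathbb{D})$, $\mathcal{Z}(f_0,\dots,f_n)$ is the set of points $z\in\mathbb{D}$ for which there exist complex numbers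 $\lambda_0,\dots,\lambda_n$ (depending on $z$), not all zero, such that $\sum_{j=0}^n\lambda_jf_j$ has an $n$-deep zero at $z$. $\mathcal{Z}_n(X)$ is the collection of sets of the form $\mathcal{Z}(f_0,\dots,f_n)$ with $f_0,\dots,f_n$ linearly independent functions in $X$. *)

theory Defs
  imports "HOL-Complex_Analysis.Complex_Analysis"
begin

text \<open>
  A function on the open unit disk is represented by a total function on \<^typ>\<open>complex\<close>,
  of which only the values on \<^term>\<open>ball 0 1 :: complex set\<close> are relevant; likewise a function on
  the unit circle is read through \<^term>\<open>cis t\<close> only.  No condition below constrains the values
  elsewhere, and all spaces of functions on the disk consist of functions holomorphic there.
\<close>

abbreviation unit_disk :: "complex set" (\<open>\<D>\<close>)
  where "\<D> \<equiv> ball 0 1"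


subsection \<open>Function spaces\<close>

definition Hinf :: "(complex \<Rightarrow> complex) set" where
  "Hinf = {f. f holomorphic_on \<D> \<and> bounded (f ` \<D>)}"

definition hardy_mean :: "real \<Rightarrow> (complex \<Rightarrow> complex) \<Rightarrow> real \<Rightarrow> real" where
  "hardy_mean p f r =
     (LINT t:{0..2 * pi}|lebesgue. cmod (f (of_real r * cis t)) powr p) / (2 * pi)"

definition Hardy :: "real \<Rightarrow> (complex \<Rightarrow> complex) set" where
  "Hardy p = {f. f holomorphic_on \<D> \<and> bdd_above (hardy_mean p f ` {0<..<1})}"

text \<open>
  The arcs of the unit circle are the images under \<^const>\<open>cis\<close> of the intervals
  \<^term>\<open>{a..b}\<close> with \<^prop>\<open>a < b\<close> and \<^prop>\<open>b \<le> a + 2 * pi\<close>.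
\<close>

definition arc_mean :: "real \<Rightarrow> real \<Rightarrow> (complex \<Rightarrow> complex) \<Rightarrow> complex" where
  "arc_mean a b g = (LINT t:{a..b}|lebesgue. g (cis t)) / of_real (b - a)"

definition arc_oscillation :: "real \<Rightarrow> real \<Rightarrow> (complex \<Rightarrow> complex) \<Rightarrow> real" where
  "arc_oscillation a b g =
     (LINT t:{a..b}|lebesgue. cmod (g (cis t) - arc_mean a b g)) / (b - a)"

definition BMO :: "(complex \<Rightarrow> complex) set" where
  "BMO = {g. set_integrable lebesgue {0..2 * pi} (\<lambda>t. g (cis t)) \<and>
             (\<exists>C. \<forall>a b. a < b \<and> b \<le> a + 2 * pi \<longrightarrow> arc_oscillation a b g \<le> C)}"

definition boundary_values :: "(complex \<Rightarrow> complex) \<Rightarrow> (complex \<Rightarrow> complex) \<Rightarrow> bool" where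
  "boundary_values f g \<longleftrightarrow>
     (AE t in lebesgue. ((\<lambda>r. f (of_real r * cis t)) \<longlongrightarrow> g (cis t)) (at_left 1))"

definition BMOA :: "(complex \<Rightarrow> complex) set" where
  "BMOA = {f \<in> Hardy 1. \<exists>g \<in> BMO. boundary_values f g}"

definition Nevanlinna :: "(complex \<Rightarrow> complex) set" where
  "Nevanlinna = {f. \<exists>u \<in> Hinf. \<exists>v \<in> Hinf. (\<forall>z \<in> \<D>. v z \<noteq> 0) \<and> (\<forall>z \<in> \<D>. f z = u z / v z)}"

text \<open>
  In the definition of outer functions, \<open>k\<close> is the logarithm of the boundary modulus.  Stating the
  integrability condition for \<open>k\<close> itself avoids the convention \<^prop>\<open>ln (0::real) = 0\<close>.
\<close>

definition outer :: "(complex \<Rightarrow> complex) \<Rightarrow> bool" where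
  "outer v \<longleftrightarrow>
     (\<exists>c k. cmod c = 1 \<and> set_integrable lebesgue {0..2 * pi} (k :: real \<Rightarrow> real) \<and>
        (\<forall>z \<in> \<D>. v z = c * exp ((LINT t:{0..2 * pi}|lebesgue.
                                     (cis t + z) / (cis t - z) * of_real (k t)) / (2 * pi))))"

definition Smirnov :: "(complex \<Rightarrow> complex) set" where
  "Smirnov = {f. \<exists>u \<in> Hinf. \<exists>v \<in> Hinf. outer v \<and> (\<forall>z \<in> \<D>. f z = u z / v z)}"

definition deriv_space :: "(complex \<Rightarrow> complex) set \<Rightarrow> (complex \<Rightarrow> complex) set" where
  "deriv_space X = {g. \<exists>f \<in> X. \<forall>z \<in> \<D>. g z = deriv f z}"

definition order_space :: "nat \<Rightarrow> (complex \<Rightarrow> complex) set \<Rightarrow> (complex \<Rightarrow> complex) set" where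
  "order_space m X = {f. f holomorphic_on \<D> \<and> (\<forall>k \<le> m. (deriv ^^ k) f \<in> X)}"


subsection \<open>Zero sets\<close>

definition zero_sets :: "(complex \<Rightarrow> complex) set \<Rightarrow> complex set set" where
  "zero_sets X = {{z \<in> \<D>. g z = 0} | g. g \<in> X \<and> (\<exists>z \<in> \<D>. g z \<noteq> 0)}"

text \<open>
  \<^const>\<open>zorder\<close> is meaningful only for functions that do not vanish identically near the point.
  Below, \<open>deep_zero\<close> is applied only to nontrivial combinations of linearly independent
  functions, which are non-null on the disk.
\<close>

definition deep_zero :: "nat \<Rightarrow> (complex \<Rightarrow> complex) \<Rightarrow> complex \<Rightarrow> bool" where
  "deep_zero n g z \<longleftrightarrow> g z = 0 \<and> zorder g z \<ge> int (n + 1)"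

definition lin_indep_disk :: "nat \<Rightarrow> (nat \<Rightarrow> complex \<Rightarrow> complex) \<Rightarrow> bool" where
  "lin_indep_disk n f \<longleftrightarrow>
     (\<forall>c :: nat \<Rightarrow> complex. (\<forall>z \<in> \<D>. (\<Sum>j\<le>n. c j * f j z) = 0) \<longrightarrow> (\<forall>j\<le>n. c j = 0))"

definition deep_zero_set :: "nat \<Rightarrow> (nat \<Rightarrow> complex \<Rightarrow> complex) \<Rightarrow> complex set" where
  "deep_zero_set n f =
     {z \<in> \<D>. \<exists>c :: nat \<Rightarrow> complex. (\<exists>j\<le>n. c j \<noteq> 0) \<and> deep_zero n (\<lambda>w. \<Sum>j\<le>n. c j * f j w) z}"

definition deep_zero_sets :: "nat \<Rightarrow> (complex \<Rightarrow> complex) set \<Rightarrow> complex set set" where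
  "deep_zero_sets n X = {deep_zero_set n f | f. (\<forall>j\<le>n. f j \<in> X) \<and> lin_indep_disk n f}"

end

theory Submission
  imports Defs "Jordan_Normal_Form.Determinant"
begin

text \<open>
  The theorem reduces to one class of functions: the finite sums of products \<open>g \<cdot> h'\<close> with
  \<open>g\<close> and \<open>h\<close> bounded and holomorphic on the disk.

  All four kinds of spaces consist of quotients \<open>u / v\<close> of bounded functions with zero-free \<open>v\<close>.
  A point is a deep zero of some combination of \<open>f\<^sub>0, \<dots>, f\<^sub>n\<close> exactly if their Wronskian vanishes
  there, and the Wronskian of independent functions is not the null function
  (\<open>deep_zero_set_wronskian\<close>, \<open>wronskian_nonnull\<close>).  If \<open>n = m + 1\<close> and the derivatives of the \<open>f\<^sub>j\<close>
  up to order \<open>m\<close> are such quotients, each term of the Leibniz expansion of the Wronskian is a product of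
  quotients and of one derivative of a quotient.  The rule \<open>(u / v)' = (v u' - u v') / v\<^sup>2\<close> then shows
  that the Wronskian is a sum of products \<open>g \<cdot> h'\<close>, divided by a bounded zero-free function
  (\<open>wronskian_deriv_quotient\<close>).  So it has the same zeros as \<open>H'\<close>, where \<open>H\<close> is a primitive of such a sum.

  The analytic core is that each such \<open>H\<close> lies in BMOA, in every Hardy space and in the Smirnov class.
  This gives one inclusion at once.  For the other one, a function \<open>f\<close> in BMOA is itself a quotient of
  bounded functions, so \<open>f'\<close> has the same zeros as some \<open>H'\<close> of this kind.  If \<open>F\<close> is an \<open>m\<close>-fold
  primitive of \<open>H\<close>, then \<open>1, z, \<dots>, z\<^sup>m, F\<close> have a triangular matrix of derivatives, their Wronskian is a
  constant multiple of \<open>H'\<close>, and the derivatives of \<open>F\<close> of order less than \<open>m\<close> are bounded.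

  The core rests on the weighted area norm with density \<open>1 - \<bar>z\<bar>\<^sup>2\<close>.  Parseval's identity compares the
  square mean of \<open>f\<close> with the area norm of \<open>f'\<close> in both directions, and the area norm is monotone in the
  modulus; therefore \<open>H' = g \<cdot> h'\<close> inherits a bound from \<open>h\<close>.  The product rule extends this by induction
  to all powers of \<open>H\<close> (\<open>primitive_power_bounds\<close>), which gives every Hardy space.  The hypotheses are
  invariant under Moebius maps, so the square means are bounded with respect to all Poisson kernels
  (\<open>garsia_primitive\<close>), and comparing an arc with the Poisson kernel of a suitable point bounds the mean
  oscillation (\<open>garsia_subset_BMOA\<close>).  The boundary function exists by Fatou's theorem (\<open>radial_limits_ae\<close>), which follows from a maximal inequality.

  Both factorisations into bounded functions come from one construction (\<open>bounded_multiplier\<close>):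
  \<open>log\<^sup>+ \<bar>f\<bar>\<close> is approximated on a circle from above by the real part of an entire function \<open>Q\<close>, and the
  maximum principle bounds \<open>exp (- Q)\<close> and \<open>f \<cdot> exp (- Q)\<close> by one.  Normal families give the quotient for
  functions in Hardy spaces, and convergence in mean to the boundary function identifies the limit of
  \<open>exp (- Q)\<close> as an outer function for functions with bounded square means.
\<close>

section \<open>Means over the unit circle\<close>

definition cmean :: "(complex \<Rightarrow> 'a::banach) \<Rightarrow> 'a" where
  "cmean F = (1 / (2 * pi)) *\<^sub>R integral {0..2 * pi} (\<lambda>t. F (cis t))"

abbreviation circle :: "complex set" (\<open>\<C>\<close>)
  where "\<C> \<equiv> sphere 0 1"

lemma continuous_on_circle_cis:
  assumes "continuous_on \<C> F"
  shows "continuous_on A (\<lambda>t. F (cis t))"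
  using assms by (rule continuous_on_compose2) (auto intro: continuous_intros)

lemma circle_integrable:
  assumes "continuous_on \<C> (F :: complex \<Rightarrow> 'a::banach)"
  shows "(\<lambda>t. F (cis t)) integrable_on {a..b}"
  by (intro integrable_continuous_real continuous_on_circle_cis assms)

lemma cmean_add:
  assumes "continuous_on \<C> F" "continuous_on \<C> G"
  shows "cmean (\<lambda>z. F z + G z) = cmean F + cmean G"
  unfolding cmean_def
  by (simp add: integral_add circle_integrable assms scaleR_add_right)

lemma cmean_diff:
  assumes "continuous_on \<C> F" "continuous_on \<C> G"
  shows "cmean (\<lambda>z. F z - G z) = cmean F - cmean G"
  unfolding cmean_def
  by (simp add: integral_diff circle_integrable assms scaleR_diff_right)

lemma cmean_mult_left:
  fixes F :: "complex \<Rightarrow> 'a::{real_normed_field,banach}"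
  shows "cmean (\<lambda>z. c * F z) = c * cmean F"
  unfolding cmean_def by simp

lemma cmean_const [simp]: "cmean (\<lambda>z. c) = c"
  unfolding cmean_def by simp

lemma cmean_cong:
  assumes "\<And>z. z \<in> \<C> \<Longrightarrow> F z = G z"
  shows "cmean F = cmean G"
  unfolding cmean_def by (simp add: assms)

lemma cmean_mono:
  fixes F G :: "complex \<Rightarrow> real"
  assumes "continuous_on \<C> F" "continuous_on \<C> G" "\<And>z. z \<in> \<C> \<Longrightarrow> F z \<le> G z"
  shows "cmean F \<le> cmean G"
  unfolding cmean_def
  by (auto intro!: divide_right_mono integral_le circle_integrable assms)

lemma cmean_nonneg:
  fixes F :: "complex \<Rightarrow> real"
  assumes "continuous_on \<C> F" "\<And>z. z \<in> \<C> \<Longrightarrow> 0 \<le> F z"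
  shows "0 \<le> cmean F"
  using cmean_mono[of "\<lambda>_. 0" F] assms by simp

lemma norm_cmean_le:
  assumes "continuous_on \<C> F"
  shows "norm (cmean F) \<le> cmean (\<lambda>z. norm (F z))"
proof -
  have "norm (integral {0..2 * pi} (\<lambda>t. F (cis t))) \<le> integral {0..2 * pi} (\<lambda>t. norm (F (cis t)))"
    by (intro integral_norm_bound_integral circle_integrable continuous_on_norm assms) auto
  then show ?thesis
    unfolding cmean_def by (simp add: divide_right_mono)
qed

lemma abs_cmean_le:
  fixes F :: "complex \<Rightarrow> real"
  shows "continuous_on \<C> F \<Longrightarrow> \<bar>cmean F\<bar> \<le> cmean (\<lambda>z. \<bar>F z\<bar>)"
  using norm_cmean_le[of F] by simp

lemma cmean_linear:
  assumes "bounded_linear h" "continuous_on \<C> F"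
  shows "cmean (\<lambda>z. h (F z)) = h (cmean F)"
proof -
  interpret bounded_linear h by fact
  show ?thesis
    using integral_linear[OF circle_integrable[OF assms(2)] assms(1), of 0 "2 * pi"]
    unfolding cmean_def o_def by (simp add: scaleR)
qed

lemmas cmean_Re = cmean_linear[OF bounded_linear_Re]
lemmas cmean_cnj = cmean_linear[OF bounded_linear_cnj]
lemmas cmean_of_real = cmean_linear[OF bounded_linear_of_real]

text \<open>
  The inequality expands \<open>0 \<le> (F - m)\<^sup>2\<close>, with \<open>m\<close> the weighted mean of \<open>F\<close>, under a weight of total mass one.
\<close>

lemma cmean_cauchy_schwarz:
  fixes F w :: "complex \<Rightarrow> real"
  assumes "continuous_on \<C> F" "continuous_on \<C> w" "\<And>z. z \<in> \<C> \<Longrightarrow> 0 \<le> w z" "cmean w = 1"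
  shows "(cmean (\<lambda>z. F z * w z))\<^sup>2 \<le> cmean (\<lambda>z. (F z)\<^sup>2 * w z)"
proof -
  define m where "m = cmean (\<lambda>z. F z * w z)"
  have "0 \<le> cmean (\<lambda>z. (F z - m)\<^sup>2 * w z)"
    by (intro cmean_nonneg continuous_intros assms mult_nonneg_nonneg zero_le_power2)
  also have "(\<lambda>z. (F z - m)\<^sup>2 * w z) =
      (\<lambda>z. ((F z)\<^sup>2 * w z - (2 * m) * (F z * w z)) + m\<^sup>2 * w z)"
    by (auto simp: power2_eq_square algebra_simps)
  also have "cmean \<dots> = (cmean (\<lambda>z. (F z)\<^sup>2 * w z) - 2 * m * m) + m\<^sup>2"
    by (subst cmean_add cmean_diff; (intro continuous_intros assms)?)
       (simp add: cmean_mult_left assms(4) m_def del: mult_minus_left,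
        subst cmean_diff, (intro continuous_intros assms)+, simp add: cmean_mult_left)
  finally show ?thesis
    by (simp add: m_def power2_eq_square)
qed

text \<open>Functions analytic near the closed disk are the natural domain of all formulas below.\<close>

lemma analytic_cball_imp_continuous:
  assumes "f analytic_on cball 0 1"
  shows "continuous_on (cball 0 1) f" "continuous_on \<C> f"
proof -
  show "continuous_on (cball 0 1) f"
    using assms analytic_imp_holomorphic holomorphic_on_imp_continuous_on by blast
  then show "continuous_on \<C> f"
    by (rule continuous_on_subset) auto
qed

text \<open>
  Cauchy's integral formula in the parametrisation by the angle, where \<open>du = \<i> u dt\<close>.
\<close>

lemma cauchy_cmean:
  assumes "f analytic_on cball 0 1" "a \<in> \<D>"
  shows "cmean (\<lambda>\<zeta>. f \<zeta> * (\<zeta> / (\<zeta> - a))) = f a"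
proof -
  have hol: "f holomorphic_on ball 0 1"
    using analytic_imp_holomorphic[OF assms(1)] by (rule holomorphic_on_subset) auto
  have "((\<lambda>u. f u/(u-a)) has_contour_integral (2 * of_real pi * \<i> * f a)) (circlepath 0 1)"
    using Cauchy_integral_circlepath[OF analytic_cball_imp_continuous(1)[OF assms(1)] hol] assms(2)
    by simp
  then have "((\<lambda>t. f (cis t) / (cis t - a) * \<i> * cis t) has_integral (2 * of_real pi * \<i> * f a))
        {0..2 * pi}"
    unfolding circlepath_def
    by (subst (asm) has_contour_integral_part_circlepath_iff) auto
  then have "((\<lambda>t. (1 / \<i>) * (f (cis t) / (cis t - a) * \<i> * cis t)) has_integral
      ((1 / \<i>) * (2 * of_real pi * \<i> * f a))) {0..2 * pi}"
    by (rule has_integral_mult_right)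
  then have "((\<lambda>t. f (cis t) * (cis t / (cis t - a))) has_integral (2 * of_real pi * f a)) {0..2 * pi}"
    by (simp add: field_simps)
  then show ?thesis
    unfolding cmean_def by (simp add: integral_unique scaleR_conv_of_real)
qed

lemma cmean_analytic:
  assumes "f analytic_on cball 0 1"
  shows "cmean f = f 0"
proof -
  have "cmean f = cmean (\<lambda>\<zeta>. f \<zeta> * (\<zeta> / (\<zeta> - 0)))"
    by (intro cmean_cong) auto
  then show ?thesis
    using cauchy_cmean[OF assms, of 0] by simp
qed

definition poisson :: "complex \<Rightarrow> complex \<Rightarrow> real" where
  "poisson a \<zeta> = (1 - (cmod a)\<^sup>2) / (cmod (\<zeta> - a))\<^sup>2"

text \<open>
  The real part is half the sum of \<open>Q\<close> and its conjugate.  The first half is Cauchy's formula.  In the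
  second half, \<open>cnj \<zeta> = 1 / \<zeta>\<close> on the circle turns the kernel into the conjugate of a function that is
  analytic on the closed disk, and the mean value property applies.
\<close>

lemma herglotz_cmean:
  assumes "Q analytic_on cball 0 1" "a \<in> \<D>"
  shows "cmean (\<lambda>\<zeta>. (\<zeta> + a) / (\<zeta> - a) * of_real (Re (Q \<zeta>))) = Q a - \<i> * of_real (Im (Q 0))"
proof -
  have ne: "\<zeta> \<noteq> a" "1 - cnj a * \<zeta> \<noteq> 0" if "\<zeta> \<in> \<C>" for \<zeta>
  proof -
    show "\<zeta> \<noteq> a" using that assms(2) by auto
    show "1 - cnj a * \<zeta> \<noteq> 0"
    proof
      assume "1 - cnj a * \<zeta> = 0"
      then have "cmod (cnj a * \<zeta>) = 1" by simp
      then show False using that assms(2) by (simp add: norm_mult)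
    qed
  qed
  have ne2: "1 - cnj a * \<zeta> \<noteq> 0" if "\<zeta> \<in> cball 0 1" for \<zeta>
  proof
    assume "1 - cnj a * \<zeta> = 0"
    then have "cmod a * cmod \<zeta> = 1" by (metis complex_mod_cnj eq_iff_diff_eq_0 norm_mult norm_one)
    moreover have "cmod a * cmod \<zeta> \<le> cmod a" using that by (simp add: mult_left_le)
    ultimately show False using assms(2) by simp
  qed
  note [continuous_intros] = analytic_cball_imp_continuous(2)[OF assms(1)]
  define A where "A = (\<lambda>\<zeta>. Q \<zeta> * (\<zeta> / (\<zeta> - a)))"
  define B where "B = (\<lambda>\<zeta>. Q \<zeta> * (2 / (1 - cnj a * \<zeta>) - 1))"
  have anB: "B analytic_on cball 0 1"
    unfolding B_def using ne2 by (intro analytic_intros assms(1)) auto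
  have contA: "continuous_on \<C> A"
    unfolding A_def using ne by (intro continuous_intros) auto
  have contB: "continuous_on \<C> B"
    by (rule analytic_cball_imp_continuous(2)[OF anB])
  have "(\<zeta> + a) / (\<zeta> - a) * of_real (Re (Q \<zeta>)) = (A \<zeta> - (1/2) * Q \<zeta>) + (1/2) * cnj (B \<zeta>)"
    if "\<zeta> \<in> \<C>" for \<zeta>
  proof -
    have z: "\<zeta> * cnj \<zeta> = 1" using that by (simp add: complex_norm_square[symmetric])
    have eq: "1 / (1 - a * cnj \<zeta>) = \<zeta> / (\<zeta> - a)"
    proof -
      have "1 - a * cnj \<zeta> \<noteq> 0" using ne(2)[OF that] by (metis complex_cnj_cnj complex_cnj_diff complex_cnj_mult complex_cnj_one complex_cnj_zero)
      moreover have "\<zeta> * (1 - a * cnj \<zeta>) = \<zeta> - a" using z by (simp add: algebra_simps)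
      ultimately show ?thesis using ne(1)[OF that] by (simp add: field_simps)
    qed
    have c: "cnj (B \<zeta>) = cnj (Q \<zeta>) * (2 * (\<zeta> / (\<zeta> - a)) - 1)"
      unfolding B_def eq[symmetric] by simp
    have d: "2 * (\<zeta> / (\<zeta> - a)) - 1 = (\<zeta> + a) / (\<zeta> - a)"
      using ne(1)[OF that] by (simp add: field_simps)
    have r: "complex_of_real (Re (Q \<zeta>)) = (Q \<zeta> + cnj (Q \<zeta>)) / 2"
      by (simp add: complex_add_cnj)
    have half: "w * ((q + q') / 2) = (1/2) * (q * w) + (1/2) * (q' * w)"
      "q * w - (1/2) * q = (1/2) * (q * (2 * w - 1))" for q q' w :: complex
      by (simp_all add: field_simps)
    have "A \<zeta> - (1/2) * Q \<zeta> = (1/2) * (Q \<zeta> * ((\<zeta> + a) / (\<zeta> - a)))"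
      unfolding A_def half(2) d ..
    then show ?thesis
      unfolding c d r half(1) by simp
  qed
  then have "cmean (\<lambda>\<zeta>. (\<zeta> + a) / (\<zeta> - a) * of_real (Re (Q \<zeta>))) =
      cmean (\<lambda>\<zeta>. (A \<zeta> - (1/2) * Q \<zeta>) + (1/2) * cnj (B \<zeta>))"
    by (intro cmean_cong) auto
  also have "\<dots> = cmean (\<lambda>\<zeta>. A \<zeta> - (1/2) * Q \<zeta>) + (1/2) * cmean (\<lambda>\<zeta>. cnj (B \<zeta>))"
    unfolding cmean_mult_left[of "1/2", symmetric]
    by (rule cmean_add) (intro continuous_intros contA contB)+
  also have "cmean (\<lambda>\<zeta>. A \<zeta> - (1/2) * Q \<zeta>) = cmean A - (1/2) * cmean Q"
    unfolding cmean_mult_left[of "1/2", symmetric]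
    by (rule cmean_diff) (intro continuous_intros contA)+
  also have "cmean A = Q a"
    unfolding A_def using assms by (rule cauchy_cmean)
  also have "cmean Q = Q 0"
    using assms(1) by (rule cmean_analytic)
  also have "cmean (\<lambda>\<zeta>. cnj (B \<zeta>)) = cnj (B 0)"
    using cmean_cnj[OF contB] cmean_analytic[OF anB] by simp
  also have "B 0 = Q 0" by (simp add: B_def)
  finally show ?thesis
    by (simp add: complex_eq_iff)
qed

lemma poisson_eq_Re:
  assumes "\<zeta> \<in> \<C>"
  shows "poisson a \<zeta> = Re ((\<zeta> + a) / (\<zeta> - a))"
proof -
  have "(\<zeta> + a) * cnj (\<zeta> - a) = (\<zeta> * cnj \<zeta> - a * cnj a) + (a * cnj \<zeta> - cnj (a * cnj \<zeta>))"
    by (simp add: algebra_simps)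
  then have "Re ((\<zeta> + a) * cnj (\<zeta> - a)) = Re (\<zeta> * cnj \<zeta> - a * cnj a)"
    by simp
  also have "\<dots> = 1 - (cmod a)\<^sup>2"
    using assms by (simp add: complex_norm_square[symmetric] flip: of_real_power)
  finally have "Re ((\<zeta> + a) * cnj (\<zeta> - a)) = 1 - (cmod a)\<^sup>2" .
  then show ?thesis
    unfolding poisson_def complex_div_cnj[of "\<zeta> + a"]
    by (simp add: Re_divide_of_real flip: of_real_power)
qed

lemma continuous_on_poisson:
  assumes "a \<in> \<D>"
  shows "continuous_on \<C> (poisson a)"
  unfolding poisson_def using assms by (intro continuous_intros) auto

lemma poisson_nonneg: "a \<in> \<D> \<Longrightarrow> 0 \<le> poisson a \<zeta>"
  by (simp add: poisson_def power_le_one)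

lemma poisson_le:
  assumes "a \<in> \<D>" "\<zeta> \<in> \<C>"
  shows "poisson a \<zeta> \<le> 2 / (1 - cmod a)"
proof -
  have le: "1 - cmod a \<le> cmod (\<zeta> - a)"
    using assms norm_triangle_ineq2[of \<zeta> a] by simp
  have pos: "0 < 1 - cmod a" using assms by simp
  have "poisson a \<zeta> \<le> (1 - (cmod a)\<^sup>2) / (1 - cmod a)\<^sup>2"
    unfolding poisson_def using le pos assms
    by (intro divide_left_mono power_mono mult_pos_pos zero_less_power) (auto simp: power_le_one)
  also have "\<dots> = (1 + cmod a) / (1 - cmod a)"
  proof -
    have "1 - (cmod a)\<^sup>2 = (1 + cmod a) * (1 - cmod a)" by (simp add: power2_eq_square algebra_simps)
    then show ?thesis using pos by (simp add: power2_eq_square)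
  qed
  also have "\<dots> \<le> 2 / (1 - cmod a)"
    using pos assms by (intro divide_right_mono) auto
  finally show ?thesis .
qed

lemma poisson_cmean_Re:
  assumes "Q analytic_on cball 0 1" "a \<in> \<D>"
  shows "cmean (\<lambda>\<zeta>. Re (Q \<zeta>) * poisson a \<zeta>) = Re (Q a)"
proof -
  have ne: "\<zeta> \<noteq> a" if "\<zeta> \<in> \<C>" for \<zeta> using that assms(2) by auto
  have "cmean (\<lambda>\<zeta>. Re (Q \<zeta>) * poisson a \<zeta>) =
        cmean (\<lambda>\<zeta>. Re ((\<zeta> + a) / (\<zeta> - a) * of_real (Re (Q \<zeta>))))"
    by (intro cmean_cong) (simp only: poisson_eq_Re Re_complex_of_real times_complex.sel
        Im_complex_of_real mult_zero_right diff_zero mult.commute)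
  also have "\<dots> = Re (cmean (\<lambda>\<zeta>. (\<zeta> + a) / (\<zeta> - a) * of_real (Re (Q \<zeta>))))"
    using ne by (intro cmean_Re continuous_intros analytic_cball_imp_continuous assms) auto
  also have "\<dots> = Re (Q a)"
    by (simp only: herglotz_cmean[OF assms]) simp
  finally show ?thesis .
qed

lemma poisson_cmean:
  assumes "Q analytic_on cball 0 1" "a \<in> \<D>"
  shows "cmean (\<lambda>\<zeta>. Q \<zeta> * of_real (poisson a \<zeta>)) = Q a"
proof -
  have c: "continuous_on \<C> (\<lambda>\<zeta>. Q \<zeta> * of_real (poisson a \<zeta>))"
    by (intro continuous_intros analytic_cball_imp_continuous assms continuous_on_poisson)
  have "Re (cmean (\<lambda>\<zeta>. Q \<zeta> * of_real (poisson a \<zeta>))) = Re (Q a)"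
    using poisson_cmean_Re[OF assms] cmean_Re[OF c] by simp
  moreover have "Re (cmean (\<lambda>\<zeta>. (- \<i>) * (Q \<zeta> * of_real (poisson a \<zeta>)))) = Re ((- \<i>) * Q a)"
  proof -
    have "(\<lambda>\<zeta>. - \<i> * Q \<zeta>) analytic_on cball 0 1"
      by (intro analytic_intros assms)
    from poisson_cmean_Re[OF this assms(2)]
    show ?thesis
      by (subst cmean_Re[symmetric]) (use c in \<open>auto intro!: continuous_intros\<close>)
  qed
  ultimately show ?thesis
    unfolding cmean_mult_left by (simp add: complex_eq_iff)
qed

lemma cmean_poisson_one:
  assumes "a \<in> \<D>"
  shows "cmean (poisson a) = 1"
  using poisson_cmean_Re[of "\<lambda>_. 1" a] assms by simp

section \<open>Approximation by real parts of entire functions\<close>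

text \<open>
  Real trigonometric polynomials.  Allowing \<open>\<zeta>\<close> and \<open>cnj \<zeta>\<close> in one monomial makes closure under
  products a direct computation.
\<close>

inductive trig :: "(complex \<Rightarrow> real) \<Rightarrow> bool" where
  trig_mono: "trig (\<lambda>\<zeta>. Re (c * \<zeta> ^ j * cnj \<zeta> ^ k))"
| trig_add: "trig f \<Longrightarrow> trig g \<Longrightarrow> trig (\<lambda>\<zeta>. f \<zeta> + g \<zeta>)"

lemma trig_mult:
  assumes "trig f" "trig g"
  shows "trig (\<lambda>\<zeta>. f \<zeta> * g \<zeta>)"
  using assms
proof (induction f)
  case (trig_mono c j k)
  from trig_mono show ?case
  proof (induction g)
    case (trig_mono d l m)
    have R: "Re A * Re B = Re (A * B / 2) + Re (A * cnj B / 2)" for A B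
      by (simp add: field_simps)
    have "(\<lambda>\<zeta>. Re (c * \<zeta> ^ j * cnj \<zeta> ^ k) * Re (d * \<zeta> ^ l * cnj \<zeta> ^ m)) =
      (\<lambda>\<zeta>. Re ((c * d / 2) * \<zeta> ^ (j + l) * cnj \<zeta> ^ (k + m)) +
          Re ((c * cnj d / 2) * \<zeta> ^ (j + m) * cnj \<zeta> ^ (k + l)))"
      unfolding R by (rule ext, rule arg_cong2[where f = "(+)"])
        (simp_all add: power_add mult_ac)
    then show ?case
      by (simp only: trig.intros)
  next
    case (trig_add f g)
    then show ?case using trig.trig_add by (auto simp: distrib_left)
  qed
next
  case (trig_add f g')
  then show ?case using trig.trig_add by (auto simp: distrib_right)
qed

lemma trig_real_polynomial:
  assumes "real_polynomial_function g"
  shows "trig g"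
  using assms
proof induction
  case (linear f)
  interpret bounded_linear f by fact
  define c where "c = of_real (f 1) - \<i> * of_real (f \<i>)"
  have "f \<zeta> = Re (c * \<zeta> ^ 1 * cnj \<zeta> ^ 0)" for \<zeta>
  proof -
    have "f \<zeta> = f (Re \<zeta> *\<^sub>R 1 + Im \<zeta> *\<^sub>R \<i>)"
      by (simp add: scaleR_conv_of_real complex_eq[symmetric] mult.commute)
    also have "\<dots> = Re \<zeta> * f 1 + Im \<zeta> * f \<i>"
      by (simp add: add scaleR)
    finally show ?thesis by (simp add: c_def)
  qed
  then have eq: "f = (\<lambda>\<zeta>. Re (c * \<zeta> ^ 1 * cnj \<zeta> ^ 0))" by (rule ext)
  show ?case by (subst eq, rule trig_mono)
next
  case (const c)
  show ?case using trig_mono[of "of_real c" 0 0] by simp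
qed (auto intro: trig_add trig_mult)

text \<open>
  On the circle \<open>\<zeta> \<cdot> cnj \<zeta> = 1\<close> cancels the smaller of the two exponents, and conjugation inside the
  real part removes a remaining power of \<open>cnj \<zeta>\<close>.
\<close>

lemma trig_eq_Re_entire:
  assumes "trig g"
  shows "\<exists>Q. Q holomorphic_on UNIV \<and> (\<forall>\<zeta>\<in>\<C>. g \<zeta> = Re (Q \<zeta>))"
  using assms
proof induction
  case (trig_mono c j k)
  show ?case
  proof (cases "k \<le> j")
    case True
    have "Re (c * \<zeta> ^ j * cnj \<zeta> ^ k) = Re (c * \<zeta> ^ (j - k))" if "\<zeta> \<in> \<C>" for \<zeta>
    proof -
      have z: "\<zeta> * cnj \<zeta> = 1" using that by (simp add: complex_norm_square[symmetric])
      have "\<zeta> ^ j * cnj \<zeta> ^ k = \<zeta> ^ (j - k) * (\<zeta> * cnj \<zeta>) ^ k"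
        using True by (simp add: power_mult_distrib power_add[symmetric] mult.assoc[symmetric])
      then show ?thesis by (simp add: z mult.assoc)
    qed
    then show ?thesis
      by (intro exI[of _ "\<lambda>\<zeta>. c * \<zeta> ^ (j - k)"]) (auto intro!: holomorphic_intros)
  next
    case False
    have "Re (c * \<zeta> ^ j * cnj \<zeta> ^ k) = Re (cnj c * \<zeta> ^ (k - j))" if "\<zeta> \<in> \<C>" for \<zeta>
    proof -
      have z: "\<zeta> * cnj \<zeta> = 1" using that by (simp add: complex_norm_square[symmetric])
      have "\<zeta> ^ j * cnj \<zeta> ^ k = cnj \<zeta> ^ (k - j) * (\<zeta> * cnj \<zeta>) ^ j"
        using False by (simp add: power_mult_distrib power_add[symmetric] mult_ac)
      then have "c * \<zeta> ^ j * cnj \<zeta> ^ k = cnj (cnj c * \<zeta> ^ (k - j))" by (simp add: z mult.assoc)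
      then show ?thesis by (metis complex_cnj(1) complex_cnj_cnj cnj.simps(1))
    qed
    then show ?thesis
      by (intro exI[of _ "\<lambda>\<zeta>. cnj c * \<zeta> ^ (k - j)"]) (auto intro!: holomorphic_intros)
  qed
next
  case (trig_add f g)
  then obtain P Q where "P holomorphic_on UNIV" "\<forall>\<zeta>\<in>\<C>. f \<zeta> = Re (P \<zeta>)"
    "Q holomorphic_on UNIV" "\<forall>\<zeta>\<in>\<C>. g \<zeta> = Re (Q \<zeta>)" by blast
  then show ?case
    by (intro exI[of _ "\<lambda>\<zeta>. P \<zeta> + Q \<zeta>"]) (auto intro!: holomorphic_intros)
qed

text \<open>
  The form of the Weierstrass theorem on which most of what follows depends: statements about continuous
  functions on the circle reduce to Cauchy's formula for entire functions.
\<close>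

lemma circle_approximation:
  assumes "continuous_on \<C> (F :: complex \<Rightarrow> real)" "0 < e"
  obtains Q where "Q holomorphic_on UNIV" "Im (Q 0) = 0" "\<And>\<zeta>. \<zeta> \<in> \<C> \<Longrightarrow> \<bar>F \<zeta> - Re (Q \<zeta>)\<bar> < e"
proof -
  obtain g where g: "real_polynomial_function g" "\<And>x. x \<in> \<C> \<Longrightarrow> \<bar>F x - g x\<bar> < e"
    using Stone_Weierstrass_real_polynomial_function[OF compact_sphere assms] by metis
  obtain Q where Q: "Q holomorphic_on UNIV" "\<forall>\<zeta>\<in>\<C>. g \<zeta> = Re (Q \<zeta>)"
    using trig_eq_Re_entire trig_real_polynomial g(1) by blast
  show ?thesis
  proof
    show "(\<lambda>z. Q z - \<i> * of_real (Im (Q 0))) holomorphic_on UNIV"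
      by (intro holomorphic_intros Q)
  qed (use g Q in auto)
qed

section \<open>Invariance of circle means\<close>

lemma entire_imp_analytic: "Q holomorphic_on UNIV \<Longrightarrow> Q analytic_on A"
  using analytic_on_open analytic_on_subset by blast

lemma entire_comp_analytic:
  assumes "Q holomorphic_on UNIV" "f analytic_on A"
  shows "(\<lambda>z. Q (f z)) analytic_on A"
  using analytic_on_compose[OF assms(2) entire_imp_analytic[OF assms(1)]] by (simp add: o_def)

text \<open>
  For the real part of an entire function \<open>Q\<close> both sides equal \<open>Re (Q (\<psi> 0))\<close>; the general case follows by
  uniform approximation.  Rotations and Moebius maps are the two applications.
\<close>

lemma cmean_compose_inner:
  fixes F :: "complex \<Rightarrow> real"
  assumes F: "continuous_on \<C> F" and psi: "\<psi> analytic_on cball 0 1"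
    and im: "\<psi> ` \<C> \<subseteq> \<C>" and in0: "\<psi> 0 \<in> \<D>"
  shows "cmean (\<lambda>\<zeta>. F (\<psi> \<zeta>)) = cmean (\<lambda>\<zeta>. F \<zeta> * poisson (\<psi> 0) \<zeta>)"
proof -
  define a where "a = \<psi> 0"
  have a: "a \<in> \<D>" using in0 by (simp add: a_def)
  note cp = continuous_on_poisson[OF a]
  have cpsi: "continuous_on \<C> \<psi>" by (rule analytic_cball_imp_continuous(2)[OF psi])
  have cF: "continuous_on \<C> (\<lambda>\<zeta>. F (\<psi> \<zeta>))"
    using F cpsi im by (rule continuous_on_compose2)
  have "\<bar>cmean (\<lambda>\<zeta>. F (\<psi> \<zeta>)) - cmean (\<lambda>\<zeta>. F \<zeta> * poisson a \<zeta>)\<bar> \<le> e" if "e > 0" for e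
  proof -
    obtain Q where Q: "Q holomorphic_on UNIV" "\<And>\<zeta>. \<zeta> \<in> \<C> \<Longrightarrow> \<bar>F \<zeta> - Re (Q \<zeta>)\<bar> < e/2"
      using circle_approximation[OF F, of "e/2"] \<open>e > 0\<close> by auto
    have cQ: "continuous_on A (\<lambda>\<zeta>. Re (Q \<zeta>))" for A
      using Q(1) by (intro continuous_intros) (meson holomorphic_on_imp_continuous_on holomorphic_on_subset subset_UNIV)
    have cQpsi: "continuous_on \<C> (\<lambda>\<zeta>. Re (Q (\<psi> \<zeta>)))"
      using cQ cpsi by (rule continuous_on_compose2[where t = UNIV]) auto
    have 1: "cmean (\<lambda>\<zeta>. Re (Q (\<psi> \<zeta>))) = Re (Q a)"
    proof -
      have an: "(\<lambda>\<zeta>. Q (\<psi> \<zeta>)) analytic_on cball 0 1"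
        by (rule entire_comp_analytic[OF Q(1) psi])
      show ?thesis
        using cmean_Re[OF analytic_cball_imp_continuous(2)[OF an]] cmean_analytic[OF an]
        by (simp add: a_def)
    qed
    have 2: "cmean (\<lambda>\<zeta>. Re (Q \<zeta>) * poisson a \<zeta>) = Re (Q a)"
      by (rule poisson_cmean_Re[OF entire_imp_analytic[OF Q(1)] a])
    have "\<bar>cmean (\<lambda>\<zeta>. F (\<psi> \<zeta>)) - Re (Q a)\<bar> = \<bar>cmean (\<lambda>\<zeta>. F (\<psi> \<zeta>) - Re (Q (\<psi> \<zeta>)))\<bar>"
      by (simp add: cmean_diff cF cQpsi 1)
    also have "\<dots> \<le> cmean (\<lambda>\<zeta>. \<bar>F (\<psi> \<zeta>) - Re (Q (\<psi> \<zeta>))\<bar>)"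
      by (rule abs_cmean_le) (intro continuous_intros cF cQpsi)
    also have "\<dots> \<le> cmean (\<lambda>\<zeta>. e / 2)"
    proof (intro cmean_mono continuous_on_rabs continuous_on_diff continuous_on_const cF cQpsi)
      fix \<zeta> :: complex assume "\<zeta> \<in> \<C>"
      then show "\<bar>F (\<psi> \<zeta>) - Re (Q (\<psi> \<zeta>))\<bar> \<le> e / 2"
        using im by (intro less_imp_le Q(2)) blast
    qed
    finally have A: "\<bar>cmean (\<lambda>\<zeta>. F (\<psi> \<zeta>)) - Re (Q a)\<bar> \<le> e / 2" by simp
    have "\<bar>cmean (\<lambda>\<zeta>. F \<zeta> * poisson a \<zeta>) - Re (Q a)\<bar> =
        \<bar>cmean (\<lambda>\<zeta>. F \<zeta> * poisson a \<zeta> - Re (Q \<zeta>) * poisson a \<zeta>)\<bar>"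
      by (subst cmean_diff) (auto simp: 2 intro!: continuous_intros F cQ cp)
    also have "\<dots> \<le> cmean (\<lambda>\<zeta>. \<bar>F \<zeta> * poisson a \<zeta> - Re (Q \<zeta>) * poisson a \<zeta>\<bar>)"
      by (rule abs_cmean_le) (intro continuous_intros F cQ cp)
    also have "\<dots> \<le> cmean (\<lambda>\<zeta>. e / 2 * poisson a \<zeta>)"
    proof (intro cmean_mono continuous_on_rabs continuous_on_diff continuous_on_mult continuous_on_const F cQ cp)
      fix \<zeta> :: complex assume z: "\<zeta> \<in> \<C>"
      have "\<bar>F \<zeta> * poisson a \<zeta> - Re (Q \<zeta>) * poisson a \<zeta>\<bar> = \<bar>F \<zeta> - Re (Q \<zeta>)\<bar> * poisson a \<zeta>"
        using poisson_nonneg[OF a, of \<zeta>] by (simp add: left_diff_distrib[symmetric] abs_mult)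
      also have "\<dots> \<le> e / 2 * poisson a \<zeta>"
        using Q(2)[OF z] poisson_nonneg[OF a] by (intro mult_right_mono) auto
      finally show "\<bar>F \<zeta> * poisson a \<zeta> - Re (Q \<zeta>) * poisson a \<zeta>\<bar> \<le> e / 2 * poisson a \<zeta>" .
    qed
    also have "\<dots> = e / 2"
      by (simp only: cmean_mult_left cmean_poisson_one[OF a] mult_1_right)
    finally show ?thesis using A by linarith
  qed
  then have "\<bar>cmean (\<lambda>\<zeta>. F (\<psi> \<zeta>)) - cmean (\<lambda>\<zeta>. F \<zeta> * poisson a \<zeta>)\<bar> \<le> 0"
    by (rule field_le_epsilon) simp
  then show ?thesis by (simp add: a_def)
qed

definition mobius :: "complex \<Rightarrow> complex \<Rightarrow> complex" where
  "mobius a z = (z + a) / (1 + cnj a * z)"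

lemma mobius_denom_nz:
  assumes "a \<in> \<D>" "z \<in> cball 0 1"
  shows "1 + cnj a * z \<noteq> 0"
proof
  assume "1 + cnj a * z = 0"
  then have "cnj a * z = -1" by (simp add: add_eq_0_iff)
  then have "cmod a * cmod z = 1" by (metis complex_mod_cnj norm_mult norm_minus_cancel norm_one)
  moreover have "cmod a * cmod z \<le> cmod a" using assms by (simp add: mult_left_le)
  ultimately show False using assms by simp
qed

lemma analytic_mobius:
  assumes "a \<in> \<D>"
  shows "mobius a analytic_on cball 0 1"
  unfolding mobius_def[abs_def] using mobius_denom_nz[OF assms] by (intro analytic_intros) auto

lemma mobius_0 [simp]: "mobius a 0 = a"
  by (simp add: mobius_def)

lemma mobius_cball:
  assumes "a \<in> \<D>" "z \<in> cball 0 1"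
  shows "mobius a z \<in> cball 0 1" and "z \<in> \<C> \<Longrightarrow> mobius a z \<in> \<C>"
proof -
  have "(cmod (1 + cnj a * z))\<^sup>2 - (cmod (z + a))\<^sup>2 = (1 - (cmod a)\<^sup>2) * (1 - (cmod z)\<^sup>2)"
    unfolding cmod_power2 by (simp add: power2_eq_square algebra_simps)
  moreover have "0 \<le> (1 - (cmod a)\<^sup>2) * (1 - (cmod z)\<^sup>2)"
    using assms by (intro mult_nonneg_nonneg) (auto simp: power_le_one)
  moreover have nz: "0 < cmod (1 + cnj a * z)"
    using mobius_denom_nz[OF assms] by simp
  ultimately have le: "(cmod (z + a))\<^sup>2 \<le> (cmod (1 + cnj a * z))\<^sup>2"
    and eq: "z \<in> \<C> \<Longrightarrow> (cmod (z + a))\<^sup>2 = (cmod (1 + cnj a * z))\<^sup>2"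
    by (linarith, simp)
  from le have "cmod (z + a) \<le> cmod (1 + cnj a * z)" by (rule power2_le_imp_le) simp
  then show "mobius a z \<in> cball 0 1" using nz by (simp add: mobius_def norm_divide)
  show "mobius a z \<in> \<C>" if "z \<in> \<C>"
    using eq[OF that] nz by (simp add: mobius_def norm_divide power2_eq_iff_nonneg)
qed

lemma cmean_mobius:
  fixes F :: "complex \<Rightarrow> real"
  assumes "continuous_on \<C> F" "a \<in> \<D>"
  shows "cmean (\<lambda>\<zeta>. F (mobius a \<zeta>)) = cmean (\<lambda>\<zeta>. F \<zeta> * poisson a \<zeta>)"
  using cmean_compose_inner[OF assms(1) analytic_mobius[OF assms(2)]] mobius_cball[OF assms(2)] assms(2)
  by (force simp: image_subset_iff)

lemma cmean_rotate:
  fixes F :: "complex \<Rightarrow> real"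
  assumes "continuous_on \<C> F"
  shows "cmean (\<lambda>\<zeta>. F (cis b * \<zeta>)) = cmean F"
proof -
  have "cmean (\<lambda>\<zeta>. F (cis b * \<zeta>)) = cmean (\<lambda>\<zeta>. F \<zeta> * poisson (cis b * 0) \<zeta>)"
    by (intro cmean_compose_inner assms analytic_intros) (auto simp: norm_mult)
  also have "\<dots> = cmean F"
    by (intro cmean_cong) (simp add: poisson_def)
  finally show ?thesis .
qed

section \<open>Parseval's identity and the weighted area norm\<close>

definition tcoef :: "(complex \<Rightarrow> complex) \<Rightarrow> nat \<Rightarrow> complex" where
  "tcoef f n = (deriv ^^ n) f 0 / fact n"

lemma analytic_cball_imp_holomorphic_ball:
  assumes "f analytic_on cball 0 1"
  obtains R where "1 < R" "f holomorphic_on ball (0::complex) R"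
proof -
  obtain S where S: "open S" "cball 0 1 \<subseteq> S" "f holomorphic_on S"
    using assms analytic_on_holomorphic by auto
  obtain e where e: "e > 0" "(\<Union>x\<in>cball 0 1. ball x e) \<subseteq> S"
    using compact_subset_open_imp_ball_epsilon_subset[OF compact_cball S(1,2)] by auto
  have "ball 0 (1 + e) \<subseteq> S"
  proof
    fix z :: complex assume z: "z \<in> ball 0 (1 + e)"
    show "z \<in> S"
    proof (cases "z \<in> cball 0 1")
      case True then show ?thesis using S by auto
    next
      case False
      then have n: "cmod z > 1" by simp
      have zz: "z / cmod z \<in> cball 0 1" using n by (simp add: norm_divide)
      have "z - z / cmod z = (1 - 1 / cmod z) *\<^sub>R z"
        by (simp add: scaleR_conv_of_real algebra_simps)
      then have "dist (z / cmod z) z = \<bar>1 - 1 / cmod z\<bar> * cmod z"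
        by (metis dist_commute dist_norm norm_scaleR)
      also have "\<dots> = cmod z - 1" 
      proof -
        have "1 - 1 / cmod z = (cmod z - 1) / cmod z" using n by (auto simp: diff_divide_distrib)
        then show ?thesis using n by auto
      qed
      finally have "z \<in> ball (z / cmod z) e" using z by simp
      then show ?thesis using e(2) zz by blast
    qed
  qed
  then show ?thesis
    using that[of "1 + e"] e(1) S(3) holomorphic_on_subset by auto
qed

lemma tcoef_sums:
  assumes "f analytic_on cball 0 1" "z \<in> cball 0 1"
  shows "(\<lambda>n. tcoef f n * z ^ n) sums f z" "summable (\<lambda>n. cmod (tcoef f n))"
proof -
  obtain R where R: "1 < R" "f holomorphic_on ball 0 R"
    using analytic_cball_imp_holomorphic_ball[OF assms(1)] .
  have s: "(\<lambda>n. tcoef f n * w ^ n) sums f w" if "w \<in> ball 0 R" for w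
    using holomorphic_power_series[OF R(2) that] by (simp add: tcoef_def)
  show "(\<lambda>n. tcoef f n * z ^ n) sums f z"
    by (rule s) (use R assms in auto)
  have "summable (\<lambda>n. tcoef f n * (of_real ((1 + R) / 2)) ^ n)"
    by (rule sums_summable[OF s]) (use R in \<open>auto simp del: of_real_add of_real_divide\<close>)
  then have "summable (\<lambda>n. norm (tcoef f n * 1 ^ n))"
    by (rule powser_insidea) (use R in \<open>simp del: of_real_add of_real_divide\<close>)
  then show "summable (\<lambda>n. cmod (tcoef f n))" by simp
qed

lemma cmean_tcoef:
  assumes "f analytic_on cball 0 1"
  shows "cmean (\<lambda>\<zeta>. f \<zeta> * cnj \<zeta> ^ n) = tcoef f n"
proof -
  have hol: "f holomorphic_on ball 0 1"
    using analytic_imp_holomorphic[OF assms(1)] by (rule holomorphic_on_subset) auto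
  have "((\<lambda>u. f u / (u - 0) ^ Suc n) has_contour_integral
          (2 * pi * \<i>) / fact n * (deriv ^^ n) f 0) (circlepath 0 1)"
    using Cauchy_has_contour_integral_higher_derivative_circlepath
      [OF analytic_cball_imp_continuous(1)[OF assms] hol, of 0 n] by simp
  then have "((\<lambda>t. f (cis t) / (cis t) ^ Suc n * \<i> * cis t) has_integral (2 * pi * \<i> * tcoef f n))
        {0..2 * pi}"
    unfolding circlepath_def tcoef_def
    by (subst (asm) has_contour_integral_part_circlepath_iff) auto
  then have "((\<lambda>t. (1 / \<i>) * (f (cis t) / (cis t) ^ Suc n * \<i> * cis t)) has_integral
      ((1 / \<i>) * (2 * pi * \<i> * tcoef f n))) {0..2 * pi}"
    by (rule has_integral_mult_right)
  then have "((\<lambda>t. f (cis t) * cnj (cis t) ^ n) has_integral (2 * pi * tcoef f n)) {0..2 * pi}"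
    by (simp add: cis_cnj field_simps flip: cis_inverse)
  then show ?thesis
    unfolding cmean_def by (simp add: integral_unique scaleR_conv_of_real)
qed

lemma cmean_sums:
  fixes F :: "nat \<Rightarrow> complex \<Rightarrow> complex"
  assumes "\<And>n. continuous_on \<C> (F n)" "\<And>n z. z \<in> \<C> \<Longrightarrow> norm (F n z) \<le> M n" "summable M"
  shows "(\<lambda>n. cmean (F n)) sums cmean (\<lambda>z. \<Sum>n. F n z)"
proof -
  have ul: "uniform_limit {0..2*pi} (\<lambda>N t. \<Sum>n<N. F n (cis t)) (\<lambda>t. \<Sum>n. F n (cis t)) sequentially"
    using assms by (intro Weierstrass_m_test) auto
  obtain I J where I: "\<And>N. ((\<lambda>t. \<Sum>n<N. F n (cis t)) has_integral I N) {0..2*pi}"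
    and J: "((\<lambda>t. \<Sum>n. F n (cis t)) has_integral J) {0..2*pi}" and lim: "I \<longlonglongrightarrow> J"
    by (rule uniform_limit_integral[OF ul])
       (auto intro!: continuous_on_sum continuous_on_circle_cis assms(1))
  have "I N = integral {0..2*pi} (\<lambda>t. \<Sum>n<N. F n (cis t))" for N
    using I[of N] by (simp add: integral_unique)
  also have "\<dots> N = (2*pi) *\<^sub>R (\<Sum>n<N. cmean (F n))" for N
    unfolding cmean_def
    by (subst integral_sum) (auto intro: circle_integrable assms simp flip: scaleR_sum_right)
  finally have I': "I = (\<lambda>N. (2*pi) *\<^sub>R (\<Sum>n<N. cmean (F n)))" by auto
  have "(\<lambda>N. (1 / (2*pi)) *\<^sub>R I N) \<longlonglongrightarrow> (1 / (2*pi)) *\<^sub>R J"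
    by (intro tendsto_intros lim)
  then show ?thesis
    unfolding sums_def I' using J by (simp add: cmean_def integral_unique)
qed

text \<open>
  The series of \<open>cnj f\<close> converges uniformly on the circle, and the mean of \<open>f \<zeta> \<cdot> cnj \<zeta> ^ n\<close> is a Taylor
  coefficient of \<open>f\<close>.
\<close>

lemma parseval:
  assumes "f analytic_on cball 0 1"
  shows "(\<lambda>n. (cmod (tcoef f n))\<^sup>2) sums cmean (\<lambda>\<zeta>. (cmod (f \<zeta>))\<^sup>2)"
proof -
  note c = analytic_cball_imp_continuous(2)[OF assms]
  have "bounded (f ` \<C>)"
    using c by (intro compact_imp_bounded compact_continuous_image) auto
  then obtain B where B: "\<And>\<zeta>. \<zeta> \<in> \<C> \<Longrightarrow> cmod (f \<zeta>) \<le> B"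
    unfolding bounded_iff by (metis imageI)
  have "(\<lambda>n. cmean (\<lambda>\<zeta>. cnj (tcoef f n) * (f \<zeta> * cnj \<zeta> ^ n))) sums
        cmean (\<lambda>\<zeta>. \<Sum>n. cnj (tcoef f n) * (f \<zeta> * cnj \<zeta> ^ n))"
  proof (rule cmean_sums)
    show "summable (\<lambda>n. cmod (tcoef f n) * B)"
      using tcoef_sums(2)[OF assms, of 0] by (intro summable_mult2) auto
    show "norm (cnj (tcoef f n) * (f \<zeta> * cnj \<zeta> ^ n)) \<le> cmod (tcoef f n) * B"
      if "\<zeta> \<in> \<C>" for n \<zeta>
      using B[OF that] that by (auto simp: norm_mult norm_power intro!: mult_left_mono)
  qed (intro continuous_intros c)
  also have "(\<lambda>n. cmean (\<lambda>\<zeta>. cnj (tcoef f n) * (f \<zeta> * cnj \<zeta> ^ n))) = (\<lambda>n. of_real ((cmod (tcoef f n))\<^sup>2))"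
    unfolding cmean_mult_left cmean_tcoef[OF assms] complex_norm_square
    by (rule ext, rule mult.commute)
  also have "cmean (\<lambda>\<zeta>. \<Sum>n. cnj (tcoef f n) * (f \<zeta> * cnj \<zeta> ^ n)) = 
      cmean (\<lambda>\<zeta>. of_real ((cmod (f \<zeta>))\<^sup>2))"
  proof (rule cmean_cong)
    fix \<zeta> :: complex assume z: "\<zeta> \<in> \<C>"
    have "(\<lambda>n. cnj (tcoef f n * \<zeta> ^ n) * f \<zeta>) sums (cnj (f \<zeta>) * f \<zeta>)"
      using tcoef_sums(1)[OF assms, of \<zeta>] z by (intro sums_mult2) (simp only: sums_cnj, auto)
    then have "(\<Sum>n. cnj (tcoef f n) * (f \<zeta> * cnj \<zeta> ^ n)) = cnj (f \<zeta>) * f \<zeta>"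
      by (simp add: sums_unique[symmetric] mult_ac)
    then show "(\<Sum>n. cnj (tcoef f n) * (f \<zeta> * cnj \<zeta> ^ n)) = of_real ((cmod (f \<zeta>))\<^sup>2)"
      unfolding complex_norm_square by (simp add: mult.commute)
  qed
  also have "\<dots> = of_real (cmean (\<lambda>\<zeta>. (cmod (f \<zeta>))\<^sup>2))"
    by (intro cmean_of_real continuous_intros c)
  finally show ?thesis by (simp only: sums_of_real_iff)
qed

lemma analytic_scale:
  assumes "f analytic_on cball 0 1" "cmod c \<le> 1"
  shows "(\<lambda>z. f (c * z)) analytic_on cball 0 1"
proof -
  have "(f \<circ> (\<lambda>z. c * z)) analytic_on cball 0 1"
  proof (rule analytic_on_compose)
    show "f analytic_on (*) c ` cball 0 1"
      using assms(2) by (intro analytic_on_subset[OF assms(1)]) (auto simp: norm_mult mult_le_one)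
  qed (intro analytic_intros)
  then show ?thesis by (simp add: o_def)
qed

lemma tcoef_scale:
  assumes "f holomorphic_on \<D>" "cmod c \<le> 1"
  shows "tcoef (\<lambda>z. f (c * z)) n = c ^ n * tcoef f n"
proof -
  have "(deriv ^^ n) (\<lambda>w. f (c * w)) 0 = c ^ n * (deriv ^^ n) f (c * 0)"
  proof (rule higher_deriv_compose_linear[of f "\<D>" "\<D>"])
    fix w :: complex assume "w \<in> \<D>"
    then show "c * w \<in> \<D>" 
      using assms(2) by (simp add: norm_mult) (metis mult_left_le_one_le norm_ge_zero order_le_less_trans)
  qed (use assms in auto)
  then show ?thesis by (simp add: tcoef_def)
qed

text \<open>
  The weight \<open>1 / ((n + 1) (n + 2))\<close> is the integral of \<open>s ^ n (1 - s)\<close> over the unit interval, so the claim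
  integrates a nonnegative function termwise.
\<close>

lemma nonneg_moments:
  fixes e :: "nat \<Rightarrow> real"
  assumes "summable (\<lambda>n. \<bar>e n\<bar>)" "\<And>s. s \<in> {0..1} \<Longrightarrow> 0 \<le> (\<Sum>n. e n * s ^ n)"
  shows "0 \<le> (\<Sum>n. e n / (real (n + 1) * real (n + 2)))"
proof -
  have ul: "uniform_limit {0..1} (\<lambda>N s. \<Sum>n<N. e n * s ^ n * (1 - s))
        (\<lambda>s. \<Sum>n. e n * s ^ n * (1 - s)) sequentially"
  proof (rule Weierstrass_m_test)
    show "norm (e n * s ^ n * (1 - s)) \<le> \<bar>e n\<bar>" if "s \<in> {0..1}" for n s
    proof -
      have "\<bar>s ^ n * (1 - s)\<bar> \<le> 1"
        using that by (auto simp: abs_mult mult_le_one power_le_one)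
      then show ?thesis by (simp add: abs_mult mult.assoc mult_left_le)
    qed
  qed (use assms in auto)
  have mom: "((\<lambda>s. e n * s ^ n * (1 - s)) has_integral e n / (real (n + 1) * real (n + 2))) {0..1}" for n
  proof -
    let ?F = "\<lambda>s. s ^ Suc n / real (Suc n) - s ^ Suc (Suc n) / real (Suc (Suc n))"
    have "((\<lambda>s. s ^ n - s ^ Suc n) has_integral (?F 1 - ?F 0)) {0..1}"
    proof (rule fundamental_theorem_of_calculus)
      fix x :: real
      have d: "((\<lambda>s. s ^ Suc k / real (Suc k)) has_real_derivative x ^ k) (at x within {0..1})" for k
        by (auto intro!: derivative_eq_intros simp del: of_nat_Suc power_Suc)
      show "(?F has_vector_derivative x ^ n - x ^ Suc n) (at x within {0..1})"
        using DERIV_diff[OF d[of n] d[of "Suc n"]]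
        by (simp only: has_real_derivative_iff_has_vector_derivative)
    qed simp
    then have "((\<lambda>s. e n * (s ^ n - s ^ Suc n)) has_integral e n * (?F 1 - ?F 0)) {0..1}"
      by (rule has_integral_mult_right)
    moreover have "?F 1 - ?F 0 = 1 / (real (n + 1) * real (n + 2))"
      by (simp add: divide_simps)
    moreover have "e n * (s ^ n - s ^ Suc n) = e n * s ^ n * (1 - s)" for s
      by (simp add: algebra_simps)
    ultimately show ?thesis by (simp only:) simp
  qed
  have contN: "continuous_on {0..1} (\<lambda>s. \<Sum>n<N. e n * s ^ n * (1 - s))" for N
    by (intro continuous_intros)
  obtain I J where I: "\<And>N. ((\<lambda>s. \<Sum>n<N. e n * s ^ n * (1 - s)) has_integral I N) {0..1}"
    and J: "((\<lambda>s. \<Sum>n. e n * s ^ n * (1 - s)) has_integral J) {0..1}" and lim: "I \<longlonglongrightarrow> J"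
    by (rule uniform_limit_integral[OF ul contN]) auto
  have "((\<lambda>s. \<Sum>n<N. e n * s ^ n * (1 - s)) has_integral (\<Sum>n<N. e n / (real (n + 1) * real (n + 2)))) {0..1}" for N
    by (intro has_integral_sum mom) auto
  then have "I = (\<lambda>N. \<Sum>n<N. e n / (real (n + 1) * real (n + 2)))"
    using I has_integral_unique by blast
  with lim have "(\<lambda>n. e n / (real (n + 1) * real (n + 2))) sums J" by (simp add: sums_def)
  moreover have "0 \<le> J"
  proof (rule has_integral_nonneg[OF J])
    fix s :: real assume s: "s \<in> {0..1}"
    have "summable (\<lambda>n. e n * s ^ n)"
    proof (rule summable_comparison_test'[OF assms(1), of 0])
      show "norm (e n * s ^ n) \<le> \<bar>e n\<bar>" for n
        using s mult_left_le[of "s ^ n" "\<bar>e n\<bar>"] by (simp add: abs_mult power_le_one)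
    qed
    then have "(\<Sum>n. e n * s ^ n * (1 - s)) = (\<Sum>n. e n * s ^ n) * (1 - s)"
      by (simp add: suminf_mult2)
    then show "0 \<le> (\<Sum>n. e n * s ^ n * (1 - s))"
      using assms(2)[OF s] s by simp
  qed
  ultimately show ?thesis by (simp add: sums_unique[symmetric])
qed

text \<open>
  This is \<open>1 / \<pi>\<close> times the integral of \<open>\<bar>f z\<bar>\<^sup>2 (1 - \<bar>z\<bar>\<^sup>2)\<close> over the unit disk, written in terms of the
  Taylor coefficients.
\<close>

definition area :: "(complex \<Rightarrow> complex) \<Rightarrow> real" where
  "area f = (\<Sum>n. (cmod (tcoef f n))\<^sup>2 / (real (n + 1) * real (n + 2)))"

lemma summable_weighted:
  assumes "summable c" "\<And>n. 0 \<le> c n"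
  shows "summable (\<lambda>n. c n / (real (n + 1) * real (n + 2)))"
proof (rule summable_comparison_test'[OF assms(1), of 0])
  show "norm (c n / (real (n + 1) * real (n + 2))) \<le> c n" for n
  proof -
    have "1 \<le> real (n + 1) * real (n + 2)" by (simp add: algebra_simps)
    then have "c n / (real (n + 1) * real (n + 2)) \<le> c n / 1"
      using assms(2) by (intro divide_left_mono) auto
    then show ?thesis using assms(2)[of n] by simp
  qed
qed

lemma summable_area:
  assumes "f analytic_on cball 0 1"
  shows "summable (\<lambda>n. (cmod (tcoef f n))\<^sup>2 / (real (n + 1) * real (n + 2)))"
  using sums_summable[OF parseval[OF assms]] by (intro summable_weighted) auto

lemma parseval_dilated:
  assumes "f analytic_on cball 0 1" "s \<in> {0..1}"
  shows "(\<lambda>n. (cmod (tcoef f n))\<^sup>2 * s ^ n) sums cmean (\<lambda>\<zeta>. (cmod (f (of_real (sqrt s) * \<zeta>)))\<^sup>2)"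
proof -
  have n: "cmod (of_real (sqrt s)) \<le> 1" using assms(2) by simp
  have hol: "f holomorphic_on \<D>"
    using analytic_imp_holomorphic[OF assms(1)] by (rule holomorphic_on_subset) auto
  have "(cmod (of_real (sqrt s) ^ n * tcoef f n))\<^sup>2 = (cmod (tcoef f n))\<^sup>2 * s ^ n" for n
  proof -
    have "((sqrt s) ^ n)\<^sup>2 = s ^ n"
      using assms(2) by (simp flip: power_mult add: mult.commute[of n]) (simp add: power_mult)
    then show ?thesis
      using assms(2) by (simp add: norm_mult norm_power power_mult_distrib)
  qed
  then show ?thesis
    using parseval[OF analytic_scale[OF assms(1) n]] by (simp add: tcoef_scale[OF hol n])
qed

text \<open>
  Parseval's identity on each circle of radius \<open>sqrt s\<close> turns the pointwise bound into an inequality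
  between two power series in \<open>s\<close>, to which \<open>nonneg_moments\<close> applies.
\<close>

lemma area_mono:
  assumes k1: "k1 analytic_on cball 0 1" and k2: "k2 analytic_on cball 0 1"
    and le: "\<And>z. z \<in> cball 0 1 \<Longrightarrow> cmod (k1 z) \<le> G * cmod (k2 z)"
  shows "area k1 \<le> G\<^sup>2 * area k2"
proof -
  define e where "e n = G\<^sup>2 * (cmod (tcoef k2 n))\<^sup>2 - (cmod (tcoef k1 n))\<^sup>2" for n
  note s1 = sums_summable[OF parseval[OF k1]] and s2 = sums_summable[OF parseval[OF k2]]
  have "0 \<le> (\<Sum>n. e n / (real (n + 1) * real (n + 2)))"
  proof (rule nonneg_moments)
    show "summable (\<lambda>n. \<bar>e n\<bar>)"
    proof (rule summable_comparison_test'[of _ 0])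
      show "summable (\<lambda>n. G\<^sup>2 * (cmod (tcoef k2 n))\<^sup>2 + (cmod (tcoef k1 n))\<^sup>2)"
        by (intro summable_add summable_mult s1 s2)
      show "norm \<bar>e n\<bar> \<le> G\<^sup>2 * (cmod (tcoef k2 n))\<^sup>2 + (cmod (tcoef k1 n))\<^sup>2" for n
        unfolding e_def by (simp add: abs_le_iff)
    qed
    fix s :: real assume s: "s \<in> {0..1}"
    let ?r = "of_real (sqrt s) :: complex"
    have r: "cmod ?r \<le> 1" using s by simp
    have "(\<lambda>n. e n * s ^ n) sums (G\<^sup>2 * cmean (\<lambda>\<zeta>. (cmod (k2 (?r * \<zeta>)))\<^sup>2) - cmean (\<lambda>\<zeta>. (cmod (k1 (?r * \<zeta>)))\<^sup>2))"
      using sums_diff[OF sums_mult[OF parseval_dilated[OF k2 s], of "G\<^sup>2"] parseval_dilated[OF k1 s]]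
      by (simp add: e_def algebra_simps)
    moreover have "cmean (\<lambda>\<zeta>. (cmod (k1 (?r * \<zeta>)))\<^sup>2) \<le> cmean (\<lambda>\<zeta>. G\<^sup>2 * (cmod (k2 (?r * \<zeta>)))\<^sup>2)"
    proof (intro cmean_mono continuous_intros analytic_cball_imp_continuous analytic_scale r k1 k2)
      fix \<zeta> :: complex assume z: "\<zeta> \<in> \<C>"
      then have "?r * \<zeta> \<in> cball 0 1" using s by (simp add: norm_mult)
      from le[OF this] have "(cmod (k1 (?r * \<zeta>)))\<^sup>2 \<le> (G * cmod (k2 (?r * \<zeta>)))\<^sup>2"
        by (rule power_mono) simp
      then show "(cmod (k1 (?r * \<zeta>)))\<^sup>2 \<le> G\<^sup>2 * (cmod (k2 (?r * \<zeta>)))\<^sup>2"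
        by (simp add: power_mult_distrib)
    qed
    ultimately show "0 \<le> (\<Sum>n. e n * s ^ n)"
      by (simp add: sums_unique[symmetric] cmean_mult_left)
  qed
  also have "(\<Sum>n. e n / (real (n + 1) * real (n + 2))) = G\<^sup>2 * area k2 - area k1"
    unfolding area_def e_def
    by (simp add: diff_divide_distrib suminf_diff[symmetric] suminf_mult[symmetric] summable_area k1 k2
        summable_mult summable_area[OF k2, simplified] summable_area[OF k1, simplified]
        del: times_divide_eq_right add: times_divide_eq_right[symmetric])
  finally show ?thesis by simp
qed

lemma tcoef_add:
  assumes "f analytic_on cball 0 1" "g analytic_on cball 0 1"
  shows "tcoef (\<lambda>z. f z + g z) n = tcoef f n + tcoef g n"
proof -
  have "f analytic_on {0}" "g analytic_on {0}"
    using assms analytic_on_subset by fastforce+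
  then show ?thesis
    by (simp add: tcoef_def higher_deriv_add_at add_divide_distrib)
qed

lemma area_add:
  assumes f: "f analytic_on cball 0 1" and g: "g analytic_on cball 0 1"
  shows "area (\<lambda>z. f z + g z) \<le> 2 * area f + 2 * area g"
proof -
  have "area (\<lambda>z. f z + g z) \<le> (\<Sum>n. 2 * ((cmod (tcoef f n))\<^sup>2 / (real (n + 1) * real (n + 2)))
      + 2 * ((cmod (tcoef g n))\<^sup>2 / (real (n + 1) * real (n + 2))))"
    unfolding area_def
  proof (rule suminf_le)
    show "summable (\<lambda>n. 2 * ((cmod (tcoef f n))\<^sup>2 / (real (n + 1) * real (n + 2)))
      + 2 * ((cmod (tcoef g n))\<^sup>2 / (real (n + 1) * real (n + 2))))"
      by (intro summable_add summable_mult summable_area f g)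
    show "summable (\<lambda>n. (cmod (tcoef (\<lambda>z. f z + g z) n))\<^sup>2 / (real (n + 1) * real (n + 2)))"
      by (intro summable_area analytic_intros f g)
    fix n
    have "(cmod (tcoef f n + tcoef g n))\<^sup>2 \<le> (cmod (tcoef f n) + cmod (tcoef g n))\<^sup>2"
      by (intro power_mono norm_triangle_ineq) auto
    also have "\<dots> \<le> 2 * (cmod (tcoef f n))\<^sup>2 + 2 * (cmod (tcoef g n))\<^sup>2"
      using sum_squares_bound[of "cmod (tcoef f n)" "cmod (tcoef g n)"]
      by (simp add: power2_sum)
    finally show "(cmod (tcoef (\<lambda>z. f z + g z) n))\<^sup>2 / (real (n + 1) * real (n + 2))
        \<le> 2 * ((cmod (tcoef f n))\<^sup>2 / (real (n + 1) * real (n + 2)))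
      + 2 * ((cmod (tcoef g n))\<^sup>2 / (real (n + 1) * real (n + 2)))"
      unfolding tcoef_add[OF f g]
      by (simp only: times_divide_eq_right add_divide_distrib[symmetric]) (rule divide_right_mono, auto)
  qed
  also have "\<dots> = 2 * area f + 2 * area g"
    unfolding area_def
    by (subst suminf_add[symmetric]) (intro summable_mult summable_area f g | simp only: suminf_mult summable_area f g)+
  finally show ?thesis .
qed

lemma tcoef_deriv: "tcoef (deriv f) n = of_nat (n + 1) * tcoef f (n + 1)"
  unfolding tcoef_def by (simp add: funpow_swap1[symmetric] field_simps del: of_nat_Suc)

lemma tcoef_deriv_weight:
  "(cmod (tcoef (deriv f) n))\<^sup>2 / (real (n + 1) * real (n + 2)) =
    (real (n + 1) / real (n + 2)) * (cmod (tcoef f (n + 1)))\<^sup>2"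
proof -
  have "(a\<^sup>2 * x) / (a * b) = a / b * x" if "a \<noteq> 0" for a b x :: real
    using that by (simp add: power2_eq_square)
  then show ?thesis
    unfolding tcoef_deriv norm_mult norm_of_nat power_mult_distrib by simp
qed

text \<open>
  Together with \<open>cmean_le_area_deriv\<close> this is the Littlewood-Paley identity up to a factor two: the
  coefficient of \<open>\<bar>c\<bar>\<^sup>2\<close> for the \<open>(n + 1)\<close>-st Taylor coefficient \<open>c\<close> is \<open>(n + 1) / (n + 2)\<close>, which lies between
  \<open>1 / 2\<close> and \<open>1\<close>.
\<close>

lemma area_deriv_le:
  assumes f: "f analytic_on cball 0 1"
  shows "area (deriv f) \<le> cmean (\<lambda>\<zeta>. (cmod (f \<zeta>))\<^sup>2)"
proof -
  let ?c = "\<lambda>n. (cmod (tcoef f n))\<^sup>2"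
  note p = parseval[OF f]
  have "area (deriv f) \<le> (\<Sum>n. ?c (n + 1))"
    unfolding area_def
  proof (rule suminf_le)
    show "summable (\<lambda>n. ?c (n + 1))"
      using sums_summable[OF p] by (rule summable_ignore_initial_segment)
    show "summable (\<lambda>n. (cmod (tcoef (deriv f) n))\<^sup>2 / (real (n + 1) * real (n + 2)))"
      by (intro summable_area analytic_deriv f)
    show "(cmod (tcoef (deriv f) n))\<^sup>2 / (real (n + 1) * real (n + 2)) \<le> ?c (n + 1)" for n
      unfolding tcoef_deriv_weight by (rule mult_left_le_one_le) auto
  qed
  also have "\<dots> \<le> (\<Sum>n. ?c n)"
    using suminf_split_initial_segment[OF sums_summable[OF p], of 1] by simp
  also have "\<dots> = cmean (\<lambda>\<zeta>. (cmod (f \<zeta>))\<^sup>2)"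
    by (rule sums_unique[OF p, symmetric])
  finally show ?thesis .
qed

lemma cmean_le_area_deriv:
  assumes f: "f analytic_on cball 0 1" and 0: "f 0 = 0"
  shows "cmean (\<lambda>\<zeta>. (cmod (f \<zeta>))\<^sup>2) \<le> 2 * area (deriv f)"
proof -
  let ?c = "\<lambda>n. (cmod (tcoef f n))\<^sup>2"
  note p = parseval[OF f]
  have "cmean (\<lambda>\<zeta>. (cmod (f \<zeta>))\<^sup>2) = (\<Sum>n. ?c n)"
    using p by (simp add: sums_unique)
  also have "\<dots> = (\<Sum>n. ?c (n + 1))"
    using suminf_split_initial_segment[OF sums_summable[OF p], of 1] 0 by (simp add: tcoef_def)
  also have "\<dots> \<le> (\<Sum>n. 2 * ((cmod (tcoef (deriv f) n))\<^sup>2 / (real (n + 1) * real (n + 2))))"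
  proof (rule suminf_le)
    show "summable (\<lambda>n. ?c (n + 1))"
      using sums_summable[OF p] by (rule summable_ignore_initial_segment)
    show "summable (\<lambda>n. 2 * ((cmod (tcoef (deriv f) n))\<^sup>2 / (real (n + 1) * real (n + 2))))"
      by (intro summable_mult summable_area analytic_deriv f)
    fix n
    have "1 * ?c (n + 1) \<le> (2 * (real (n + 1) / real (n + 2))) * ?c (n + 1)"
      by (rule mult_right_mono) auto
    then show "?c (n + 1) \<le> 2 * ((cmod (tcoef (deriv f) n))\<^sup>2 / (real (n + 1) * real (n + 2)))"
      unfolding tcoef_deriv_weight by (simp only: mult_1 mult.assoc)
  qed
  also have "\<dots> = 2 * area (deriv f)"
    unfolding area_def by (intro suminf_mult summable_area analytic_deriv f)
  finally show ?thesis .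
qed

section \<open>Mean values of powers of primitives\<close>

lemma area_scale_le:
  assumes "f analytic_on cball 0 1" "k analytic_on cball 0 1"
    "\<And>z. z \<in> cball 0 1 \<Longrightarrow> cmod (k z) \<le> G * cmod (f z)" "area f \<le> C"
  shows "area k \<le> G\<^sup>2 * C"
  using area_mono[OF assms(2,1,3)] mult_left_mono[OF assms(4), of "G\<^sup>2"] by simp

text \<open>
  The hypotheses on a primitive \<open>H\<close> of \<open>g \<cdot> h'\<close>.  They survive composition with self-maps of the disk, apart
  from the normalisation at the origin.
\<close>

definition primitive_data ::
  "real \<Rightarrow> real \<Rightarrow> (complex \<Rightarrow> complex) \<Rightarrow> (complex \<Rightarrow> complex) \<Rightarrow> (complex \<Rightarrow> complex) \<Rightarrow> bool" where
  "primitive_data G B g h H \<longleftrightarrow>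
     g analytic_on cball 0 1 \<and> h analytic_on cball 0 1 \<and> H analytic_on cball 0 1 \<and> H 0 = 0 \<and>
     (\<forall>z\<in>cball 0 1. cmod (g z) \<le> G \<and> cmod (h z) \<le> B \<and> deriv H z = g z * deriv h z)"

text \<open>
  The two bounds support each other in the induction on \<open>k\<close>.  Since \<open>(H^(k+1))' = (k+1) H^k g h'\<close>, the area
  norm of \<open>H^k h'\<close> bounds the square mean of \<open>H^(k+1)\<close>.  Conversely the product rule gives
  \<open>H^(k+1) h' = (H^(k+1) h)' - (k+1) H^k g h h'\<close>, where the first term is controlled by the square mean of
  \<open>H^(k+1)\<close> and the second by the area norm of \<open>H^k h'\<close>.
\<close>

lemma primitive_power_bounds:
  fixes G B :: real
  shows "\<exists>C. \<forall>g h H. primitive_data G B g h H \<longrightarrow>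
     cmean (\<lambda>\<zeta>. (cmod (H \<zeta> ^ k))\<^sup>2) \<le> C \<and> area (\<lambda>z. H z ^ k * deriv h z) \<le> C"
    (is "\<exists>C. ?P k C")
proof (induction k)
  case 0
  have "?P 0 (max 1 (B\<^sup>2))"
  proof (intro allI impI conjI)
    fix g h H :: "complex \<Rightarrow> complex"
    assume d: "primitive_data G B g h H"
    then have h: "h analytic_on cball 0 1" by (simp add: primitive_data_def)
    have "area (\<lambda>z. H z ^ 0 * deriv h z) = area (deriv h)" by simp
    also have "\<dots> \<le> cmean (\<lambda>\<zeta>. (cmod (h \<zeta>))\<^sup>2)" using h by (rule area_deriv_le)
    also have "\<dots> \<le> cmean (\<lambda>\<zeta>. B\<^sup>2)"
      using d by (intro cmean_mono continuous_intros analytic_cball_imp_continuous h power_mono)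
        (auto simp: primitive_data_def)
    finally show "area (\<lambda>z. H z ^ 0 * deriv h z) \<le> max 1 (B\<^sup>2)" by simp
  qed simp
  then show ?case by blast
next
  case (Suc k)
  then obtain C where C: "?P k C" by blast
  \<comment> \<open>\<open>C1\<close> bounds the square mean of \<open>H^(k+1)\<close>, and \<open>C2\<close> the area norm of \<open>H^(k+1) h'\<close> by the product rule.\<close>
  define C1 where "C1 = 2 * ((real (Suc k) * G)\<^sup>2 * C)"
  define C2 where "C2 = 2 * (B\<^sup>2 * C1) + 2 * ((real (Suc k) * G * B)\<^sup>2 * C)"
  have "?P (Suc k) (max C1 C2)"
  proof (intro allI impI)
    fix g h H :: "complex \<Rightarrow> complex"
    assume d: "primitive_data G B g h H"
    then have g: "g analytic_on cball 0 1" and h: "h analytic_on cball 0 1" and H: "H analytic_on cball 0 1"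
      and G: "\<forall>z\<in>cball 0 1. cmod (g z) \<le> G" and B: "\<forall>z\<in>cball 0 1. cmod (h z) \<le> B"
      and H0: "H 0 = 0" and dH: "\<forall>z\<in>cball 0 1. deriv H z = g z * deriv h z"
      unfolding primitive_data_def by blast+
    have C': "area (\<lambda>z. H z ^ k * deriv h z) \<le> C" using C d by blast
    have dh: "deriv h analytic_on cball 0 1" by (rule analytic_deriv[OF h])
    have G0: "0 \<le> G" using G norm_ge_zero order_trans by (metis centre_in_cball zero_le_one)
    have B0: "0 \<le> B" using B norm_ge_zero order_trans by (metis centre_in_cball zero_le_one)
    have der: "(H has_field_derivative deriv H z) (at z)" "(h has_field_derivative deriv h z) (at z)"
      if "z \<in> cball 0 1" for z
      using H h that by (auto simp: analytic_on_imp_differentiable_at DERIV_deriv_iff_field_differentiable)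
    have d1: "deriv (\<lambda>z. H z ^ Suc k) z = of_nat (Suc k) * g z * (H z ^ k * deriv h z)" if "z \<in> cball 0 1" for z
      by (rule DERIV_imp_deriv)
         (use der[OF that] dH that in \<open>auto intro!: derivative_eq_intros simp del: of_nat_Suc power_Suc\<close>)
    have d2: "deriv (\<lambda>z. H z ^ Suc k * h z) z =
        H z ^ Suc k * deriv h z + of_nat (Suc k) * g z * h z * (H z ^ k * deriv h z)" if "z \<in> cball 0 1" for z
      by (rule DERIV_imp_deriv)
         (use der[OF that] dH that in \<open>auto intro!: derivative_eq_intros simp del: of_nat_Suc power_Suc\<close>)
    have m1: "cmean (\<lambda>\<zeta>. (cmod (H \<zeta> ^ Suc k))\<^sup>2) \<le> C1"
    proof -
      have "cmean (\<lambda>\<zeta>. (cmod (H \<zeta> ^ Suc k))\<^sup>2) \<le> 2 * area (deriv (\<lambda>z. H z ^ Suc k))"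
        by (rule cmean_le_area_deriv) (auto intro!: analytic_intros H simp: H0)
      also have "area (deriv (\<lambda>z. H z ^ Suc k)) \<le> (real (Suc k) * G)\<^sup>2 * C"
      proof (rule area_scale_le[OF _ _ _ C'])
        show "cmod (deriv (\<lambda>z. H z ^ Suc k) z) \<le> real (Suc k) * G * cmod (H z ^ k * deriv h z)"
          if "z \<in> cball 0 1" for z
          unfolding d1[OF that] norm_mult[of _ "H z ^ k * deriv h z"] norm_mult[of _ "g z"] norm_of_nat
          using G that by (intro mult_right_mono mult_left_mono) auto
      qed (auto intro!: analytic_intros analytic_deriv H dh)
      finally show ?thesis by (simp add: C1_def)
    qed
    have "area (\<lambda>z. H z ^ Suc k * deriv h z) \<le>
        1\<^sup>2 * area (\<lambda>z. deriv (\<lambda>z. H z ^ Suc k * h z) z + (- of_nat (Suc k) * g z * h z) * (H z ^ k * deriv h z))"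
      by (rule area_mono)
        (auto simp only: d2 mult_1 intro!: analytic_intros analytic_deriv H h dh g eq_refl arg_cong[where f = cmod], auto simp: algebra_simps)
    also have "\<dots> \<le> 2 * area (deriv (\<lambda>z. H z ^ Suc k * h z)) +
          2 * area (\<lambda>z. (- of_nat (Suc k) * g z * h z) * (H z ^ k * deriv h z))"
      by (simp only: one_power2 mult_1, rule area_add) (intro analytic_intros analytic_deriv H h dh g)+
    also have "area (deriv (\<lambda>z. H z ^ Suc k * h z)) \<le> B\<^sup>2 * C1"
    proof -
      have "area (deriv (\<lambda>z. H z ^ Suc k * h z)) \<le> cmean (\<lambda>\<zeta>. (cmod (H \<zeta> ^ Suc k * h \<zeta>))\<^sup>2)"
        by (intro area_deriv_le analytic_intros H h)
      also have "\<dots> \<le> cmean (\<lambda>\<zeta>. B\<^sup>2 * (cmod (H \<zeta> ^ Suc k))\<^sup>2)"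
      proof (intro cmean_mono continuous_intros analytic_cball_imp_continuous h H)
        fix \<zeta> :: complex assume z: "\<zeta> \<in> \<C>"
        have "cmod (H \<zeta> ^ Suc k * h \<zeta>) \<le> B * cmod (H \<zeta> ^ Suc k)"
          using B z unfolding norm_mult[of "H \<zeta> ^ Suc k"] by (subst mult.commute) (intro mult_right_mono; auto)
        then show "(cmod (H \<zeta> ^ Suc k * h \<zeta>))\<^sup>2 \<le> B\<^sup>2 * (cmod (H \<zeta> ^ Suc k))\<^sup>2"
          unfolding power_mult_distrib[symmetric] by (rule power_mono) simp
      qed
      also have "\<dots> \<le> B\<^sup>2 * C1" using m1 by (simp only: cmean_mult_left) (intro mult_left_mono; simp)
      finally show ?thesis .
    qed
    also have "area (\<lambda>z. (- of_nat (Suc k) * g z * h z) * (H z ^ k * deriv h z)) \<le> (real (Suc k) * G * B)\<^sup>2 * C"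
    proof (rule area_scale_le[OF _ _ _ C'])
      show "cmod ((- of_nat (Suc k) * g z * h z) * (H z ^ k * deriv h z)) \<le> real (Suc k) * G * B * cmod (H z ^ k * deriv h z)"
        if "z \<in> cball 0 1" for z
        unfolding norm_mult[of _ "H z ^ k * deriv h z"] norm_mult[of _ "g z"] norm_mult[of _ "h z"] norm_of_nat norm_minus_cancel
        using G B that G0 by (intro mult_right_mono mult_mono mult_left_mono) auto
    qed (auto intro!: analytic_intros analytic_deriv H h dh g)
    finally have "area (\<lambda>z. H z ^ Suc k * deriv h z) \<le> C2" by (simp add: C2_def)
    with m1 show "cmean (\<lambda>\<zeta>. (cmod (H \<zeta> ^ Suc k))\<^sup>2) \<le> max C1 C2 \<and> area (\<lambda>z. H z ^ Suc k * deriv h z) \<le> max C1 C2"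
      by (simp add: le_max_iff_disj del: power_Suc)
  qed
  then show ?case by blast
qed

section \<open>Dilations and Hardy spaces\<close>

lemma HinfI:
  assumes "f holomorphic_on \<D>" "\<And>z. z \<in> \<D> \<Longrightarrow> cmod (f z) \<le> B"
  shows "f \<in> Hinf"
  using assms unfolding Hinf_def bounded_iff by blast

lemma HinfE:
  assumes "f \<in> Hinf"
  obtains B where "f holomorphic_on \<D>" "\<And>z. z \<in> \<D> \<Longrightarrow> cmod (f z) \<le> B"
  using assms unfolding Hinf_def bounded_iff by blast

lemma HardyI:
  assumes "f holomorphic_on \<D>" "\<And>r. r \<in> {0<..<1} \<Longrightarrow> hardy_mean p f r \<le> C"
  shows "f \<in> Hardy p"
  using assms unfolding Hardy_def bdd_above_def by blast

lemma HardyE: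
  assumes "f \<in> Hardy p"
  obtains C where "\<And>r. r \<in> {0<..<1} \<Longrightarrow> hardy_mean p f r \<le> C"
  using assms unfolding Hardy_def bdd_above_def by blast

lemma analytic_dilate:
  assumes "f holomorphic_on \<D>" "0 < r" "r < 1"
  shows "(\<lambda>z. f (of_real r * z)) analytic_on cball 0 1"
proof -
  have "f analytic_on \<D>" using assms(1) by (simp add: analytic_on_open)
  moreover have "(\<lambda>z. of_real r * z) ` cball 0 1 \<subseteq> \<D>"
  proof
    fix w assume "w \<in> (\<lambda>z. complex_of_real r * z) ` cball 0 1"
    then obtain z where z: "w = of_real r * z" "z \<in> cball 0 1" by blast
    then have "cmod z \<le> 1" by simp
    then have "cmod w \<le> r * 1" unfolding z(1) norm_mult using assms by (intro mult_mono) auto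
    then show "w \<in> \<D>" using assms by simp
  qed
  ultimately have "(f \<circ> (\<lambda>z. of_real r * z)) analytic_on cball 0 1"
    by (intro analytic_on_compose analytic_intros) (auto intro: analytic_on_subset)
  then show ?thesis by (simp add: o_def)
qed

lemma dilate_in_disk: "z \<in> cball 0 1 \<Longrightarrow> 0 < r \<Longrightarrow> r < 1 \<Longrightarrow> of_real r * z \<in> \<D>"
  using mult_left_mono[of "cmod z" 1 r] by (auto simp: norm_mult intro: order_le_less_trans[of _ "r * 1"])

text \<open>A fixed sequence of radii tending to one, for arguments that pass to the boundary.\<close>

definition radius :: "nat \<Rightarrow> real" where
  "radius n = 1 - 1 / real (n + 2)"

lemma radius: "0 < radius n" "radius n < 1"
  by (auto simp: radius_def field_simps)

lemma radius_tendsto: "radius \<longlonglongrightarrow> 1"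
proof -
  have "(\<lambda>n. 1 - 1 / real (n + 2)) \<longlonglongrightarrow> 1 - 0"
    by (intro tendsto_intros LIMSEQ_ignore_initial_segment lim_1_over_n[unfolded inverse_eq_divide])
  then show ?thesis by (simp add: radius_def[abs_def])
qed

lemma dilate_tendsto:
  assumes "f holomorphic_on \<D>" "z \<in> \<D>"
  shows "(\<lambda>n. f (of_real (radius n) * z)) \<longlonglongrightarrow> f z"
proof -
  have "isCont f z"
    using holomorphic_on_imp_continuous_on[OF assms(1)] assms(2)
    by (simp add: continuous_on_eq_continuous_at)
  moreover have "(\<lambda>n. of_real (radius n) * z) \<longlonglongrightarrow> of_real 1 * z"
    by (intro tendsto_intros radius_tendsto)
  ultimately show ?thesis
    using continuous_within_tendsto_compose'[of z UNIV f] by simp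
qed

lemma cmean_lebesgue:
  fixes F :: "complex \<Rightarrow> 'a::euclidean_space"
  assumes "continuous_on \<C> F"
  shows "set_integrable lebesgue {a..b} (\<lambda>t. F (cis t))"
    "cmean F = (1 / (2 * pi)) *\<^sub>R (LINT t:{0..2*pi}|lebesgue. F (cis t))"
proof -
  show i: "set_integrable lebesgue {a..b} (\<lambda>t. F (cis t))" for a b
    by (intro absolutely_integrable_continuous_real continuous_on_circle_cis assms)
  show "cmean F = (1 / (2 * pi)) *\<^sub>R (LINT t:{0..2*pi}|lebesgue. F (cis t))"
    unfolding cmean_def set_lebesgue_integral_eq_integral(2)[OF i] ..
qed

lemma continuous_on_dilate:
  assumes "f holomorphic_on \<D>" "0 < r" "r < 1"
  shows "continuous_on \<C> (\<lambda>z. f (of_real r * z))"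
  using analytic_cball_imp_continuous(2)[OF analytic_dilate[OF assms]] .

lemma continuous_on_powr_const:
  fixes F :: "complex \<Rightarrow> real"
  assumes "continuous_on A F" "\<And>z. z \<in> A \<Longrightarrow> 0 \<le> F z" "0 < p"
  shows "continuous_on A (\<lambda>z. F z powr p)"
  using assms by (intro continuous_on_powr' continuous_intros) auto

lemma hardy_mean_cmean:
  assumes "f holomorphic_on \<D>" "0 < r" "r < 1" "0 < p"
  shows "hardy_mean p f r = cmean (\<lambda>\<zeta>. cmod (f (of_real r * \<zeta>)) powr p)"
proof -
  have "continuous_on \<C> (\<lambda>\<zeta>. cmod (f (of_real r * \<zeta>)) powr p)"
    by (intro continuous_on_powr_const continuous_intros continuous_on_dilate assms) auto
  from cmean_lebesgue(2)[OF this] show ?thesis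
    by (simp add: hardy_mean_def)
qed

section \<open>Moebius invariant power means\<close>

text \<open>
  For \<open>k = 1\<close> the condition is a bound for the Garsia norm, which characterises BMOA; it is imposed for all
  even powers because these means also give every Hardy space, and on dilations because these extend
  continuously to the circle.
\<close>

definition garsia :: "(complex \<Rightarrow> complex) set" where
  "garsia = {f. f holomorphic_on \<D> \<and> (\<forall>k. \<exists>C. \<forall>r\<in>{0<..<1}. \<forall>a\<in>\<D>.
     cmean (\<lambda>\<zeta>. cmod (f (of_real r * \<zeta>) - f (of_real r * a)) ^ (2 * k) * poisson a \<zeta>) \<le> C)}"

lemma garsiaE:
  assumes "f \<in> garsia"
  obtains C where "\<And>r a. r \<in> {0<..<1} \<Longrightarrow> a \<in> \<D> \<Longrightarrow>
    cmean (\<lambda>\<zeta>. cmod (f (of_real r * \<zeta>) - f (of_real r * a)) ^ (2 * k) * poisson a \<zeta>) \<le> C"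
  using assms unfolding garsia_def by blast

lemma garsia_holomorphic: "f \<in> garsia \<Longrightarrow> f holomorphic_on \<D>"
  by (simp add: garsia_def)

lemma power_add_le_two:
  fixes x y :: real
  assumes "0 \<le> x" "0 \<le> y"
  shows "(x + y) ^ n \<le> 2 ^ n * (x ^ n + y ^ n)"
proof -
  have "(x + y) ^ n \<le> (2 * max x y) ^ n"
    using assms by (intro power_mono) auto
  also have "\<dots> = 2 ^ n * (max x y) ^ n" by (simp add: power_mult_distrib)
  also have "(max x y) ^ n \<le> x ^ n + y ^ n" using assms by (simp add: max_def)
  finally show ?thesis by simp
qed

lemma cmean_power_add:
  assumes "continuous_on \<C> F" "continuous_on \<C> G" "continuous_on \<C> w" "\<And>z. z \<in> \<C> \<Longrightarrow> 0 \<le> w z"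
    "\<And>z. z \<in> \<C> \<Longrightarrow> cmod (K z) \<le> cmod (F z) + cmod (G z)" "continuous_on \<C> K"
  shows "cmean (\<lambda>z. cmod (K z) ^ n * w z) \<le>
     2 ^ n * (cmean (\<lambda>z. cmod (F z) ^ n * w z) + cmean (\<lambda>z. cmod (G z) ^ n * w z))"
proof -
  have "cmean (\<lambda>z. cmod (K z) ^ n * w z) \<le> cmean (\<lambda>z. 2 ^ n * (cmod (F z) ^ n * w z + cmod (G z) ^ n * w z))"
  proof (intro cmean_mono continuous_intros assms)
    fix z :: complex assume z: "z \<in> \<C>"
    have "cmod (K z) ^ n \<le> (cmod (F z) + cmod (G z)) ^ n"
      using assms(5)[OF z] by (intro power_mono) auto
    also have "\<dots> \<le> 2 ^ n * (cmod (F z) ^ n + cmod (G z) ^ n)"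
      by (rule power_add_le_two) auto
    finally have "cmod (K z) ^ n * w z \<le> 2 ^ n * (cmod (F z) ^ n + cmod (G z) ^ n) * w z"
      using assms(4)[OF z] by (rule mult_right_mono)
    then show "cmod (K z) ^ n * w z \<le> 2 ^ n * (cmod (F z) ^ n * w z + cmod (G z) ^ n * w z)"
      by (simp add: algebra_simps)
  qed
  also have "\<dots> = 2 ^ n * (cmean (\<lambda>z. cmod (F z) ^ n * w z) + cmean (\<lambda>z. cmod (G z) ^ n * w z))"
    unfolding cmean_mult_left by (subst cmean_add) (auto intro!: continuous_intros assms)
  finally show ?thesis .
qed

lemma garsia_add:
  assumes f: "f \<in> garsia" and g: "g \<in> garsia" and h: "\<And>z. z \<in> \<D> \<Longrightarrow> h z = f z + g z"
  shows "h \<in> garsia"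
proof -
  note hf = garsia_holomorphic[OF f] and hg = garsia_holomorphic[OF g]
  have hh: "h holomorphic_on \<D>"
    by (rule holomorphic_transform[of "\<lambda>z. f z + g z"]) (use hf hg h in \<open>auto intro: holomorphic_intros\<close>)
  note cd = continuous_on_dilate[OF hf] continuous_on_dilate[OF hg] continuous_on_dilate[OF hh]
  have "\<exists>C. \<forall>r\<in>{0<..<1}. \<forall>a\<in>\<D>.
     cmean (\<lambda>\<zeta>. cmod (h (of_real r * \<zeta>) - h (of_real r * a)) ^ (2 * k) * poisson a \<zeta>) \<le> C" for k
  proof -
    obtain C where C: "\<And>r a. r\<in>{0<..<1} \<Longrightarrow> a\<in>\<D> \<Longrightarrow>
      cmean (\<lambda>\<zeta>. cmod (f (of_real r * \<zeta>) - f (of_real r * a)) ^ (2 * k) * poisson a \<zeta>) \<le> C"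
      using garsiaE[OF f, of k] by blast
    obtain C' where C': "\<And>r a. r\<in>{0<..<1} \<Longrightarrow> a\<in>\<D> \<Longrightarrow>
      cmean (\<lambda>\<zeta>. cmod (g (of_real r * \<zeta>) - g (of_real r * a)) ^ (2 * k) * poisson a \<zeta>) \<le> C'"
      using garsiaE[OF g, of k] by blast
    have "cmean (\<lambda>\<zeta>. cmod (h (of_real r * \<zeta>) - h (of_real r * a)) ^ (2 * k) * poisson a \<zeta>) \<le> 2 ^ (2 * k) * (C + C')"
      if r: "r\<in>{0<..<1}" and a: "a\<in>\<D>" for r a
    proof -
      have heq: "h (of_real r * z) = f (of_real r * z) + g (of_real r * z)" if "z \<in> cball 0 1" for z
        by (rule h[OF dilate_in_disk]) (use that r in auto)
      have "cmean (\<lambda>\<zeta>. cmod (h (of_real r * \<zeta>) - h (of_real r * a)) ^ (2 * k) * poisson a \<zeta>) \<le> 2 ^ (2 * k) *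
         (cmean (\<lambda>\<zeta>. cmod (f (of_real r * \<zeta>) - f (of_real r * a)) ^ (2 * k) * poisson a \<zeta>) +
          cmean (\<lambda>\<zeta>. cmod (g (of_real r * \<zeta>) - g (of_real r * a)) ^ (2 * k) * poisson a \<zeta>))"
      proof (intro cmean_power_add continuous_on_diff continuous_on_const cd continuous_on_poisson poisson_nonneg)
        fix \<zeta> :: complex assume "\<zeta> \<in> \<C>"
        then have "h (of_real r * \<zeta>) - h (of_real r * a) =
           (f (of_real r * \<zeta>) - f (of_real r * a)) + (g (of_real r * \<zeta>) - g (of_real r * a))"
          using heq[of \<zeta>] heq[of a] a by simp
        then show "cmod (h (of_real r * \<zeta>) - h (of_real r * a)) \<le>
           cmod (f (of_real r * \<zeta>) - f (of_real r * a)) + cmod (g (of_real r * \<zeta>) - g (of_real r * a))"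
          by (simp only: norm_triangle_ineq)
      qed (use r a in auto)
      also have "\<dots> \<le> 2 ^ (2 * k) * (C + C')"
        by (intro mult_left_mono add_mono C[OF r a] C'[OF r a]) simp
      finally show ?thesis .
    qed
    then show ?thesis by blast
  qed
  then show ?thesis using hh unfolding garsia_def by blast
qed

text \<open>
  The Poisson kernel of the origin is constant, and the value of \<open>f\<close> at the origin is added back.
\<close>

lemma garsia_power_mean:
  assumes f: "f \<in> garsia"
  obtains C where "\<And>r. r \<in> {0<..<1} \<Longrightarrow> cmean (\<lambda>\<zeta>. cmod (f (of_real r * \<zeta>)) ^ (2 * k)) \<le> C"
proof -
  note hf = garsia_holomorphic[OF f]
  obtain C where C: "\<And>r a. r\<in>{0<..<1} \<Longrightarrow> a\<in>\<D> \<Longrightarrow>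
    cmean (\<lambda>\<zeta>. cmod (f (of_real r * \<zeta>) - f (of_real r * a)) ^ (2 * k) * poisson a \<zeta>) \<le> C"
    using garsiaE[OF f, of k] by blast
  have "cmean (\<lambda>\<zeta>. cmod (f (of_real r * \<zeta>)) ^ (2 * k)) \<le> 2 ^ (2 * k) * (C + cmod (f 0) ^ (2 * k))"
    if r: "r\<in>{0<..<1}" for r
  proof -
    have "cmean (\<lambda>\<zeta>. cmod (f (of_real r * \<zeta>)) ^ (2 * k) * 1) \<le>
      2 ^ (2 * k) * (cmean (\<lambda>\<zeta>. cmod (f (of_real r * \<zeta>) - f 0) ^ (2 * k) * 1) + cmean (\<lambda>\<zeta>. cmod (f 0) ^ (2 * k) * 1))"
    proof (intro cmean_power_add continuous_on_diff continuous_on_const continuous_on_dilate hf)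
      fix \<zeta> :: complex
      show "cmod (f (of_real r * \<zeta>)) \<le> cmod (f (of_real r * \<zeta>) - f 0) + cmod (f 0)"
        using norm_triangle_ineq[of "f (of_real r * \<zeta>) - f 0" "f 0"] by simp
    qed (use r in auto)
    also have "cmean (\<lambda>\<zeta>. cmod (f (of_real r * \<zeta>) - f 0) ^ (2 * k) * 1) =
        cmean (\<lambda>\<zeta>. cmod (f (of_real r * \<zeta>) - f (of_real r * 0)) ^ (2 * k) * poisson 0 \<zeta>)"
      by (rule cmean_cong) (simp add: poisson_def)
    also have "\<dots> \<le> C" by (rule C[OF r]) simp
    finally show ?thesis by simp
  qed
  then show ?thesis using that by blast
qed

text \<open>
  Composing \<open>g\<close>, \<open>h\<close> and \<open>H\<close> with a dilated Moebius map preserves the bounds for \<open>g\<close> and \<open>h\<close> and the relation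
  between the derivatives, so \<open>primitive_power_bounds\<close> holds with one constant for all of these
  compositions.  The invariance of circle means turns the Moebius map into a Poisson kernel.
\<close>

lemma garsia_primitive:
  assumes g: "g \<in> Hinf" and h: "h \<in> Hinf" and H: "H holomorphic_on \<D>"
    and dH: "\<And>z. z \<in> \<D> \<Longrightarrow> deriv H z = g z * deriv h z"
  shows "H \<in> garsia"
proof -
  have hg: "g holomorphic_on \<D>" and hh: "h holomorphic_on \<D>" using g h by (auto simp: Hinf_def)
  from g obtain G where G: "\<And>z. z \<in> \<D> \<Longrightarrow> cmod (g z) \<le> G"
    by (rule HinfE) blast
  from h obtain B where B: "\<And>z. z \<in> \<D> \<Longrightarrow> cmod (h z) \<le> B"
    by (rule HinfE) blast
  have der: "(f has_field_derivative deriv f z) (at z)" if "f holomorphic_on \<D>" "z \<in> \<D>" for f z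
    by (rule holomorphic_derivI[OF that(1) open_ball that(2)])
  have "\<exists>C. \<forall>r\<in>{0<..<1}. \<forall>a\<in>\<D>.
     cmean (\<lambda>\<zeta>. cmod (H (of_real r * \<zeta>) - H (of_real r * a)) ^ (2 * k) * poisson a \<zeta>) \<le> C" for k
  proof -
    obtain C where C: "\<And>g h H. primitive_data G B g h H \<Longrightarrow> cmean (\<lambda>\<zeta>. (cmod (H \<zeta> ^ k))\<^sup>2) \<le> C"
      using primitive_power_bounds[of G B k] by blast
    have "cmean (\<lambda>\<zeta>. cmod (H (of_real r * \<zeta>) - H (of_real r * a)) ^ (2 * k) * poisson a \<zeta>) \<le> C"
      if r: "r\<in>{0<..<1}" and a: "a\<in>\<D>" for r a
    proof -
      let ?m = "\<lambda>z. of_real r * mobius a z"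
      have mD: "?m z \<in> \<D>" if "z \<in> cball 0 1" for z
        by (rule dilate_in_disk) (use mobius_cball[OF a that] r in auto)
      have ma: "?m analytic_on cball 0 1"
        by (intro analytic_intros analytic_mobius a)
      have an: "(\<lambda>z. f (?m z)) analytic_on cball 0 1" if "f holomorphic_on \<D>" for f
      proof -
        have "f analytic_on \<D>" using that by (simp add: analytic_on_open)
        then have "f analytic_on ?m ` cball 0 1"
          by (rule analytic_on_subset) (use mD in auto)
        from analytic_on_compose[OF ma this] show ?thesis by (simp add: o_def)
      qed
      have dm: "(?m has_field_derivative deriv ?m z) (at z)" if "z \<in> cball 0 1" for z
        using ma that by (auto simp: analytic_on_imp_differentiable_at DERIV_deriv_iff_field_differentiable)
      have "cmean (\<lambda>\<zeta>. (cmod ((H (?m \<zeta>) - H (of_real r * a)) ^ k))\<^sup>2) \<le> C"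
      proof (rule C[of "\<lambda>z. g (?m z)" "\<lambda>z. h (?m z)"], unfold primitive_data_def, intro conjI ballI)
        fix z :: complex assume z: "z \<in> cball 0 1"
        show "cmod (g (?m z)) \<le> G" "cmod (h (?m z)) \<le> B" using G B mD[OF z] by auto
        have "((\<lambda>z. H (?m z) - H (of_real r * a)) has_field_derivative deriv H (?m z) * deriv ?m z) (at z)"
          using DERIV_chain2[OF der[OF H mD[OF z]] dm[OF z]] by (auto intro!: derivative_eq_intros)
        then have 1: "deriv (\<lambda>z. H (?m z) - H (of_real r * a)) z = deriv H (?m z) * deriv ?m z"
          by (rule DERIV_imp_deriv)
        have 2: "deriv (\<lambda>z. h (?m z)) z = deriv h (?m z) * deriv ?m z"
          by (rule DERIV_imp_deriv, rule DERIV_chain2[OF der[OF hh mD[OF z]] dm[OF z]])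
        show "deriv (\<lambda>z. H (?m z) - H (of_real r * a)) z = g (?m z) * deriv (\<lambda>z. h (?m z)) z"
          unfolding 1 2 using dH[OF mD[OF z]] by simp
      qed (use an[OF hg] an[OF hh] analytic_on_diff[OF an[OF H] analytic_on_const] in auto)
      moreover have "cmean (\<lambda>\<zeta>. cmod (H (?m \<zeta>) - H (of_real r * a)) ^ (2 * k)) =
          cmean (\<lambda>\<zeta>. cmod (H (of_real r * \<zeta>) - H (of_real r * a)) ^ (2 * k) * poisson a \<zeta>)"
        by (rule cmean_mobius[of "\<lambda>\<zeta>. cmod (H (of_real r * \<zeta>) - H (of_real r * a)) ^ (2 * k)"])
           (use r a in \<open>auto intro!: continuous_intros continuous_on_dilate H\<close>)
      ultimately show ?thesis by (simp add: norm_power power_even_eq)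
    qed
    then show ?thesis by blast
  qed
  with H show ?thesis unfolding garsia_def by blast
qed

lemma Hinf_subset_garsia:
  assumes "f \<in> Hinf"
  shows "f \<in> garsia"
proof (rule garsia_primitive[of "\<lambda>_. 1" f])
  show "(\<lambda>_. 1) \<in> Hinf" by (auto simp: Hinf_def bounded_iff)
qed (use assms in \<open>auto simp: Hinf_def\<close>)

lemma garsia_subset_Hardy:
  assumes f: "f \<in> garsia" and p: "0 < p"
  shows "f \<in> Hardy p"
proof -
  have hf: "f holomorphic_on \<D>" using f by (simp add: garsia_def)
  define k where "k = nat \<lceil>p\<rceil>"
  have k: "p \<le> real (2 * k)" using p by (simp add: k_def) linarith
  obtain C where C: "\<And>r. r\<in>{0<..<1} \<Longrightarrow> cmean (\<lambda>\<zeta>. cmod (f (of_real r * \<zeta>)) ^ (2 * k)) \<le> C"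
    using garsia_power_mean[OF f, of k] by blast
  have le: "x powr p \<le> 1 + x ^ (2 * k)" if "0 \<le> x" for x :: real
  proof (cases "x \<le> 1")
    case True
    then have "x powr p \<le> 1" using that p by (intro powr_le1) auto
    then show ?thesis using that by (simp add: add_increasing2)
  next
    case False
    then have "x powr p \<le> x powr real (2 * k)" using k by (intro powr_mono) auto
    also have "\<dots> = x ^ (2 * k)" using False by (simp add: powr_realpow del: of_nat_mult)
    finally show ?thesis by simp
  qed
  have "hardy_mean p f r \<le> 1 + C" if r: "r \<in> {0<..<1}" for r
  proof -
    have "hardy_mean p f r = cmean (\<lambda>\<zeta>. cmod (f (of_real r * \<zeta>)) powr p)"
      by (rule hardy_mean_cmean) (use hf p r in auto)
    also have "\<dots> \<le> cmean (\<lambda>\<zeta>. 1 + cmod (f (of_real r * \<zeta>)) ^ (2 * k))"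
      by (intro cmean_mono continuous_on_powr_const continuous_intros continuous_on_dilate le)
         (use hf p r in auto)
    also have "\<dots> = 1 + cmean (\<lambda>\<zeta>. cmod (f (of_real r * \<zeta>)) ^ (2 * k))"
      by (subst cmean_add) (use hf r in \<open>auto intro!: continuous_intros continuous_on_dilate\<close>)
    finally show ?thesis using C[OF r] by simp
  qed
  then show ?thesis using hf by (rule HardyI[rotated])
qed

text \<open>
  The square of a value at \<open>a\<close> is the mean of the squared boundary values against the Poisson kernel of \<open>a\<close>,
  which is at most \<open>2 / (1 - \<bar>a\<bar>)\<close>.
\<close>

lemma garsia_growth:
  assumes f: "f \<in> garsia"
  obtains K where "\<And>z. z \<in> \<D> \<Longrightarrow> cmod (f z) \<le> K / sqrt (1 - cmod z)" "0 \<le> K"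
proof -
  have hf: "f holomorphic_on \<D>" using f by (simp add: garsia_def)
  obtain C where C: "\<And>r. r\<in>{0<..<1} \<Longrightarrow> cmean (\<lambda>\<zeta>. cmod (f (of_real r * \<zeta>)) ^ (2 * 1)) \<le> C"
    using garsia_power_mean[OF f, of 1] by blast
  have C0: "0 \<le> C"
  proof -
    have "0 \<le> cmean (\<lambda>\<zeta>. cmod (f (of_real (1/2) * \<zeta>)) ^ (2 * 1))"
      by (intro cmean_nonneg continuous_intros continuous_on_dilate hf) auto
    also have "\<dots> \<le> C" by (rule C) auto
    finally show ?thesis .
  qed
  have bound: "(cmod (f (of_real r * a)))\<^sup>2 \<le> 2 * C / (1 - cmod a)" if r: "r \<in> {0<..<1}" and a: "a \<in> \<D>" for r a
  proof -
    have an: "(\<lambda>z. f (of_real r * z)) analytic_on cball 0 1"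
      by (rule analytic_dilate) (use hf r in auto)
    note ca = analytic_cball_imp_continuous(2)[OF an]
    have "(\<lambda>z. (f (of_real r * z))\<^sup>2) analytic_on cball 0 1" by (intro analytic_intros an)
    from poisson_cmean[OF this a]
    have "(cmod (f (of_real r * a)))\<^sup>2 = cmod (cmean (\<lambda>\<zeta>. (f (of_real r * \<zeta>))\<^sup>2 * of_real (poisson a \<zeta>)))"
      by (simp add: norm_power)
    also have "\<dots> \<le> cmean (\<lambda>\<zeta>. cmod ((f (of_real r * \<zeta>))\<^sup>2 * of_real (poisson a \<zeta>)))"
      by (intro norm_cmean_le continuous_intros ca continuous_on_poisson a)
    also have "\<dots> \<le> cmean (\<lambda>\<zeta>. 2 / (1 - cmod a) * cmod (f (of_real r * \<zeta>)) ^ (2 * 1))"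
    proof (intro cmean_mono continuous_intros ca continuous_on_poisson a)
      fix \<zeta> :: complex assume z: "\<zeta> \<in> \<C>"
      show "cmod ((f (of_real r * \<zeta>))\<^sup>2 * of_real (poisson a \<zeta>)) \<le> 2 / (1 - cmod a) * cmod (f (of_real r * \<zeta>)) ^ (2 * 1)"
        using mult_left_mono[OF poisson_le[OF a z], of "(cmod (f (of_real r * \<zeta>)))\<^sup>2"] poisson_nonneg[OF a, of \<zeta>]
        by (simp add: norm_mult norm_power mult.commute)
    qed
    also have "\<dots> \<le> 2 / (1 - cmod a) * C"
      unfolding cmean_mult_left using C[OF r] a by (intro mult_left_mono) auto
    finally show ?thesis by simp
  qed
  have "cmod (f z) \<le> sqrt (2 * C) / sqrt (1 - cmod z)" if z: "z \<in> \<D>" for z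
  proof -
    have "(\<lambda>n. (cmod (f (of_real (radius n) * z)))\<^sup>2) \<longlonglongrightarrow> (cmod (f z))\<^sup>2"
      by (intro tendsto_intros dilate_tendsto hf z)
    then have "(cmod (f z))\<^sup>2 \<le> 2 * C / (1 - cmod z)"
      by (rule LIMSEQ_le_const2) (use bound[OF _ z] radius in auto)
    then show ?thesis
      by (metis real_le_rsqrt real_sqrt_divide)
  qed
  then show ?thesis using that[of "sqrt (2 * C)"] C0 by auto
qed

text \<open>
  The bound of \<open>garsia_growth\<close> is integrable along every radius.
\<close>

lemma primitive_of_garsia_bounded:
  assumes f: "f \<in> garsia" and F: "F holomorphic_on \<D>" and dF: "\<And>z. z \<in> \<D> \<Longrightarrow> deriv F z = f z"
  shows "F \<in> Hinf"
proof -
  obtain K where K: "\<And>z. z \<in> \<D> \<Longrightarrow> cmod (f z) \<le> K / sqrt (1 - cmod z)" and K0: "0 \<le> K"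
    using garsia_growth[OF f] by blast
  have b: "cmod (F z - F 0) \<le> 2 * K" if z: "z \<in> \<D>" for z
  proof -
    have tz: "of_real t * z \<in> \<D>" "t * cmod z < 1" if "t \<in> {0..1}" for t
    proof -
      have "t * cmod z \<le> 1 * cmod z" using that by (intro mult_right_mono) auto
      then show "t * cmod z < 1" using z by simp
      then show "of_real t * z \<in> \<D>" using that by (simp add: norm_mult)
    qed
    have dF': "(F has_field_derivative f w) (at w)" if "w \<in> \<D>" for w
      using holomorphic_derivI[OF F open_ball that] dF[OF that] by simp
    have v: "((\<lambda>t. F (of_real t * z)) has_vector_derivative f (of_real t * z) * z) (at t)" if "t \<in> {0..1}" for t
    proof -
      have "((\<lambda>t. of_real t * z) has_vector_derivative z) (at t)"
        by (auto intro!: derivative_eq_intros simp: has_vector_derivative_def bounded_linear_mult_left scaleR_conv_of_real)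
      from field_vector_diff_chain_at[OF this dF'[OF tz(1)[OF that]]]
      show ?thesis by (simp add: o_def mult.commute)
    qed
    define \<phi> where "\<phi> t = - 2 * K * sqrt (1 - t * cmod z)" for t
    have p: "(\<phi> has_real_derivative K * cmod z / sqrt (1 - t * cmod z)) (at t)" if "t \<in> {0..1}" for t
      unfolding \<phi>_def[abs_def] using tz(2)[OF that]
      by (auto intro!: derivative_eq_intros simp: field_simps)
    have "norm (F (of_real 1 * z) - F (of_real 0 * z)) \<le> \<phi> 1 - \<phi> 0"
    proof (rule differentiable_bound_general[where f = "\<lambda>t. F (of_real t * z)"])
      show "continuous_on {0..1} (\<lambda>t. F (of_real t * z))"
        by (rule continuous_at_imp_continuous_on) (use v in \<open>blast intro: has_vector_derivative_continuous\<close>)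
      show "continuous_on {0..1} \<phi>"
        by (rule continuous_at_imp_continuous_on) (use p in \<open>blast intro: DERIV_isCont\<close>)
      fix t :: real assume "0 < t" "t < 1"
      then have t: "t \<in> {0..1}" by simp
      show "((\<lambda>t. F (of_real t * z)) has_vector_derivative f (of_real t * z) * z) (at t)" by (rule v[OF t])
      show "(\<phi> has_vector_derivative K * cmod z / sqrt (1 - t * cmod z)) (at t)"
        using p[OF t] by (simp add: has_real_derivative_iff_has_vector_derivative)
      have "cmod (f (of_real t * z)) \<le> K / sqrt (1 - t * cmod z)"
        using K[OF tz(1)[OF t]] t by (simp add: norm_mult)
      then show "norm (f (of_real t * z) * z) \<le> K * cmod z / sqrt (1 - t * cmod z)"
        using mult_right_mono[of "cmod (f (of_real t * z))" "K / sqrt (1 - t * cmod z)" "cmod z"]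
        by (simp add: norm_mult)
    qed auto
    also have "\<phi> 1 - \<phi> 0 \<le> 2 * K"
      using K0 z by (simp add: \<phi>_def)
    finally show ?thesis by simp
  qed
  have "cmod (F z) \<le> 2 * K + cmod (F 0)" if "z \<in> \<D>" for z
    using that norm_triangle_sub[of "F z" "F 0"] b[of z] by linarith
  then show ?thesis using F by (rule HinfI[rotated])
qed

section \<open>Hardy spaces consist of quotients of bounded functions\<close>

definition logp :: "real \<Rightarrow> real" where "logp x = ln (max 1 x)"

lemma logp_nonneg: "0 \<le> logp x"
  by (simp add: logp_def)

lemma continuous_on_logp [continuous_intros]:
  "continuous_on A F \<Longrightarrow> continuous_on A (\<lambda>z. logp (F z))"
  unfolding logp_def by (intro continuous_intros) auto

lemma le_exp_logp: "x \<le> exp (logp x)"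
  by (simp add: logp_def)

text \<open>
  The approximation is shifted by \<open>e / 2\<close> so that it lies above \<open>log\<^sup>+ \<bar>f\<bar>\<close>.  Then \<open>exp (- Q)\<close> and
  \<open>f \<cdot> exp (- Q)\<close> have modulus at most one on the circle, hence on the disk by the maximum
  principle, whether or not \<open>f\<close> has zeros.
\<close>

lemma bounded_multiplier:
  assumes f: "f analytic_on cball 0 1" and e: "0 < e"
  obtains Q where "Q holomorphic_on UNIV" "Im (Q 0) = 0"
    "\<And>z. z \<in> cball 0 1 \<Longrightarrow> cmod (exp (- Q z)) \<le> 1"
    "\<And>z. z \<in> cball 0 1 \<Longrightarrow> cmod (f z * exp (- Q z)) \<le> 1"
    "\<And>\<zeta>. \<zeta> \<in> \<C> \<Longrightarrow> logp (cmod (f \<zeta>)) \<le> Re (Q \<zeta>) \<and> Re (Q \<zeta>) \<le> logp (cmod (f \<zeta>)) + e"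
proof -
  note cf = analytic_cball_imp_continuous[OF f]
  have "continuous_on \<C> (\<lambda>\<zeta>. logp (cmod (f \<zeta>)) + e / 2)"
    by (intro continuous_intros cf)
  from circle_approximation[OF this, of "e / 2"] e
  obtain Q where Q: "Q holomorphic_on UNIV" "Im (Q 0) = 0"
    "\<And>\<zeta>. \<zeta> \<in> \<C> \<Longrightarrow> \<bar>logp (cmod (f \<zeta>)) + e / 2 - Re (Q \<zeta>)\<bar> < e / 2" by auto
  have b: "logp (cmod (f \<zeta>)) \<le> Re (Q \<zeta>) \<and> Re (Q \<zeta>) \<le> logp (cmod (f \<zeta>)) + e" if "\<zeta> \<in> \<C>" for \<zeta>
    using Q(3)[OF that] by (simp add: abs_less_iff) argo
  have hQ: "Q holomorphic_on A" for A using Q(1) by (rule holomorphic_on_subset) auto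
  have hf: "f holomorphic_on cball 0 1" using f by (rule analytic_imp_holomorphic)
  have mm: "cmod (k z) \<le> 1" if "k holomorphic_on cball 0 1" "\<And>\<zeta>. \<zeta> \<in> \<C> \<Longrightarrow> cmod (k \<zeta>) \<le> 1" "z \<in> cball 0 1" for k z
  proof (rule maximum_modulus_frontier[of k "cball 0 1"])
    show "k holomorphic_on interior (cball 0 1)" 
      using that(1) by (rule holomorphic_on_subset) (rule interior_subset)
    show "continuous_on (closure (cball 0 1)) k" 
      using holomorphic_on_imp_continuous_on[OF that(1)] by simp
  qed (use that in auto)
  show ?thesis
  proof
    show "cmod (exp (- Q z)) \<le> 1" if "z \<in> cball 0 1" for z
    proof (rule mm[OF _ _ that])
      show "(\<lambda>z. exp (- Q z)) holomorphic_on cball 0 1" by (intro holomorphic_intros hQ)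
      show "cmod (exp (- Q \<zeta>)) \<le> 1" if "\<zeta> \<in> \<C>" for \<zeta>
        using b[OF that] logp_nonneg[of "cmod (f \<zeta>)"] by simp
    qed
    show "cmod (f z * exp (- Q z)) \<le> 1" if "z \<in> cball 0 1" for z
    proof (rule mm[OF _ _ that])
      show "(\<lambda>z. f z * exp (- Q z)) holomorphic_on cball 0 1" by (intro holomorphic_intros hQ hf)
      fix \<zeta> :: complex assume z: "\<zeta> \<in> \<C>"
      have "cmod (f \<zeta>) \<le> exp (Re (Q \<zeta>))"
        using le_exp_logp[of "cmod (f \<zeta>)"] b[OF z] by (meson exp_le_cancel_iff order_trans)
      then show "cmod (f \<zeta> * exp (- Q \<zeta>)) \<le> 1"
        unfolding norm_mult norm_exp_eq_Re by (simp add: exp_minus inverse_eq_divide)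
    qed
  qed (use Q b in auto)
qed

text \<open>
  The multipliers \<open>exp (- Q)\<close> for a sequence of dilations of \<open>f\<close> form a normal family.  Their values at the
  origin stay away from zero because \<open>Re (Q 0)\<close> is close to the mean of \<open>log\<^sup>+ \<bar>f\<bar>\<close>, which is bounded by a
  multiple of the mean of \<open>\<bar>f\<bar>\<close> to the power \<open>p\<close>.  By Hurwitz' theorem a limit of the family is zero-free.
\<close>

lemma Hardy_subset_Nevanlinna:
  assumes f: "f \<in> Hardy p" and p: "0 < p"
  shows "f \<in> Nevanlinna"
proof -
  have hf: "f holomorphic_on \<D>" using f by (simp add: Hardy_def)
  obtain C where C: "\<And>r. r \<in> {0<..<1} \<Longrightarrow> hardy_mean p f r \<le> C"
    using HardyE[OF f] by blast
  have an: "(\<lambda>z. f (of_real (radius n) * z)) analytic_on cball 0 1" for n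
    by (intro analytic_dilate hf radius)
  have "\<exists>Q. Q holomorphic_on UNIV \<and> Im (Q 0) = 0 \<and>
    (\<forall>z \<in> cball 0 1. cmod (exp (- Q z)) \<le> 1) \<and>
    (\<forall>z \<in> cball 0 1. cmod (f (of_real (radius n) * z) * exp (- Q z)) \<le> 1) \<and>
    (\<forall>\<zeta> \<in> \<C>. Re (Q \<zeta>) \<le> logp (cmod (f (of_real (radius n) * \<zeta>))) + 1)" for n
    using bounded_multiplier[OF an[of n] less_numeral_extra(1)] by metis
  then obtain Q where Q: "\<And>n. Q n holomorphic_on UNIV" 
    and le1: "\<And>n z. z \<in> cball 0 1 \<Longrightarrow> cmod (exp (- Q n z)) \<le> 1"
    and le2: "\<And>n z. z \<in> cball 0 1 \<Longrightarrow> cmod (f (of_real (radius n) * z) * exp (- Q n z)) \<le> 1"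
    and up: "\<And>n \<zeta>. \<zeta> \<in> \<C> \<Longrightarrow> Re (Q n \<zeta>) \<le> logp (cmod (f (of_real (radius n) * \<zeta>))) + 1"
    by metis
  have logp_le: "logp x \<le> x powr p / p" if "0 \<le> x" for x
  proof (cases "x \<le> 1")
    case True then show ?thesis using p by (simp add: logp_def max_def)
  next
    case False
    then have "p * ln x = ln (x powr p)" by (simp add: ln_powr)
    also have "\<dots> \<le> x powr p - 1" using False by (intro ln_le_minus_one) auto
    finally show ?thesis using False p by (simp add: logp_def field_simps)
  qed
  have Q0: "Re (Q n 0) \<le> C / p + 1" for n
  proof -
    have anQ: "Q n analytic_on cball 0 1" by (rule entire_imp_analytic[OF Q])
    note cQ = analytic_cball_imp_continuous(2)[OF anQ]
    have cp: "continuous_on \<C> (\<lambda>\<zeta>. cmod (f (of_real (radius n) * \<zeta>)) powr p)"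
      by (rule continuous_on_powr_const) (use p in \<open>auto intro!: continuous_intros analytic_cball_imp_continuous an\<close>)
    have "Re (Q n 0) = cmean (\<lambda>\<zeta>. Re (Q n \<zeta>))"
      using cmean_Re[OF cQ] cmean_analytic[OF anQ] by simp
    also have "\<dots> \<le> cmean (\<lambda>\<zeta>. (1 / p) * (cmod (f (of_real (radius n) * \<zeta>)) powr p) + 1)"
    proof (intro cmean_mono continuous_on_add continuous_on_mult continuous_on_Re continuous_on_const cQ cp)
      fix \<zeta> :: complex assume z: "\<zeta> \<in> \<C>"
      show "Re (Q n \<zeta>) \<le> (1 / p) * (cmod (f (of_real (radius n) * \<zeta>)) powr p) + 1"
        using up[OF z, of n] logp_le[of "cmod (f (of_real (radius n) * \<zeta>))"] by simp
    qed
    also have "\<dots> = (1 / p) * cmean (\<lambda>\<zeta>. cmod (f (of_real (radius n) * \<zeta>)) powr p) + 1"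
      unfolding cmean_mult_left[symmetric]
      by (subst cmean_add[OF continuous_on_mult[OF continuous_on_const cp] continuous_on_const]) simp
    also have "cmean (\<lambda>\<zeta>. cmod (f (of_real (radius n) * \<zeta>)) powr p) = hardy_mean p f (radius n)"
      using hardy_mean_cmean[OF hf radius p] by simp
    also have "(1 / p) * hardy_mean p f (radius n) + 1 \<le> (1 / p) * C + 1"
      using C[of "radius n"] radius[of n] p by (intro add_right_mono mult_left_mono) auto
    finally show ?thesis by simp
  qed
  define V where "V n z = exp (- Q n z)" for n z
  have hV: "V n holomorphic_on \<D>" for n
    unfolding V_def[abs_def] using Q[of n] by (intro holomorphic_intros) (rule holomorphic_on_subset, auto)
  obtain v k where v: "v holomorphic_on \<D>" and k: "strict_mono (k :: nat \<Rightarrow> nat)"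
    and lim: "\<And>z. z \<in> \<D> \<Longrightarrow> (\<lambda>n. V (k n) z) \<longlonglongrightarrow> v z"
    and ul: "\<And>K. compact K \<Longrightarrow> K \<subseteq> \<D> \<Longrightarrow> uniform_limit K (V \<circ> k) v sequentially"
  proof (rule Montel[of "\<D>" "range V" V])
    show "\<exists>B. \<forall>h\<in>range V. \<forall>z\<in>K. norm (h z) \<le> B" if "K \<subseteq> \<D>" for K
      using le1 that ball_subset_cball unfolding V_def by (intro exI[of _ 1]) blast
  qed (use hV in auto)
  have v1: "cmod (v z) \<le> 1" if "z \<in> \<D>" for z
    using lim[OF that] by (rule Lim_bounded[OF tendsto_norm, of _ _ 0]) (use le1 that in \<open>auto simp: V_def\<close>)
  have v2: "cmod (f z * v z) \<le> 1" if z: "z \<in> \<D>" for z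
  proof -
    have "(\<lambda>n. f (of_real (radius (k n)) * z)) \<longlonglongrightarrow> f z"
      using LIMSEQ_subseq_LIMSEQ[OF dilate_tendsto[OF hf z] k] by (simp add: o_def)
    then have "(\<lambda>n. cmod (f (of_real (radius (k n)) * z) * V (k n) z)) \<longlonglongrightarrow> cmod (f z * v z)"
      by (intro tendsto_intros lim z)
    then show ?thesis
      by (rule Lim_bounded[of _ _ 0]) (use le2 z in \<open>auto simp: V_def\<close>)
  qed
  have v0: "exp (- (C / p + 1)) \<le> cmod (v 0)"
  proof -
    have "(\<lambda>n. cmod (V (k n) 0)) \<longlonglongrightarrow> cmod (v 0)" by (intro tendsto_intros lim) auto
    then show ?thesis
    proof (rule LIMSEQ_le_const, intro exI[of _ 0] allI impI)
      fix n show "exp (- (C / p + 1)) \<le> cmod (V (k n) 0)"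
        using Q0[of "k n"] by (simp add: V_def)
    qed
  qed
  have vnz: "v z \<noteq> 0" if z: "z \<in> \<D>" for z
  proof (cases "v constant_on \<D>")
    case True
    then have "v z = v 0" using z by (auto simp: constant_on_def)
    then show ?thesis using v0 by (metis exp_gt_zero norm_zero not_le)
  next
    case False
    show ?thesis
      by (rule Hurwitz_no_zeros[of \<D> "V \<circ> k" v z])
         (use False ul v hV z in \<open>auto simp: V_def connected_ball o_def\<close>)
  qed
  have "(\<lambda>z. f z * v z) \<in> Hinf" "v \<in> Hinf"
    using v1 v2 v hf by (auto intro!: holomorphic_intros HinfI[where B = 1])
  moreover have "(\<forall>z\<in>\<D>. v z \<noteq> 0) \<and> (\<forall>z\<in>\<D>. f z = f z * v z / v z)"
    using vnz by auto
  ultimately show ?thesis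
    unfolding Nevanlinna_def by (intro CollectI bexI[of _ "\<lambda>z. f z * v z"] bexI[of _ v])
qed

lemma BMOA_subset_Nevanlinna: "f \<in> BMOA \<Longrightarrow> f \<in> Nevanlinna"
  using Hardy_subset_Nevanlinna[of f 1] by (simp add: BMOA_def)

lemma Smirnov_subset_Nevanlinna:
  assumes "f \<in> Smirnov"
  shows "f \<in> Nevanlinna"
proof -
  have "v z \<noteq> 0" if "outer v" "z \<in> \<D>" for v z
    using that unfolding outer_def by fastforce
  then show ?thesis using assms unfolding Smirnov_def Nevanlinna_def by blast
qed

section \<open>A maximal inequality\<close>

lemma integral_symmetric_interval:
  fixes h :: "real \<Rightarrow> real"
  assumes "continuous_on UNIV h" "0 \<le> s"
  shows "integral {- s..s} h = integral {0..s} (\<lambda>\<theta>. h \<theta> + h (- \<theta>))"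
proof -
  have c: "continuous_on A h" for A using assms(1) continuous_on_subset by blast
  have c': "continuous_on A (\<lambda>\<theta>. h (- \<theta>))" for A
    by (rule continuous_on_compose2[OF assms(1)]) (auto intro: continuous_intros)
  have "integral {- s..s} h = integral {- s..0} h + integral {0..s} h"
    by (intro Henstock_Kurzweil_Integration.integral_combine[symmetric] integrable_continuous_real c) (use assms(2) in auto)
  also have "integral {- s..0} h = integral {0..s} (\<lambda>\<theta>. h (- \<theta>))"
    using Henstock_Kurzweil_Integration.integral_reflect_real[where f = "\<lambda>\<theta>. h (- \<theta>)" and a = 0 and b = s]
    by (simp del: Henstock_Kurzweil_Integration.integral_reflect_real)
  finally show ?thesis
    by (subst integral_add) (auto intro: integrable_continuous_real c c')
qed

lemma integral_centred_interval:
  fixes g :: "real \<Rightarrow> real"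
  assumes "continuous_on UNIV g" "0 \<le> s"
  shows "integral {t - s..t + s} g = integral {0..s} (\<lambda>\<theta>. g (t + \<theta>) + g (t - \<theta>))"
proof -
  have "integral {t - s..t + s} g = integral {- s..s} (\<lambda>x. g (x + t))"
    using integral_shift_real_ivl[of "t - s" t "t + s" g] by simp
  also have "\<dots> = integral {0..s} (\<lambda>\<theta>. g (\<theta> + t) + g (- \<theta> + t))"
    using assms(2) by (intro integral_symmetric_interval continuous_on_compose2[OF assms(1)] continuous_intros) auto
  finally show ?thesis by (simp add: add.commute)
qed

lemma cmean_period:
  fixes F :: "complex \<Rightarrow> real"
  assumes "continuous_on \<C> F"
  shows "integral {a..a + 2 * pi} (\<lambda>t. F (cis t)) = 2 * pi * cmean F"
proof -
  have "integral {a..a + 2 * pi} (\<lambda>t. F (cis t)) = integral {0..2*pi} (\<lambda>t. F (cis (t + a)))"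
    using integral_shift_real_ivl[of a a "a + 2 * pi" "\<lambda>t. F (cis t)"] by simp
  also have "\<dots> = 2 * pi * cmean (\<lambda>\<zeta>. F (cis a * \<zeta>))"
    by (simp add: cmean_def cis_mult add.commute)
  finally show ?thesis by (simp add: cmean_rotate[OF assms])
qed

lemma cmean_centred:
  fixes F :: "complex \<Rightarrow> real"
  assumes "continuous_on \<C> F"
  shows "2 * pi * cmean F = integral {0..pi} (\<lambda>\<theta>. F (cis (t + \<theta>)) + F (cis (t - \<theta>)))"
proof -
  have "2 * pi * cmean F = integral {t - pi..t + pi} (\<lambda>t. F (cis t))"
    using cmean_period[OF assms, of "t - pi"] by (simp add: add.commute)
  also have "\<dots> = integral {0..pi} (\<lambda>\<theta>. F (cis (t + \<theta>)) + F (cis (t - \<theta>)))"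
    by (intro integral_centred_interval continuous_on_circle_cis assms) simp
  finally show ?thesis .
qed

lemma poisson_cis:
  "poisson (of_real r * cis t) (cis (t + \<theta>)) = (1 - r\<^sup>2) / (1 - 2 * r * cos \<theta> + r\<^sup>2)"
proof -
  have "cis (t + \<theta>) - of_real r * cis t = cis t * (cis \<theta> - of_real r)"
    by (simp add: cis_mult[symmetric] algebra_simps)
  then have "(cmod (cis (t + \<theta>) - of_real r * cis t))\<^sup>2 = (cmod (cis \<theta> - of_real r))\<^sup>2"
    by (simp add: norm_mult)
  also have "\<dots> = (cos \<theta> - r)\<^sup>2 + (sin \<theta>)\<^sup>2"
    by (simp add: cmod_power2)
  also have "\<dots> = 1 - 2 * r * cos \<theta> + r\<^sup>2"
    using sin_cos_squared_add[of \<theta>] by (simp add: power2_eq_square algebra_simps)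
  finally show ?thesis
    by (simp add: poisson_def norm_mult)
qed

text \<open>
  The Poisson kernel decreases in the angular distance \<open>\<theta>\<close>.  Integration by parts therefore expresses the
  Poisson mean as a positive combination of the symmetric averages of \<open>F\<close> about \<open>t\<close>, with total mass one.
\<close>

lemma poisson_mean_le_of_averages:
  fixes F :: "complex \<Rightarrow> real"
  assumes F: "continuous_on \<C> F" and r: "0 < r" "r < 1"
    and avg: "\<And>s. 0 \<le> s \<Longrightarrow> s \<le> pi \<Longrightarrow> integral {t - s..t + s} (\<lambda>x. F (cis x)) \<le> 2 * s * \<alpha>"
  shows "cmean (\<lambda>\<zeta>. F \<zeta> * poisson (of_real r * cis t) \<zeta>) \<le> \<alpha>"
proof -
  define w where "w = of_real r * cis t"
  have w: "w \<in> \<D>" using r by (simp add: w_def norm_mult)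
  define K where "K \<theta> = (1 - r\<^sup>2) / (1 - 2 * r * cos \<theta> + r\<^sup>2)" for \<theta>
  define K' where "K' \<theta> = - ((1 - r\<^sup>2) * (2 * r * sin \<theta>)) / (1 - 2 * r * cos \<theta> + r\<^sup>2)\<^sup>2" for \<theta>
  have den: "0 < 1 - 2 * r * cos \<theta> + r\<^sup>2" for \<theta>
  proof -
    have "r * cos \<theta> \<le> r * 1" using r by (intro mult_left_mono) auto
    then have "(1 - r)\<^sup>2 \<le> 1 - 2 * r * cos \<theta> + r\<^sup>2" by (simp add: power2_eq_square algebra_simps)
    moreover have "0 < (1 - r)\<^sup>2" using r by simp
    ultimately show ?thesis by linarith
  qed
  have r2: "0 < 1 - r\<^sup>2" using r by (simp add: power_less_one_iff)
  have Kc: "continuous_on A K" for A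
    unfolding K_def using den by (intro continuous_intros) (metis less_irrefl)
  have K0: "0 \<le> K \<theta>" for \<theta> using den[of \<theta>] r2 by (simp add: K_def)
  have dK: "(K has_real_derivative K' \<theta>) (at \<theta> within A)" for \<theta> A
    unfolding K_def[abs_def] K'_def using den[of \<theta>]
    by (auto intro!: derivative_eq_intros simp: power2_eq_square)
  have K'le: "K' \<theta> \<le> 0" if "0 \<le> \<theta>" "\<theta> \<le> pi" for \<theta>
    unfolding K'_def using r2 r that sin_ge_zero[of \<theta>]
    by (auto intro!: divide_nonpos_nonneg mult_nonneg_nonneg)
  have K'c: "continuous_on A K'" for A
    unfolding K'_def using den by (intro continuous_intros) (metis less_irrefl power_eq_0_iff)
  have cFp: "continuous_on UNIV (\<lambda>x. F (cis (t + x)))" "continuous_on UNIV (\<lambda>x. F (cis (t - x)))"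
    by (rule continuous_on_compose2[OF continuous_on_circle_cis[OF F, of UNIV]]; auto intro: continuous_intros)+
  define v where "v \<theta> = F (cis (t + \<theta>)) + F (cis (t - \<theta>))" for \<theta>
  have vc: "continuous_on A v" for A
    unfolding v_def using cFp by (intro continuous_on_add) (auto intro: continuous_on_subset)
  have pK: "poisson w (cis (t + \<theta>)) = K \<theta>" "poisson w (cis (t - \<theta>)) = K \<theta>" for \<theta>
    using poisson_cis[of r t \<theta>] poisson_cis[of r t "- \<theta>"] by (simp_all add: w_def K_def)
  have 1: "2 * pi * cmean (\<lambda>\<zeta>. F \<zeta> * poisson w \<zeta>) = integral {0..pi} (\<lambda>\<theta>. K \<theta> * v \<theta>)"
    by (subst cmean_centred[where t = t])
       (auto intro!: continuous_intros F continuous_on_poisson w simp: pK v_def distrib_left mult.commute)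
  have 2: "2 * pi = integral {0..pi} (\<lambda>\<theta>. K \<theta> * 2)"
  proof -
    have "2 * pi * cmean (poisson w) = integral {0..pi} (\<lambda>\<theta>. K \<theta> * 2)"
      by (subst cmean_centred[where t = t]) (auto intro!: continuous_on_poisson w simp: pK)
    then show ?thesis using cmean_poisson_one[OF w] by simp
  qed
  \<comment> \<open>The excess of the bound over the integral: \<open>V\<close> is nonnegative, vanishes at \<open>0\<close>, and \<open>K' \<cdot> V\<close> is nonpositive.\<close>
  define V where "V s = 2 * s * \<alpha> - integral {0..s} v" for s
  have V0: "0 \<le> V s" if "0 \<le> s" "s \<le> pi" for s
    using avg[OF that] integral_centred_interval[OF continuous_on_circle_cis[OF F] that(1), of t]
    by (simp add: V_def v_def[abs_def])
  have dV: "(V has_real_derivative 2 * \<alpha> - v s) (at s within {0..pi})" if "s \<in> {0..pi}" for s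
    unfolding V_def[abs_def]
    by (auto intro!: derivative_eq_intros Henstock_Kurzweil_Integration.integral_has_real_derivative[OF vc that])
  have Vc: "continuous_on {0..pi} V"
    using dV by (intro DERIV_continuous_on) blast
  have "((\<lambda>s. K' s * V s + (2 * \<alpha> - v s) * K s) has_integral (K pi * V pi - K 0 * V 0)) {0..pi}"
  proof (rule fundamental_theorem_of_calculus)
    fix s assume "s \<in> {0..pi}"
    from DERIV_mult[OF dK dV[OF this]]
    show "((\<lambda>s. K s * V s) has_vector_derivative K' s * V s + (2 * \<alpha> - v s) * K s) (at s within {0..pi})"
      by (simp add: has_real_derivative_iff_has_vector_derivative)
  qed simp
  then have "K pi * V pi = integral {0..pi} (\<lambda>s. K' s * V s + (2 * \<alpha> - v s) * K s)"
    by (simp add: integral_unique V_def)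
  also have "\<dots> \<le> integral {0..pi} (\<lambda>s. (K s * 2) * \<alpha> - K s * v s)"
  proof (intro integral_le integrable_continuous_real continuous_intros Kc K'c vc Vc)
    fix s assume "s \<in> {0..pi}"
    then have "K' s * V s \<le> 0" using K'le V0 by (auto intro: mult_nonpos_nonneg)
    then show "K' s * V s + (2 * \<alpha> - v s) * K s \<le> (K s * 2) * \<alpha> - K s * v s"
      by (simp add: algebra_simps)
  qed
  also have "\<dots> = integral {0..pi} (\<lambda>s. K s * 2) * \<alpha> - integral {0..pi} (\<lambda>s. K s * v s)"
    by (subst integral_diff) (auto intro!: integrable_continuous_real continuous_intros Kc vc)
  also have "\<dots> = 2 * pi * \<alpha> - 2 * pi * cmean (\<lambda>\<zeta>. F \<zeta> * poisson w \<zeta>)"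
    using 1 2 by simp
  finally have "K pi * V pi \<le> 2 * pi * \<alpha> - 2 * pi * cmean (\<lambda>\<zeta>. F \<zeta> * poisson w \<zeta>)" .
  moreover have "0 \<le> K pi * V pi" by (intro mult_nonneg_nonneg K0 V0) auto
  ultimately have "2 * pi * cmean (\<lambda>\<zeta>. F \<zeta> * poisson w \<zeta>) \<le> 2 * pi * \<alpha>" by linarith
  then show ?thesis by (simp add: w_def)
qed

text \<open>
  At each point of \<open>E\<close> some symmetric average of \<open>\<bar>f\<bar>\<close> exceeds the level.  Vitali's covering lemma selects
  disjoint intervals of this kind whose fivefold enlargements cover \<open>E\<close>.
\<close>

lemma maximal_inequality_analytic:
  assumes f: "f analytic_on cball 0 1" and lam: "0 < \<alpha>"
  defines "E \<equiv> {t \<in> {0..2*pi}. \<exists>r\<in>{0<..<1}. \<alpha> < cmod (f (of_real r * cis t))}"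
  shows "E \<in> lmeasurable" "measure lebesgue E \<le> 20 * pi / \<alpha> * cmean (\<lambda>\<zeta>. cmod (f \<zeta>))"
proof -
  note cf = analytic_cball_imp_continuous[OF f]
  have ca: "continuous_on \<C> (\<lambda>\<zeta>. cmod (f \<zeta>))" by (intro continuous_intros cf)
  let ?F = "\<lambda>x. cmod (f (cis x))"
  have E_eq: "E = {0..2*pi} \<inter> (\<Union>r\<in>{0<..<1}. {t. \<alpha> < cmod (f (of_real r * cis t))})"
    by (auto simp: E_def)
  have "open {t. \<alpha> < cmod (f (of_real r * cis t))}" if "r \<in> {0<..<1}" for r
  proof (rule open_Collect_less)
    show "continuous_on UNIV (\<lambda>t. cmod (f (of_real r * cis t)))"
      by (intro continuous_intros continuous_on_compose2[OF cf(1)]) (use that in \<open>auto simp: norm_mult\<close>)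
  qed (intro continuous_intros)
  then have "open (\<Union>r\<in>{0<..<1}. {t. \<alpha> < cmod (f (of_real r * cis t))})" by blast
  then have "(\<Union>r\<in>{0<..<1}. {t. \<alpha> < cmod (f (of_real r * cis t))}) \<in> sets lebesgue"
    by (metis borel_open sets_completionI_sets sets_lborel)
  then show meas: "E \<in> lmeasurable"
    unfolding E_eq by (intro fmeasurable_Int_fmeasurable) auto
  have "\<exists>s. 0 < s \<and> s \<le> pi \<and> 2 * s * \<alpha> < integral {t - s..t + s} ?F" if "t \<in> E" for t
  proof (rule ccontr)
    assume "\<not> ?thesis"
    then have avg: "integral {t - s..t + s} ?F \<le> 2 * s * \<alpha>" if "0 \<le> s" "s \<le> pi" for s
      using that by (cases "s = 0") force+
    obtain r where r: "0 < r" "r < 1" "\<alpha> < cmod (f (of_real r * cis t))"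
      using \<open>t \<in> E\<close> by (auto simp: E_def)
    let ?w = "of_real r * cis t"
    have w: "?w \<in> \<D>" using r by (simp add: norm_mult)
    have "cmod (f ?w) = cmod (cmean (\<lambda>\<zeta>. f \<zeta> * of_real (poisson ?w \<zeta>)))"
      using poisson_cmean[OF f w] by simp
    also have "\<dots> \<le> cmean (\<lambda>\<zeta>. cmod (f \<zeta> * of_real (poisson ?w \<zeta>)))"
      by (intro norm_cmean_le continuous_intros cf continuous_on_poisson w)
    also have "\<dots> = cmean (\<lambda>\<zeta>. cmod (f \<zeta>) * poisson ?w \<zeta>)"
      by (simp add: norm_mult poisson_nonneg[OF w])
    also have "\<dots> \<le> \<alpha>"
      by (rule poisson_mean_le_of_averages[OF ca r(1,2) avg])
    finally show False using r(3) by simp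
  qed
  then obtain s where s: "\<And>t. t \<in> E \<Longrightarrow> 0 < s t" "\<And>t. t \<in> E \<Longrightarrow> s t \<le> pi"
    and big: "\<And>t. t \<in> E \<Longrightarrow> 2 * s t * \<alpha> < integral {t - s t..t + s t} ?F" by metis
  obtain D where D: "countable D" "D \<subseteq> E"
    and disj: "pairwise (\<lambda>i j. disjnt (cball i (s i)) (cball j (s j))) D"
    and cov: "E \<subseteq> (\<Union>i\<in>D. cball i (5 * s i))"
  proof (rule Vitali_covering_lemma_cballs[where S = E and K = E and a = "\<lambda>t. t" and r = s and B = pi])
    show "E \<subseteq> (\<Union>i\<in>E. cball i (s i))" using s(1) by (force intro: less_imp_le)
  qed (use s in auto)
  let ?B = "20 * pi / \<alpha> * cmean (\<lambda>\<zeta>. cmod (f \<zeta>))"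
  have fin: "measure lebesgue (\<Union>i\<in>I. cball i (5 * s i)) \<le> ?B" if I: "I \<subseteq> D" "finite I" for I
  proof -
    have IE: "i \<in> E" if "i \<in> I" for i using that I D by blast
    have ic: "?F integrable_on {a..b}" for a b
      by (intro circle_integrable ca)
    have U: "(?F has_integral (\<Sum>i\<in>I. integral {i - s i..i + s i} ?F)) (\<Union>i\<in>I. {i - s i..i + s i})"
    proof (rule has_integral_UN[OF I(2)])
      show "(?F has_integral integral {i - s i..i + s i} ?F) {i - s i..i + s i}" for i
        using ic by (rule integrable_integral)
      show "pairwise (\<lambda>i j. negligible ({i - s i..i + s i} \<inter> {j - s j..j + s j})) I"
      proof (rule pairwiseI)
        fix i j assume "i \<in> I" "j \<in> I" "i \<noteq> j"
        then have "disjnt (cball i (s i)) (cball j (s j))"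
          using disj I(1) by (auto simp: pairwise_def)
        then show "negligible ({i - s i..i + s i} \<inter> {j - s j..j + s j})"
          by (simp add: cball_eq_atLeastAtMost disjnt_def)
      qed
    qed
    have "(\<Sum>i\<in>I. 2 * s i * \<alpha>) \<le> (\<Sum>i\<in>I. integral {i - s i..i + s i} ?F)"
      by (intro sum_mono less_imp_le big IE)
    also have "\<dots> = integral (\<Union>i\<in>I. {i - s i..i + s i}) ?F"
      using U by (simp add: integral_unique)
    also have "\<dots> \<le> integral {- pi..3 * pi} ?F"
    proof (rule integral_subset_le)
      show "(\<Union>i\<in>I. {i - s i..i + s i}) \<subseteq> {- pi..3 * pi}"
        using IE s(2) by (fastforce simp: E_def)
      show "?F integrable_on (\<Union>i\<in>I. {i - s i..i + s i})" using U by blast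
    qed (use ic in auto)
    also have "\<dots> = integral {- pi..pi} ?F + integral {pi..3 * pi} ?F"
      by (intro Henstock_Kurzweil_Integration.integral_combine[symmetric] ic) auto
    \<comment> \<open>Two periods, because the intervals around points of one period may overlap its ends.\<close>
    also have "\<dots> = 4 * pi * cmean (\<lambda>\<zeta>. cmod (f \<zeta>))"
      using cmean_period[OF ca, of "- pi"] cmean_period[OF ca, of pi] by simp
    finally have le: "(\<Sum>i\<in>I. 2 * s i * \<alpha>) \<le> 4 * pi * cmean (\<lambda>\<zeta>. cmod (f \<zeta>))" .
    have "measure lebesgue (\<Union>i\<in>I. cball i (5 * s i)) \<le> (\<Sum>i\<in>I. measure lebesgue (cball i (5 * s i)))"
      by (intro measure_UNION_le I) auto
    also have "\<dots> = (\<Sum>i\<in>I. 10 * s i)"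
      using s(1) IE by (intro sum.cong) (auto simp: cball_eq_atLeastAtMost less_imp_le)
    also have "\<dots> = 5 / \<alpha> * (\<Sum>i\<in>I. 2 * s i * \<alpha>)"
      unfolding sum_distrib_left using lam by (intro sum.cong) auto
    also have "\<dots> \<le> 5 / \<alpha> * (4 * pi * cmean (\<lambda>\<zeta>. cmod (f \<zeta>)))"
      using le lam by (intro mult_left_mono) auto
    finally show ?thesis by (simp add: mult.assoc)
  qed
  have "(\<Union>i\<in>D. cball i (5 * s i)) \<in> lmeasurable" "measure lebesgue (\<Union>i\<in>D. cball i (5 * s i)) \<le> ?B"
    by (rule fmeasurable_UN_bound[OF D(1) _ fin] measure_UN_bound[OF D(1) _ fin]; simp)+
  then show "measure lebesgue E \<le> ?B"
    using measure_mono_fmeasurable[OF cov] meas by (meson fmeasurableD order_trans)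
qed

text \<open>
  The set \<open>E\<close> is the increasing union of the corresponding sets for dilations of \<open>d\<close>.
\<close>

lemma maximal_inequality:
  assumes d: "d holomorphic_on \<D>" and lam: "0 < \<alpha>"
    and M: "\<And>n. cmean (\<lambda>\<zeta>. (cmod (d (of_real (radius n) * \<zeta>)))\<^sup>2) \<le> M"
  defines "E \<equiv> {t \<in> {0..2*pi}. \<exists>r\<in>{0<..<1}. \<alpha> < cmod (d (of_real r * cis t))}"
  shows "E \<in> lmeasurable" "measure lebesgue E \<le> 20 * pi / \<alpha> * sqrt M"
proof -
  define S where "S n = {t \<in> {0..2*pi}. \<exists>r\<in>{0<..<1}. \<alpha> < cmod (d (of_real (radius n) * (of_real r * cis t)))}" for n
  have an: "(\<lambda>z. d (of_real (radius n) * z)) analytic_on cball 0 1" for n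
    by (intro analytic_dilate d radius)
  note ca = analytic_cball_imp_continuous(2)[OF an]
  have S1: "S n \<in> lmeasurable" for n
    unfolding S_def by (rule maximal_inequality_analytic(1)[OF an lam])
  have S2: "measure lebesgue (S n) \<le> 20 * pi / \<alpha> * sqrt M" for n
  proof -
    let ?F = "\<lambda>\<zeta>. cmod (d (of_real (radius n) * \<zeta>))"
    have "(cmean (\<lambda>z. ?F z * 1))\<^sup>2 \<le> cmean (\<lambda>z. (?F z)\<^sup>2 * 1)"
      by (rule cmean_cauchy_schwarz) (auto intro!: continuous_intros ca)
    then have "(cmean ?F)\<^sup>2 \<le> M" using M[of n] by simp
    then have "cmean ?F \<le> sqrt M" by (rule real_le_rsqrt)
    then have "20 * pi / \<alpha> * cmean ?F \<le> 20 * pi / \<alpha> * sqrt M"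
      using lam by (intro mult_left_mono) auto
    then show ?thesis
      using maximal_inequality_analytic(2)[OF an[of n] lam] unfolding S_def by linarith
  qed
  have rep: "\<exists>r'\<in>{0<..<1}. of_real (radius n) * (of_real r' * cis t) = of_real r * cis t"
    if "0 < r" "r < radius n" for r n t
    using that radius[of n] by (intro bexI[of _ "r / radius n"]) auto
  have S3: "S n \<subseteq> S (Suc n)" for n
  proof
    fix t assume "t \<in> S n"
    then obtain r where t: "t \<in> {0..2*pi}" and r: "0 < r" "r < 1" 
      and big: "\<alpha> < cmod (d (of_real (radius n * r) * cis t))"
      by (auto simp: S_def mult.assoc)
    have "radius n * r < radius (Suc n)"
    proof -
      have "radius n * r \<le> radius n * 1" using r radius[of n] by (intro mult_left_mono) auto
      also have "\<dots> < radius (Suc n)" by (simp add: radius_def field_simps)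
      finally show ?thesis .
    qed
    then obtain r' where "r' \<in> {0<..<1}" "of_real (radius (Suc n)) * (of_real r' * cis t) = of_real (radius n * r) * cis t"
      using rep[of "radius n * r" "Suc n" t] r radius[of n] by auto
    then have "\<exists>r\<in>{0<..<1}. \<alpha> < cmod (d (of_real (radius (Suc n)) * (of_real r * cis t)))"
      using big by (intro bexI[of _ r']) (simp only:)
    then show "t \<in> S (Suc n)" using t unfolding S_def by blast
  qed
  have ES: "E = (\<Union>n. S n)"
  proof (intro subset_antisym subsetI)
    fix t assume "t \<in> E"
    then obtain r where t: "t \<in> {0..2*pi}" and r: "0 < r" "r < 1" 
      and big: "\<alpha> < cmod (d (of_real r * cis t))" by (auto simp: E_def)
    have "eventually (\<lambda>n. r < radius n) sequentially"
      using radius_tendsto r(2) by (rule order_tendstoD)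
    then obtain n where "r < radius n" by (auto simp: eventually_sequentially)
    with rep[of r n t] r obtain r' where "r' \<in> {0<..<1}" "of_real (radius n) * (of_real r' * cis t) = of_real r * cis t"
      by blast
    then have "\<exists>r\<in>{0<..<1}. \<alpha> < cmod (d (of_real (radius n) * (of_real r * cis t)))"
      using big by (intro bexI[of _ r']) (simp only:)
    then have "t \<in> S n" using t unfolding S_def by blast
    then show "t \<in> (\<Union>n. S n)" by blast
  next
    fix t assume "t \<in> (\<Union>n. S n)"
    then obtain n r where t: "t \<in> {0..2*pi}" and r: "0 < r" "r < 1" 
      and big: "\<alpha> < cmod (d (of_real (radius n * r) * cis t))"
      by (auto simp: S_def mult.assoc)
    have "radius n * r < 1 * 1" using r radius[of n] by (intro mult_strict_mono) auto
    moreover have "0 < radius n * r" using r radius[of n] by simp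
    ultimately have "radius n * r \<in> {0<..<1}" by simp
    then show "t \<in> E" using t big unfolding E_def by blast
  qed
  show "E \<in> lmeasurable"
    unfolding ES by (rule measurable_nested_Union[where S = S, OF S1 S2 S3])
  show "measure lebesgue E \<le> 20 * pi / \<alpha> * sqrt M"
    unfolding ES using measure_nested_Union[where S = S, OF S1 S2 S3] by (rule LIMSEQ_le_const2) (use S2 in auto)
qed

section \<open>Radial limits\<close>

text \<open>
  Membership in the Hardy space with exponent two, in terms of circle means.
\<close>

definition square_bounded :: "(complex \<Rightarrow> complex) \<Rightarrow> bool" where
  "square_bounded f \<longleftrightarrow> f holomorphic_on \<D> \<and> 
     (\<exists>C. \<forall>r\<in>{0<..<1}. cmean (\<lambda>\<zeta>. (cmod (f (of_real r * \<zeta>)))\<^sup>2) \<le> C)"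

lemma square_bounded_summable:
  assumes "square_bounded f"
  shows "summable (\<lambda>k. (cmod (tcoef f k))\<^sup>2)"
proof -
  obtain C where hf: "f holomorphic_on \<D>" and C: "\<And>r. r\<in>{0<..<1} \<Longrightarrow> cmean (\<lambda>\<zeta>. (cmod (f (of_real r * \<zeta>)))\<^sup>2) \<le> C"
    using assms unfolding square_bounded_def by blast
  have part: "(\<Sum>k<N. (radius n ^ k * cmod (tcoef f k))\<^sup>2) \<le> C" for n N
  proof -
    have an: "(\<lambda>z. f (of_real (radius n) * z)) analytic_on cball 0 1"
      by (intro analytic_dilate hf radius)
    have "tcoef (\<lambda>z. f (of_real (radius n) * z)) k = of_real (radius n) ^ k * tcoef f k" for k
      by (rule tcoef_scale[OF hf]) (use radius[of n] in simp)
    with parseval[OF an] have p: "(\<lambda>k. (radius n ^ k * cmod (tcoef f k))\<^sup>2) sums cmean (\<lambda>\<zeta>. (cmod (f (of_real (radius n) * \<zeta>)))\<^sup>2)"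
      using radius[of n] by (simp add: norm_mult norm_power)
    have "(\<Sum>k<N. (radius n ^ k * cmod (tcoef f k))\<^sup>2) \<le> (\<Sum>k. (radius n ^ k * cmod (tcoef f k))\<^sup>2)"
      by (intro sum_le_suminf sums_summable[OF p]) auto
    also have "\<dots> \<le> C" using C[of "radius n"] radius[of n] p by (simp add: sums_unique[symmetric])
    finally show ?thesis .
  qed
  have "(\<Sum>k<N. (cmod (tcoef f k))\<^sup>2) \<le> C" for N
  proof -
    have "(\<lambda>n. \<Sum>k<N. (radius n ^ k * cmod (tcoef f k))\<^sup>2) \<longlonglongrightarrow> (\<Sum>k<N. (1 ^ k * cmod (tcoef f k))\<^sup>2)"
      by (intro tendsto_intros radius_tendsto)
    then have "(\<Sum>k<N. (1 ^ k * cmod (tcoef f k))\<^sup>2) \<le> C"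
      by (rule LIMSEQ_le_const2) (use part in auto)
    then show ?thesis by simp
  qed
  then show ?thesis by (intro summableI_nonneg_bounded) auto
qed

text \<open>
  The square of the distance in the Hardy space with exponent two between \<open>f\<close> and its dilation by
  \<open>radius n\<close>.
\<close>

definition gap :: "(complex \<Rightarrow> complex) \<Rightarrow> nat \<Rightarrow> real" where
  "gap f n = (\<Sum>k. (cmod (tcoef f k))\<^sup>2 * (1 - radius n ^ k)\<^sup>2)"

lemma gap_summable:
  assumes "square_bounded f"
  shows "summable (\<lambda>k. (cmod (tcoef f k))\<^sup>2 * (1 - radius n ^ k)\<^sup>2)"
proof (rule summable_comparison_test'[OF square_bounded_summable[OF assms], of 0])
  fix k
  have "(1 - radius n ^ k)\<^sup>2 \<le> 1"
    using radius[of n] by (intro power_le_one) (auto intro: power_le_one less_imp_le)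
  then show "norm ((cmod (tcoef f k))\<^sup>2 * (1 - radius n ^ k)\<^sup>2) \<le> (cmod (tcoef f k))\<^sup>2"
    by (simp add: mult_left_le)
qed

lemma gap_tendsto:
  assumes "square_bounded f"
  shows "gap f \<longlonglongrightarrow> 0"
proof -
  have "((\<lambda>n. suminf (\<lambda>k. (cmod (tcoef f k))\<^sup>2 * (1 - radius n ^ k)\<^sup>2)) \<longlongrightarrow> suminf (\<lambda>k::nat. 0::real)) sequentially"
  proof (rule tannerys_theorem[THEN conjunct2, THEN conjunct2])
    fix k
    have "(\<lambda>n. (cmod (tcoef f k))\<^sup>2 * (1 - radius n ^ k)\<^sup>2) \<longlonglongrightarrow> (cmod (tcoef f k))\<^sup>2 * (1 - 1 ^ k)\<^sup>2"
      by (intro tendsto_intros radius_tendsto)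
    then show "(\<lambda>n. (cmod (tcoef f k))\<^sup>2 * (1 - radius n ^ k)\<^sup>2) \<longlonglongrightarrow> 0" by simp
  next
    have "norm ((cmod (tcoef f k))\<^sup>2 * (1 - radius n ^ k)\<^sup>2) \<le> (cmod (tcoef f k))\<^sup>2" for n k
    proof -
      have "(1 - radius n ^ k)\<^sup>2 \<le> 1"
        using radius[of n] by (intro power_le_one) (auto intro: power_le_one less_imp_le)
      then show ?thesis by (simp add: mult_left_le)
    qed
    then show "\<forall>\<^sub>F (k, n) in sequentially \<times>\<^sub>F sequentially. norm ((cmod (tcoef f k))\<^sup>2 * (1 - radius n ^ k)\<^sup>2) \<le> (cmod (tcoef f k))\<^sup>2"
      by (intro always_eventually) auto
  qed (use square_bounded_summable[OF assms] in auto)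
  then show ?thesis by (simp add: gap_def[abs_def])
qed

lemma dilation_gap:
  assumes f: "square_bounded f" and r: "0 < r" "r < 1" and s: "0 < s" "s < 1"
    and le: "\<And>k. \<bar>r ^ k - s ^ k\<bar> \<le> 1 - radius n ^ k"
  shows "cmean (\<lambda>\<zeta>. (cmod (f (of_real r * \<zeta>) - f (of_real s * \<zeta>)))\<^sup>2) \<le> gap f n"
proof -
  have hf: "f holomorphic_on \<D>" using f by (simp add: square_bounded_def)
  have an: "(\<lambda>z. f (of_real r * z)) analytic_on cball 0 1" if "0 < r" "r < 1" for r
    by (intro analytic_dilate hf that)
  have an': "(\<lambda>z. - f (of_real s * z)) analytic_on cball 0 1"
    by (intro analytic_intros an s)
  have tc: "tcoef (\<lambda>z. f (of_real r * z)) k = of_real r ^ k * tcoef f k" if "0 < r" "r < 1" for r k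
    by (rule tcoef_scale[OF hf]) (use that in simp)
  have "tcoef (\<lambda>z. - f (of_real s * z)) k = - tcoef (\<lambda>z. f (of_real s * z)) k" for k
  proof -
    have "tcoef (\<lambda>z. f (of_real s * z) + - f (of_real s * z)) k = 
        tcoef (\<lambda>z. f (of_real s * z)) k + tcoef (\<lambda>z. - f (of_real s * z)) k"
      by (rule tcoef_add[OF an[OF s] an'])
    moreover have "tcoef (\<lambda>z. f (of_real s * z) + - f (of_real s * z)) k = 0"
      by (simp add: tcoef_def)
    ultimately show ?thesis by (simp add: add_eq_0_iff)
  qed
  then have tcd: "tcoef (\<lambda>z. f (of_real r * z) + - f (of_real s * z)) k = of_real (r ^ k - s ^ k) * tcoef f k" for k
    by (subst tcoef_add[OF an[OF r] an']) (simp add: tc r s left_diff_distrib)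
  have "(\<lambda>k. (cmod (tcoef f k))\<^sup>2 * (r ^ k - s ^ k)\<^sup>2) sums cmean (\<lambda>\<zeta>. (cmod (f (of_real r * \<zeta>) + - f (of_real s * \<zeta>)))\<^sup>2)"
    using parseval[OF analytic_on_add[OF an[OF r] an']]
    unfolding tcd norm_mult norm_of_real power_mult_distrib by (simp add: mult.commute)
  moreover have "(\<Sum>k. (cmod (tcoef f k))\<^sup>2 * (r ^ k - s ^ k)\<^sup>2) \<le> gap f n"
    unfolding gap_def
  proof (rule suminf_le)
    fix k
    have "(r ^ k - s ^ k)\<^sup>2 \<le> (1 - radius n ^ k)\<^sup>2"
      using le[of k] by (rule abs_le_square_iff[THEN iffD1, OF order_trans]) simp
    then show "(cmod (tcoef f k))\<^sup>2 * (r ^ k - s ^ k)\<^sup>2 \<le> (cmod (tcoef f k))\<^sup>2 * (1 - radius n ^ k)\<^sup>2"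
      by (intro mult_left_mono) auto
  qed (use calculation gap_summable[OF f] in \<open>auto simp: sums_iff\<close>)
  ultimately show ?thesis by (simp add: sums_unique[symmetric])
qed

text \<open>
  The dilation of \<open>f\<close> by \<open>radius n\<close> is continuous across the circle and does not oscillate.  So the set is
  contained in the exceptional set of the maximal inequality for the difference of \<open>f\<close> and this dilation,
  whose measure tends to zero with \<open>gap f n\<close>.
\<close>

lemma radial_oscillation_negligible:
  assumes f: "square_bounded f" and lam: "0 < \<alpha>"
  shows "negligible {t \<in> {0..2*pi}. \<forall>R<1. \<exists>r\<in>{R<..<1}. \<exists>s\<in>{R<..<1}. 
           3 * \<alpha> < cmod (f (of_real r * cis t) - f (of_real s * cis t))}" (is "negligible ?N")
proof -
  have hf: "f holomorphic_on \<D>" using f by (simp add: square_bounded_def)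
  show ?thesis
    unfolding negligible_outer
  proof (intro allI impI)
    fix e :: real assume "0 < e"
    have "(\<lambda>n. 20 * pi / \<alpha> * sqrt (gap f n)) \<longlonglongrightarrow> 20 * pi / \<alpha> * sqrt 0"
      by (intro tendsto_intros gap_tendsto f)
    then have "eventually (\<lambda>n. 20 * pi / \<alpha> * sqrt (gap f n) < e) sequentially"
      using \<open>0 < e\<close> by (intro order_tendstoD) auto
    then obtain n where n: "20 * pi / \<alpha> * sqrt (gap f n) < e"
      by (auto simp: eventually_sequentially)
    let ?\<rho> = "radius n"
    define d where "d z = f z - f (of_real ?\<rho> * z)" for z
    have hd: "d holomorphic_on \<D>"
    proof -
      have "(\<lambda>z. f (of_real ?\<rho> * z)) holomorphic_on cball 0 1"
        by (intro analytic_imp_holomorphic analytic_dilate hf radius)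
      then have "(\<lambda>z. f (of_real ?\<rho> * z)) holomorphic_on \<D>"
        by (rule holomorphic_on_subset) auto
      then show ?thesis unfolding d_def[abs_def] by (intro holomorphic_intros hf)
    qed
    have M: "cmean (\<lambda>\<zeta>. (cmod (d (of_real (radius j) * \<zeta>)))\<^sup>2) \<le> gap f n" for j
    proof -
      have "cmean (\<lambda>\<zeta>. (cmod (f (of_real (radius j) * \<zeta>) - f (of_real (?\<rho> * radius j) * \<zeta>)))\<^sup>2) \<le> gap f n"
      proof (rule dilation_gap[OF f radius])
        show "?\<rho> * radius j < 1" using mult_strict_mono[of ?\<rho> 1 "radius j" 1] radius[of n] radius[of j] by simp
        fix k
        have p: "0 \<le> radius j ^ k" "radius j ^ k \<le> 1" "0 \<le> ?\<rho> ^ k" "?\<rho> ^ k \<le> 1"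
          using radius[of n] radius[of j] by (auto intro: power_le_one less_imp_le)
        have "radius j ^ k - (?\<rho> * radius j) ^ k = radius j ^ k * (1 - ?\<rho> ^ k)"
          by (simp add: power_mult_distrib algebra_simps)
        then show "\<bar>radius j ^ k - (?\<rho> * radius j) ^ k\<bar> \<le> 1 - ?\<rho> ^ k"
          using p by (simp add: abs_mult mult_left_le_one_le)
      qed (use radius[of n] radius[of j] in auto)
      then show ?thesis by (simp add: d_def mult.assoc)
    qed
    define E where "E = {t \<in> {0..2*pi}. \<exists>r\<in>{0<..<1}. \<alpha> < cmod (d (of_real r * cis t))}"
    have "?N \<subseteq> E"
    proof
      fix t assume t: "t \<in> ?N"
      show "t \<in> E"
      proof (rule ccontr)
        assume "t \<notin> E"
        then have small: "cmod (d (of_real r * cis t)) \<le> \<alpha>" if "0 < r" "r < 1" for r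
          using t that by (force simp: E_def)
        have "isCont f (of_real ?\<rho> * cis t)"
          using holomorphic_on_imp_continuous_on[OF hf] radius[of n]
          by (simp add: continuous_on_eq_continuous_at norm_mult)
        moreover have "((\<lambda>r. of_real ?\<rho> * (of_real r * cis t)) \<longlongrightarrow> of_real ?\<rho> * (of_real 1 * cis t)) (at_left 1)"
          by (intro tendsto_intros)
        ultimately have "((\<lambda>r. f (of_real ?\<rho> * (of_real r * cis t))) \<longlongrightarrow> f (of_real ?\<rho> * cis t)) (at_left 1)"
          using isCont_tendsto_compose[of "of_real ?\<rho> * cis t" f] by simp
        then have "eventually (\<lambda>r. dist (f (of_real ?\<rho> * (of_real r * cis t))) (f (of_real ?\<rho> * cis t)) < \<alpha> / 2) (at_left 1)"
          using lam by (intro tendstoD) auto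
        then obtain R where R: "R < 1" "\<And>r. R < r \<Longrightarrow> r < 1 \<Longrightarrow> 
           cmod (f (of_real ?\<rho> * (of_real r * cis t)) - f (of_real ?\<rho> * cis t)) < \<alpha> / 2"
          unfolding eventually_at_left[of 0 "1::real", OF less_numeral_extra(1)] dist_norm by blast
        \<comment> \<open>Radii must also be positive to be covered by \<open>small\<close>.\<close>
        define R' where "R' = max R 0"
        have "R' < 1" using R by (simp add: R'_def)
        then obtain r s where rs: "r\<in>{R'<..<1}" "s\<in>{R'<..<1}"
          and big: "3 * \<alpha> < cmod (f (of_real r * cis t) - f (of_real s * cis t))" using t by blast
        have rs': "0 < r" "r < 1" "0 < s" "s < 1" "R < r" "R < s" using rs by (auto simp: R'_def)
        let ?a = "\<lambda>r. f (of_real ?\<rho> * (of_real r * cis t))"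
        have "f (of_real r * cis t) - f (of_real s * cis t) = 
            (d (of_real r * cis t) - d (of_real s * cis t)) + ((?a r - f (of_real ?\<rho> * cis t)) - (?a s - f (of_real ?\<rho> * cis t)))"
          by (simp add: d_def)
        then have "cmod (f (of_real r * cis t) - f (of_real s * cis t)) \<le>
           (cmod (d (of_real r * cis t)) + cmod (d (of_real s * cis t))) + 
           (cmod (?a r - f (of_real ?\<rho> * cis t)) + cmod (?a s - f (of_real ?\<rho> * cis t)))"
          by (simp only:) (rule order_trans[OF norm_triangle_ineq add_mono[OF norm_triangle_ineq4 norm_triangle_ineq4]])
        also have "\<dots> \<le> (\<alpha> + \<alpha>) + (\<alpha> / 2 + \<alpha> / 2)"
          using R(2)[of r] R(2)[of s] small[of r] small[of s] rs' by (intro add_mono) auto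
        finally show False using big by simp
      qed
    qed
    moreover have "E \<in> lmeasurable" "measure lebesgue E \<le> 20 * pi / \<alpha> * sqrt (gap f n)"
      unfolding E_def using maximal_inequality[OF hd lam M] by auto
    ultimately show "\<exists>T. ?N \<subseteq> T \<and> T \<in> lmeasurable \<and> measure lebesgue T < e"
      using n by (meson order_le_less_trans)
  qed
qed

lemma radial_limits_period:
  assumes f: "square_bounded f"
  shows "negligible {t \<in> {0..2*pi}. \<not> (\<exists>L. ((\<lambda>r. f (of_real r * cis t)) \<longlongrightarrow> L) (at_left 1))}"
proof -
  define N where "N j = {t \<in> {0..2*pi}. \<forall>R<1. \<exists>r\<in>{R<..<1}. \<exists>s\<in>{R<..<1}. 
           3 * (1 / real (Suc j)) < cmod (f (of_real r * cis t) - f (of_real s * cis t))}" for j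
  have "negligible (N j)" for j
    unfolding N_def by (rule radial_oscillation_negligible[OF f]) simp
  then have "negligible (\<Union>j. N j)"
    by (intro negligible_countable_Union) auto
  moreover have "{t \<in> {0..2*pi}. \<not> (\<exists>L. ((\<lambda>r. f (of_real r * cis t)) \<longlongrightarrow> L) (at_left 1))} \<subseteq> (\<Union>j. N j)"
  proof (rule subsetI, rule ccontr)
    fix t assume t: "t \<in> {t \<in> {0..2*pi}. \<not> (\<exists>L. ((\<lambda>r. f (of_real r * cis t)) \<longlongrightarrow> L) (at_left 1))}"
      and nt: "t \<notin> (\<Union>j. N j)"
    let ?h = "\<lambda>r. f (of_real r * cis t)"
    have osc: "\<exists>R<1. \<forall>r s. R < r \<longrightarrow> r < 1 \<longrightarrow> R < s \<longrightarrow> s < 1 \<longrightarrow> cmod (?h r - ?h s) < e" if e0: "0 < e" for e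
    proof -
      obtain j where j: "inverse (real (Suc j)) < e / 3"
        using reals_Archimedean[of "e / 3"] e0 by (meson divide_pos_pos zero_less_numeral)
      have "t \<notin> N j" using nt by blast
      then obtain R where "R < 1" "\<And>r s. r\<in>{R<..<1} \<Longrightarrow> s\<in>{R<..<1} \<Longrightarrow> cmod (?h r - ?h s) \<le> 3 * (1 / real (Suc j))"
        using t unfolding N_def by (auto simp: not_less)
      moreover have "3 * (1 / real (Suc j)) < e" using j by (simp add: inverse_eq_divide del: of_nat_Suc)
      ultimately show ?thesis
        by (intro exI[of _ R]) (auto intro: order_le_less_trans)
    qed
    have ev: "\<exists>n. \<forall>m\<ge>n. R < radius m" if "R < 1" for R
      using order_tendstoD(1)[OF radius_tendsto that] by (simp add: eventually_sequentially)
    have "Cauchy (\<lambda>n. ?h (radius n))"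
    proof (rule metric_CauchyI)
      fix e :: real assume "0 < e"
      from osc[OF this] obtain R where R: "R < 1" "\<And>r s. R < r \<Longrightarrow> r < 1 \<Longrightarrow> R < s \<Longrightarrow> s < 1 \<Longrightarrow> cmod (?h r - ?h s) < e" by blast
      obtain n where "\<And>m. m \<ge> n \<Longrightarrow> R < radius m" using ev[OF R(1)] by blast
      then show "\<exists>M. \<forall>m\<ge>M. \<forall>n\<ge>M. dist (?h (radius m)) (?h (radius n)) < e"
        using R radius unfolding dist_norm by (intro exI[of _ n]) auto
    qed
    then obtain L where L: "(\<lambda>n. ?h (radius n)) \<longlonglongrightarrow> L"
      using convergent_eq_Cauchy by blast
    have "(?h \<longlongrightarrow> L) (at_left 1)"
    proof (rule tendstoI)
      fix e :: real assume "0 < e"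
      then obtain R where R: "R < 1" "\<And>r s. R < r \<Longrightarrow> r < 1 \<Longrightarrow> R < s \<Longrightarrow> s < 1 \<Longrightarrow> cmod (?h r - ?h s) < e / 2"
        using osc[of "e / 2"] by auto
      have "dist (?h r) L < e" if "R < r" "r < 1" for r
      proof -
        obtain n where n: "\<And>m. m \<ge> n \<Longrightarrow> R < radius m" using ev[OF R(1)] by blast
        have "(\<lambda>m. cmod (?h r - ?h (radius m))) \<longlonglongrightarrow> cmod (?h r - L)"
          by (intro tendsto_intros L)
        then have "cmod (?h r - L) \<le> e / 2"
          by (rule LIMSEQ_le_const2) (use R(2)[OF that n radius(2)] in \<open>auto intro: less_imp_le\<close>)
        then show ?thesis using \<open>0 < e\<close> by (simp add: dist_norm)
      qed
      then show "eventually (\<lambda>r. dist (?h r) L < e) (at_left 1)"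
        using R(1) unfolding eventually_at_left[of 0 "1::real", OF less_numeral_extra(1)] by blast
    qed
    then show False using t by blast
  qed
  ultimately show ?thesis by (rule negligible_subset)
qed

text \<open>
  Fatou's theorem for the Hardy space with exponent two; the exceptional set is periodic.
\<close>

lemma radial_limits_ae:
  assumes f: "square_bounded f"
  shows "AE t in lebesgue. \<exists>L. ((\<lambda>r. f (of_real r * cis t)) \<longlongrightarrow> L) (at_left 1)"
proof -
  define P where "P t \<longleftrightarrow> (\<exists>L. ((\<lambda>r. f (of_real r * cis t)) \<longlongrightarrow> L) (at_left 1))" for t
  have per: "P (2 * pi * of_int k + t) \<longleftrightarrow> P t" for k t
  proof -
    have "cis (2 * pi * of_int k + t) = cis t"
      by (simp add: cis_mult[symmetric] cis_multiple_2pi)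
    then show ?thesis by (simp add: P_def)
  qed
  have "negligible {t \<in> {0..2*pi}. \<not> P t}"
    using radial_limits_period[OF f] by (simp only: P_def)
  then have "negligible (\<Union>k. (+) (2 * pi * of_int k) ` {t \<in> {0..2*pi}. \<not> P t})"
    by (intro negligible_countable_Union) (blast intro: negligible_translation countableI_type countable_image)+
  moreover have "{t. \<not> P t} \<subseteq> (\<Union>k. (+) (2 * pi * of_int k) ` {t \<in> {0..2*pi}. \<not> P t})"
  proof
    fix t assume t: "t \<in> {t. \<not> P t}"
    define k where "k = \<lfloor>t / (2 * pi)\<rfloor>"
    define s where "s = t - 2 * pi * of_int k"
    have "of_int k \<le> t / (2 * pi)" "t / (2 * pi) < of_int k + 1"
      unfolding k_def by linarith+
    then have "0 \<le> s" "s \<le> 2 * pi" unfolding s_def by (simp_all add: field_simps)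
    moreover have "t = 2 * pi * of_int k + s" by (simp add: s_def)
    moreover then have "\<not> P s" using t per[of k s] by simp
    ultimately show "t \<in> (\<Union>k. (+) (2 * pi * of_int k) ` {t \<in> {0..2*pi}. \<not> P t})" by auto
  qed
  ultimately have "negligible {t. \<not> P t}" by (rule negligible_subset)
  then have "{t. \<not> P t} \<in> null_sets lebesgue" by (simp add: negligible_iff_null_sets)
  then show ?thesis unfolding P_def by (intro AE_I') auto
qed

section \<open>Boundary functions\<close>

text \<open>
  Limits along a fixed sequence of radii keep the boundary function Borel measurable along the circle; where
  the radial limit exists they agree with it.
\<close>

definition boundary :: "(complex \<Rightarrow> complex) \<Rightarrow> complex \<Rightarrow> complex" where
  "boundary f \<zeta> = lim (\<lambda>n. f (of_real (radius n) * \<zeta>))"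

lemma filterlim_radius: "filterlim radius (at_left 1) sequentially"
  unfolding filterlim_at using radius_tendsto radius by (auto intro!: always_eventually simp: less_le)

lemma boundary_values_boundary:
  assumes f: "square_bounded f"
  shows "boundary_values f (boundary f)"
    "AE t in lebesgue. (\<lambda>n. f (of_real (radius n) * cis t)) \<longlonglongrightarrow> boundary f (cis t)"
proof -
  have *: "((\<lambda>r. f (of_real r * cis t)) \<longlongrightarrow> boundary f (cis t)) (at_left 1)"
    "(\<lambda>n. f (of_real (radius n) * cis t)) \<longlonglongrightarrow> boundary f (cis t)"
    if ex: "\<exists>L. ((\<lambda>r. f (of_real r * cis t)) \<longlongrightarrow> L) (at_left 1)" for t
  proof -
    from ex obtain L where L: "((\<lambda>r. f (of_real r * cis t)) \<longlongrightarrow> L) (at_left 1)" by blast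
    have L': "(\<lambda>n. f (of_real (radius n) * cis t)) \<longlonglongrightarrow> L"
      using filterlim_compose[OF L filterlim_radius] .
    have "boundary f (cis t) = L" unfolding boundary_def by (rule limI[OF L'])
    with L L' show "((\<lambda>r. f (of_real r * cis t)) \<longlongrightarrow> boundary f (cis t)) (at_left 1)"
      "(\<lambda>n. f (of_real (radius n) * cis t)) \<longlonglongrightarrow> boundary f (cis t)" by auto
  qed
  show "boundary_values f (boundary f)"
    unfolding boundary_values_def using radial_limits_ae[OF f] by eventually_elim (rule *(1))
  show "AE t in lebesgue. (\<lambda>n. f (of_real (radius n) * cis t)) \<longlonglongrightarrow> boundary f (cis t)"
    using radial_limits_ae[OF f] by eventually_elim (rule *(2))
qed

lemma continuous_imp_lebesgue_measurable:
  assumes "continuous_on UNIV (h :: real \<Rightarrow> 'a::euclidean_space)"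
  shows "h \<in> borel_measurable lebesgue"
  using borel_measurable_continuous_onI[OF assms] by (intro measurable_completion) simp

lemma norm_lebesgue_measurable:
  fixes h :: "real \<Rightarrow> complex"
  shows "h \<in> borel_measurable lebesgue \<Longrightarrow> (\<lambda>t. cmod (h t)) \<in> borel_measurable lebesgue"
  by (rule measurable_compose[OF _ borel_measurable_norm])

lemma indicator_interval_measurable: "indicat_real {a..b::real} \<in> borel_measurable lebesgue"
  by (intro borel_measurable_indicator) simp

lemma set_borel_measurable_interval:
  fixes h :: "real \<Rightarrow> 'a::euclidean_space"
  assumes "h \<in> borel_measurable lebesgue"
  shows "set_borel_measurable lebesgue {a..b} h"
  unfolding set_borel_measurable_def
  by (rule borel_measurable_scaleR[OF indicator_interval_measurable assms])

lemma boundary_measurable: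
  assumes f: "f holomorphic_on \<D>"
  shows "(\<lambda>t. boundary f (cis t)) \<in> borel_measurable lebesgue"
  unfolding boundary_def
  by (intro borel_measurable_lim_metric continuous_imp_lebesgue_measurable
      continuous_on_circle_cis continuous_on_dilate f radius)

text \<open>
  Fatou's lemma, stated so that bounds for circle means of dilations pass to the boundary function.
\<close>

lemma fatou_interval:
  fixes \<phi> :: "nat \<Rightarrow> real \<Rightarrow> real"
  assumes cont: "\<And>n. continuous_on UNIV (\<phi> n)" and nn: "\<And>n t. 0 \<le> \<phi> n t"
    and meas: "\<psi> \<in> borel_measurable lebesgue"
    and lim: "AE t in lebesgue. (\<lambda>n. \<phi> n t) \<longlonglongrightarrow> \<psi> t"
    and bound: "\<And>n. integral {a..b} (\<phi> n) \<le> B"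
  shows "set_integrable lebesgue {a..b} \<psi>" "(LINT t:{a..b}|lebesgue. \<psi> t) \<le> B"
proof -
  have m\<phi>: "(\<lambda>t. indicator {a..b} t * \<phi> n t) \<in> borel_measurable lebesgue" for n
    by (rule borel_measurable_times[OF indicator_interval_measurable continuous_imp_lebesgue_measurable[OF cont]])
  have m\<psi>: "(\<lambda>t. indicator {a..b} t * \<psi> t) \<in> borel_measurable lebesgue"
    by (rule borel_measurable_times[OF indicator_interval_measurable meas])
  have si: "set_integrable lebesgue {a..b} (\<phi> n)" for n
    by (intro absolutely_integrable_continuous_real continuous_on_subset[OF cont]) auto
  have "0 \<le> integral {a..b} (\<phi> 0)" by (intro Henstock_Kurzweil_Integration.integral_nonneg integrable_continuous_real continuous_on_subset[OF cont]) (auto simp: nn)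
  then have B0: "0 \<le> B" using bound[of 0] by linarith
  have Fn: "(\<integral>\<^sup>+ t. ennreal (indicator {a..b} t * \<phi> n t) \<partial>lebesgue) \<le> ennreal B" for n
  proof -
    have "(\<integral>\<^sup>+ t. ennreal (indicator {a..b} t * \<phi> n t) \<partial>lebesgue) = ennreal (LINT t|lebesgue. indicator {a..b} t * \<phi> n t)"
      using si[of n] nn unfolding set_integrable_def by (intro nn_integral_eq_integral) auto
    also have "(LINT t|lebesgue. indicator {a..b} t * \<phi> n t) = integral {a..b} (\<phi> n)"
      using set_lebesgue_integral_eq_integral(2)[OF si[of n]] by (simp add: set_lebesgue_integral_def)
    finally show ?thesis using bound[of n] by (simp add: ennreal_leI)
  qed
  have \<psi>nn: "AE t in lebesgue. 0 \<le> \<psi> t"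
    using lim by eventually_elim (rule LIMSEQ_le_const, auto simp: nn)
  have "(\<integral>\<^sup>+ t. ennreal (indicator {a..b} t * \<psi> t) \<partial>lebesgue) =
        (\<integral>\<^sup>+ t. liminf (\<lambda>n. ennreal (indicator {a..b} t * \<phi> n t)) \<partial>lebesgue)"
  proof (intro nn_integral_cong_AE)
    show "AE t in lebesgue. ennreal (indicator {a..b} t * \<psi> t) = liminf (\<lambda>n. ennreal (indicator {a..b} t * \<phi> n t))"
      using lim
    proof eventually_elim
      case (elim t)
      have "(\<lambda>n. ennreal (indicator {a..b} t * \<phi> n t)) \<longlonglongrightarrow> ennreal (indicator {a..b} t * \<psi> t)"
        by (intro tendsto_intros elim)
      then show ?case by (simp add: lim_imp_Liminf)
    qed
  qed
  also have "\<dots> \<le> liminf (\<lambda>n. \<integral>\<^sup>+ t. ennreal (indicator {a..b} t * \<phi> n t) \<partial>lebesgue)"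
    by (intro nn_integral_liminf measurable_compose[OF m\<phi> measurable_ennreal])
  also have "\<dots> \<le> ennreal B"
    using Fn by (intro Liminf_le) (auto intro: always_eventually)
  finally have nnB: "(\<integral>\<^sup>+ t. ennreal (indicator {a..b} t * \<psi> t) \<partial>lebesgue) \<le> ennreal B" .
  have nnI: "AE t in lebesgue. 0 \<le> indicator {a..b} t * \<psi> t"
    using \<psi>nn by eventually_elim auto
  show int: "set_integrable lebesgue {a..b} \<psi>"
    unfolding set_integrable_def real_scaleR_def
  proof (rule integrableI_nonneg[OF _ nnI])
    show "(\<integral>\<^sup>+ t. ennreal (indicator {a..b} t * \<psi> t) \<partial>lebesgue) < \<infinity>"
      using nnB by (simp add: order_le_less_trans[OF _ ennreal_less_top])
  qed (rule m\<psi>)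
  have "ennreal (LINT t|lebesgue. indicator {a..b} t * \<psi> t) = (\<integral>\<^sup>+ t. ennreal (indicator {a..b} t * \<psi> t) \<partial>lebesgue)"
    using int nnI unfolding set_integrable_def real_scaleR_def by (intro nn_integral_eq_integral[symmetric])
  with nnB have "ennreal (LINT t|lebesgue. indicator {a..b} t * \<psi> t) \<le> ennreal B" by simp
  then show "(LINT t:{a..b}|lebesgue. \<psi> t) \<le> B"
    using B0 by (simp add: set_lebesgue_integral_def)
qed

lemma cmean_le_sqrt:
  assumes "continuous_on \<C> F" "cmean (\<lambda>\<zeta>. (cmod (F \<zeta>))\<^sup>2) \<le> M"
  shows "cmean (\<lambda>\<zeta>. cmod (F \<zeta>)) \<le> sqrt M"
proof -
  have "(cmean (\<lambda>z. cmod (F z) * 1))\<^sup>2 \<le> cmean (\<lambda>z. (cmod (F z))\<^sup>2 * 1)"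
    by (rule cmean_cauchy_schwarz) (auto intro!: continuous_intros assms)
  then show ?thesis using assms(2) by (intro real_le_rsqrt) simp
qed

lemma radius_mono: "m \<le> n \<Longrightarrow> radius m \<le> radius n"
  by (simp add: radius_def frac_le)

text \<open>
  Convergence of the dilations to the boundary function in mean: the squared distance to a
  dilation by a larger radius is at most \<open>gap f n\<close>, and Fatou's lemma lets that radius tend to one.
\<close>

lemma boundary_l1:
  assumes f: "square_bounded f"
  shows "set_integrable lebesgue {0..2*pi} (\<lambda>t. cmod (f (of_real (radius n) * cis t) - boundary f (cis t)))"
    "(LINT t:{0..2*pi}|lebesgue. cmod (f (of_real (radius n) * cis t) - boundary f (cis t))) \<le> 2 * pi * sqrt (gap f n)"
proof -
  have hf: "f holomorphic_on \<D>" using f by (simp add: square_bounded_def)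
  note cd = continuous_on_dilate[OF hf radius]
  let ?\<phi> = "\<lambda>m t. cmod (f (of_real (radius n) * cis t) - f (of_real (radius (m + n)) * cis t))"
  let ?\<psi> = "\<lambda>t. cmod (f (of_real (radius n) * cis t) - boundary f (cis t))"
  have c: "continuous_on UNIV (?\<phi> m)" for m
    by (intro continuous_intros continuous_on_circle_cis cd)
  have m: "?\<psi> \<in> borel_measurable lebesgue"
    by (rule norm_lebesgue_measurable[OF borel_measurable_diff[OF
          continuous_imp_lebesgue_measurable[OF continuous_on_circle_cis[OF cd]] boundary_measurable[OF hf]]])
  have l: "AE t in lebesgue. (\<lambda>m. ?\<phi> m t) \<longlonglongrightarrow> ?\<psi> t"
    using boundary_values_boundary(2)[OF f]
  proof eventually_elim
    case (elim t)
    show ?case by (intro tendsto_intros LIMSEQ_ignore_initial_segment[OF elim])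
  qed
  have b: "integral {0..2*pi} (?\<phi> m) \<le> 2 * pi * sqrt (gap f n)" for m
  proof -
    have "cmean (\<lambda>\<zeta>. (cmod (f (of_real (radius n) * \<zeta>) - f (of_real (radius (m + n)) * \<zeta>)))\<^sup>2) \<le> gap f n"
    proof (rule dilation_gap[OF f radius radius])
      fix k
      have "radius n ^ k \<le> radius (m + n) ^ k" "radius (m + n) ^ k \<le> 1"
        using radius_mono[of n "m + n"] radius[of n] radius[of "m + n"] by (auto intro: power_mono power_le_one less_imp_le)
      then show "\<bar>radius n ^ k - radius (m + n) ^ k\<bar> \<le> 1 - radius n ^ k" by simp
    qed
    then have "cmean (\<lambda>\<zeta>. cmod (f (of_real (radius n) * \<zeta>) - f (of_real (radius (m + n)) * \<zeta>))) \<le> sqrt (gap f n)"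
      by (intro cmean_le_sqrt continuous_on_diff cd)
    then have "2 * pi * cmean (\<lambda>\<zeta>. cmod (f (of_real (radius n) * \<zeta>) - f (of_real (radius (m + n)) * \<zeta>))) \<le> 2 * pi * sqrt (gap f n)"
      by (intro mult_left_mono) auto
    then show ?thesis by (simp add: cmean_def)
  qed
  show "set_integrable lebesgue {0..2*pi} ?\<psi>" "(LINT t:{0..2*pi}|lebesgue. ?\<psi> t) \<le> 2 * pi * sqrt (gap f n)"
    using fatou_interval[OF c _ m l b] by auto
qed

lemma set_integrable_of_norm_diff:
  fixes g h :: "real \<Rightarrow> complex"
  assumes "set_integrable lebesgue {a..b} (\<lambda>t. cmod (h t - g t))" "g \<in> borel_measurable lebesgue"
    "continuous_on UNIV h"
  shows "set_integrable lebesgue {a..b} g"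
proof -
  have h: "set_integrable lebesgue {a..b} h"
    by (intro absolutely_integrable_continuous_real continuous_on_subset[OF assms(3)]) auto
  have "set_integrable lebesgue {a..b} (\<lambda>t. h t - g t)"
    by (rule set_integrable_bound[OF assms(1)])
       (auto intro!: set_borel_measurable_interval borel_measurable_diff assms(2) continuous_imp_lebesgue_measurable[OF assms(3)])
  from set_integral_diff(1)[OF h this] show ?thesis by simp
qed

lemma boundary_integrable:
  assumes f: "square_bounded f"
  shows "set_integrable lebesgue {0..2*pi} (\<lambda>t. boundary f (cis t))"
  by (rule set_integrable_of_norm_diff[OF boundary_l1(1)[OF f, of 0]])
     (use f in \<open>auto simp: square_bounded_def intro!: boundary_measurable continuous_on_circle_cis continuous_on_dilate radius\<close>)

lemma garsia_square_bounded:
  assumes "f \<in> garsia"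
  shows "square_bounded f"
proof -
  obtain C where "\<And>r. r \<in> {0<..<1} \<Longrightarrow> cmean (\<lambda>\<zeta>. cmod (f (of_real r * \<zeta>)) ^ (2 * 1)) \<le> C"
    using garsia_power_mean[OF assms, of 1] by blast
  then have "\<forall>r\<in>{0<..<1}. cmean (\<lambda>\<zeta>. (cmod (f (of_real r * \<zeta>)))\<^sup>2) \<le> C" by simp
  then show ?thesis
    unfolding square_bounded_def using garsia_holomorphic[OF assms] by blast
qed

section \<open>Bounded mean oscillation\<close>

lemma cis_dist_le: "cmod (cis t - cis c) \<le> \<bar>t - c\<bar>"
proof -
  have "exp (\<i> * of_real (t - c)) = cis (t - c)" by (simp only: cis_conv_exp)
  then have "cis t - cis c = cis c * (exp (\<i> * of_real (t - c)) - 1)"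
    by (simp add: right_diff_distrib cis_mult del: of_real_diff)
  then have "cmod (cis t - cis c) = 2 * \<bar>sin ((t - c) / 2)\<bar>"
    by (simp only: norm_mult norm_cis dist_exp_i_1 mult_1)
  also have "\<dots> \<le> 2 * \<bar>(t - c) / 2\<bar>" by (intro mult_left_mono abs_sin_x_le_abs_x) auto
  finally show ?thesis by simp
qed

text \<open>
  The point \<open>w\<close> lies over the midpoint of the arc, at a distance \<open>d\<close> from the circle proportional to the
  length \<open>2 \<pi> d\<close> of the arc.  Points of the arc have distance at most \<open>d (1 + \<pi>)\<close> from \<open>w\<close>, so the Poisson
  kernel of \<open>w\<close> is bounded below on the arc by the reciprocal of a multiple of \<open>d\<close>.
\<close>

lemma arc_integral_le_poisson:
  fixes a b :: real
  assumes ab: "a < b" "b \<le> a + 2 * pi"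
  defines "w \<equiv> of_real (1 - (b - a) / (2 * pi)) * cis ((a + b) / 2)"
  shows "w \<in> \<D>"
    "\<And>F :: complex \<Rightarrow> real. continuous_on \<C> F \<Longrightarrow> (\<And>\<zeta>. \<zeta> \<in> \<C> \<Longrightarrow> 0 \<le> F \<zeta>) \<Longrightarrow>
       integral {a..b} (\<lambda>t. F (cis t)) \<le> (b - a) * (1 + pi)\<^sup>2 * cmean (\<lambda>\<zeta>. F \<zeta> * poisson w \<zeta>)"
proof -
  define d where "d = (b - a) / (2 * pi)"
  have d: "0 < d" "d \<le> 1" using ab by (simp_all add: d_def field_simps)
  have nw: "cmod w = 1 - d" using d by (simp add: w_def d_def[symmetric] norm_mult del: of_real_diff)
  show w: "w \<in> \<D>" using nw d by simp
  have lower: "1 / (d * (1 + pi)\<^sup>2) \<le> poisson w (cis t)" if "t \<in> {a..b}" for t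
  proof -
    have "w = of_real (1 - d) * cis ((a + b) / 2)" by (simp only: w_def d_def)
    then have "cis ((a + b) / 2) - w = of_real d * cis ((a + b) / 2)"
      by (simp add: algebra_simps)
    then have 1: "cmod (cis ((a + b) / 2) - w) = d" using d by (simp add: norm_mult)
    have "\<bar>t - (a + b) / 2\<bar> \<le> (b - a) / 2" using that by (simp add: abs_le_iff field_simps) linarith
    also have "\<dots> = pi * d" by (simp add: d_def)
    finally have 2: "cmod (cis t - cis ((a + b) / 2)) \<le> pi * d" using cis_dist_le order_trans by blast
    have "cmod (cis t - w) \<le> d * (1 + pi)"
      using norm_triangle_ineq[of "cis t - cis ((a + b) / 2)" "cis ((a + b) / 2) - w"] 1 2 by (simp add: algebra_simps)
    then have le: "(cmod (cis t - w))\<^sup>2 \<le> (d * (1 + pi))\<^sup>2" by (intro power_mono) auto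
    have "cis t \<noteq> w" using w by auto
    then have pos: "0 < (cmod (cis t - w))\<^sup>2" by simp
    have "d \<le> 1 - (cmod w)\<^sup>2"
      using d mult_left_mono[of d 1 d] by (simp add: nw power2_eq_square algebra_simps)
    then have "d / (d * (1 + pi))\<^sup>2 \<le> (1 - (cmod w)\<^sup>2) / (cmod (cis t - w))\<^sup>2"
      using d le pos by (intro frac_le) auto
    moreover have "d / (d * (1 + pi))\<^sup>2 = 1 / (d * (1 + pi)\<^sup>2)"
      using d by (simp add: power2_eq_square)
    ultimately show ?thesis by (simp add: poisson_def)
  qed
  fix F :: "complex \<Rightarrow> real"
  assume F: "continuous_on \<C> F" and F0: "\<And>\<zeta>. \<zeta> \<in> \<C> \<Longrightarrow> 0 \<le> F \<zeta>"
  have cFP: "continuous_on \<C> (\<lambda>\<zeta>. F \<zeta> * poisson w \<zeta>)"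
    by (intro continuous_intros F continuous_on_poisson w)
  let ?c = "d * (1 + pi)\<^sup>2"
  have "0 < 1 + pi" using pi_gt_zero by linarith
  then have c0: "0 < ?c" using d by (intro mult_pos_pos zero_less_power) auto
  have "integral {a..b} (\<lambda>t. F (cis t)) \<le> integral {a..b} (\<lambda>t. ?c * (F (cis t) * poisson w (cis t)))"
  proof (intro integral_le circle_integrable F continuous_on_mult continuous_on_const cFP)
    fix t assume t: "t \<in> {a..b}"
    have "1 \<le> ?c * poisson w (cis t)"
      using lower[OF t] c0 by (simp add: divide_le_eq mult.commute)
    then have "F (cis t) * 1 \<le> F (cis t) * (?c * poisson w (cis t))"
      by (intro mult_left_mono F0) auto
    then show "F (cis t) \<le> ?c * (F (cis t) * poisson w (cis t))" by (simp add: mult_ac)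
  qed (intro integrable_continuous_real continuous_on_mult continuous_on_const continuous_on_circle_cis F continuous_on_poisson w)
  also have "\<dots> = ?c * integral {a..b} (\<lambda>t. F (cis t) * poisson w (cis t))" by simp
  also have "\<dots> \<le> ?c * integral {a..a + 2 * pi} (\<lambda>t. F (cis t) * poisson w (cis t))"
    using c0 ab circle_integrable[OF cFP] F0 poisson_nonneg[OF w]
    by (intro mult_left_mono integral_subset_le) auto
  also have "\<dots> = ?c * (2 * pi * cmean (\<lambda>\<zeta>. F \<zeta> * poisson w \<zeta>))"
    by (simp only: cmean_period[OF cFP])
  also have "\<dots> = (b - a) * (1 + pi)\<^sup>2 * cmean (\<lambda>\<zeta>. F \<zeta> * poisson w \<zeta>)"
    by (simp add: d_def)
  finally show "integral {a..b} (\<lambda>t. F (cis t)) \<le> (b - a) * (1 + pi)\<^sup>2 * cmean (\<lambda>\<zeta>. F \<zeta> * poisson w \<zeta>)" .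
qed

text \<open>
  Replacing the mean over the arc by an arbitrary constant changes the mean oscillation at most by a factor
  two.
\<close>

lemma arc_oscillation_le:
  assumes ab: "a < b" and g: "set_integrable lebesgue {a..b} (\<lambda>t. g (cis t))"
    and B: "(LINT t:{a..b}|lebesgue. cmod (g (cis t) - c)) \<le> (b - a) * B"
  shows "arc_oscillation a b g \<le> 2 * B"
proof -
  define m where "m = arc_mean a b g"
  have ci: "set_integrable lebesgue {a..b} (\<lambda>t. x)" for x :: complex
    by (intro absolutely_integrable_continuous_real continuous_intros)
  have ri: "set_integrable lebesgue {a..b} (\<lambda>t. x)" for x :: real
    by (intro absolutely_integrable_continuous_real continuous_intros)
  have cI: "(LINT t:{a..b}|lebesgue. x) = (b - a) *\<^sub>R x" for x :: "'a::euclidean_space"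
    using ab set_lebesgue_integral_eq_integral(2)[OF absolutely_integrable_continuous_real[of a b "\<lambda>t. x"]]
    by (simp add: continuous_on_const)
  have gi: "set_integrable lebesgue {a..b} (\<lambda>t. g (cis t) - x)" for x
    by (intro set_integral_diff g ci)
  have "cmod ((LINT t:{a..b}|lebesgue. g (cis t)) - (b - a) *\<^sub>R c) = cmod (LINT t:{a..b}|lebesgue. g (cis t) - c)"
    using set_integral_diff(2)[OF g ci[of c]] by (simp add: cI)
  also have "\<dots> \<le> (LINT t:{a..b}|lebesgue. cmod (g (cis t) - c))"
    by (rule set_integral_norm_bound[OF gi])
  also have "\<dots> \<le> (b - a) * B" by (rule B)
  finally have "cmod ((LINT t:{a..b}|lebesgue. g (cis t)) - (b - a) *\<^sub>R c) \<le> (b - a) * B" .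
  moreover have "(LINT t:{a..b}|lebesgue. g (cis t)) - (b - a) *\<^sub>R c = (b - a) *\<^sub>R (m - c)"
    using ab by (simp add: m_def arc_mean_def scaleR_conv_of_real field_simps)
  ultimately have mc: "cmod (m - c) \<le> B" using ab by simp
  have "(LINT t:{a..b}|lebesgue. cmod (g (cis t) - m)) \<le> (LINT t:{a..b}|lebesgue. cmod (g (cis t) - c) + B)"
  proof (rule set_integral_mono)
    show "set_integrable lebesgue {a..b} (\<lambda>t. cmod (g (cis t) - m))"
      by (intro set_integrable_norm gi)
    show "set_integrable lebesgue {a..b} (\<lambda>t. cmod (g (cis t) - c) + B)"
      by (intro set_integral_add set_integrable_norm gi ri)
    fix t
    have "cmod (g (cis t) - m) \<le> cmod (g (cis t) - c) + cmod (m - c)"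
      using norm_triangle_ineq4[of "g (cis t) - c" "m - c"] by simp
    then show "cmod (g (cis t) - m) \<le> cmod (g (cis t) - c) + B" using mc by linarith
  qed
  also have "\<dots> = (LINT t:{a..b}|lebesgue. cmod (g (cis t) - c)) + (b - a) * B"
    by (subst set_integral_add(2)) (auto intro!: set_integrable_norm gi ri simp: cI)
  also have "\<dots> \<le> (b - a) * (2 * B)" using B by (simp only: mult.left_commute[of "b - a" 2 B])
  finally show ?thesis
    using ab by (simp add: arc_oscillation_def m_def[symmetric] divide_le_eq mult.commute)
qed

text \<open>
  On an arc the boundary function is compared with the constant \<open>f w\<close>, where \<open>w\<close> is the point belonging to the
  arc.  The bound holds for all dilations with the same constant and passes to the limit.
\<close>

lemma garsia_subset_BMOA:
  assumes f: "f \<in> garsia"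
  shows "f \<in> BMOA"
proof -
  have hf: "f holomorphic_on \<D>" using f by (simp add: garsia_def)
  note sb = garsia_square_bounded[OF f]
  note cd = continuous_on_dilate[OF hf radius]
  let ?g = "boundary f"
  obtain C where C: "\<And>r a. r\<in>{0<..<1} \<Longrightarrow> a\<in>\<D> \<Longrightarrow>
      cmean (\<lambda>\<zeta>. cmod (f (of_real r * \<zeta>) - f (of_real r * a)) ^ (2 * 1) * poisson a \<zeta>) \<le> C"
    using garsiaE[OF f, of 1] by blast
  have "arc_oscillation a b ?g \<le> 2 * ((1 + pi)\<^sup>2 * sqrt C)" if ab: "a < b" "b \<le> a + 2 * pi" for a b
  proof -
    define w where "w = of_real (1 - (b - a) / (2 * pi)) * cis ((a + b) / 2)"
    note w = arc_integral_le_poisson(1)[OF ab, folded w_def]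
      and arc = arc_integral_le_poisson(2)[OF ab, folded w_def]
    \<comment> \<open>The constant depends on the dilation and converges to \<open>f w\<close>.\<close>
    let ?\<phi> = "\<lambda>n t. cmod (f (of_real (radius n) * cis t) - f (of_real (radius n) * w))"
    have c: "continuous_on UNIV (?\<phi> n)" for n
      by (intro continuous_intros continuous_on_circle_cis cd)
    have m: "(\<lambda>t. cmod (?g (cis t) - f w)) \<in> borel_measurable lebesgue"
      by (rule norm_lebesgue_measurable[OF borel_measurable_diff[OF boundary_measurable[OF hf] borel_measurable_const]])
    have l: "AE t in lebesgue. (\<lambda>n. ?\<phi> n t) \<longlonglongrightarrow> cmod (?g (cis t) - f w)"
      using boundary_values_boundary(2)[OF sb]
    proof eventually_elim
      case (elim t)
      show ?case by (intro tendsto_intros elim dilate_tendsto hf w)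
    qed
    have b: "integral {a..b} (?\<phi> n) \<le> (b - a) * ((1 + pi)\<^sup>2 * sqrt C)" for n
    proof -
      let ?F = "\<lambda>\<zeta>. cmod (f (of_real (radius n) * \<zeta>) - f (of_real (radius n) * w))"
      have cF: "continuous_on \<C> ?F" by (intro continuous_intros cd)
      have "(cmean (\<lambda>\<zeta>. ?F \<zeta> * poisson w \<zeta>))\<^sup>2 \<le> cmean (\<lambda>\<zeta>. (?F \<zeta>)\<^sup>2 * poisson w \<zeta>)"
        by (intro cmean_cauchy_schwarz cF continuous_on_poisson poisson_nonneg cmean_poisson_one w)
      also have "\<dots> \<le> C" using C[OF _ w, of "radius n"] radius[of n] by simp
      finally have le: "cmean (\<lambda>\<zeta>. ?F \<zeta> * poisson w \<zeta>) \<le> sqrt C" by (rule real_le_rsqrt)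
      have "integral {a..b} (?\<phi> n) \<le> (b - a) * (1 + pi)\<^sup>2 * cmean (\<lambda>\<zeta>. ?F \<zeta> * poisson w \<zeta>)"
        by (rule arc[OF cF]) simp
      also have "\<dots> \<le> (b - a) * (1 + pi)\<^sup>2 * sqrt C"
        using ab by (intro mult_left_mono le) auto
      finally show ?thesis by (simp add: mult.assoc)
    qed
    note F = fatou_interval[OF c _ m l b]
    have "set_integrable lebesgue {a..b} (\<lambda>t. ?g (cis t))"
    proof (rule set_integrable_of_norm_diff)
      show "set_integrable lebesgue {a..b} (\<lambda>t. cmod (f w - ?g (cis t)))"
        using F(1) by (simp add: norm_minus_commute)
    qed (auto intro!: boundary_measurable hf)
    then show ?thesis
      using F(2) by (intro arc_oscillation_le ab) auto
  qed
  then have "?g \<in> BMO"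
    unfolding BMO_def using boundary_integrable[OF sb] by blast
  then show ?thesis
    unfolding BMOA_def using garsia_subset_Hardy[OF f less_numeral_extra(1)] boundary_values_boundary(1)[OF sb] by blast
qed

section \<open>Membership in the Smirnov class\<close>

lemma logp_lipschitz: "\<bar>logp x - logp y\<bar> \<le> \<bar>x - y\<bar>"
proof -
  have *: "logp x - logp y \<le> x - y" if "y \<le> x" for x y
  proof -
    have "logp x - logp y \<le> (max 1 x - max 1 y) / max 1 y"
      unfolding logp_def by (intro ln_diff_le) auto
    also have "\<dots> \<le> (max 1 x - max 1 y) / 1"
      using that by (intro divide_left_mono) auto
    also have "\<dots> \<le> x - y" using that by auto
    finally show ?thesis .
  qed
  have mono: "logp y \<le> logp x" if "y \<le> x" for x y
    unfolding logp_def using that by (subst ln_le_cancel_iff) auto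
  show ?thesis
    using *[of x y] *[of y x] mono[of x y] mono[of y x] by (cases "y \<le> x") (auto simp: abs_if)
qed

text \<open>
  The multipliers of \<open>bounded_multiplier\<close> for dilations of \<open>f\<close> converge to the outer function \<open>V\<close> with
  boundary modulus \<open>1 / max 1 \<bar>f\<bar>\<close>: by Herglotz' formula \<open>Q\<close> is the Herglotz integral of its real part, which
  converges in mean to \<open>log\<^sup>+\<close> of the modulus of the boundary function, since \<open>log\<^sup>+\<close> is a Lipschitz function.
  The bounds for the multipliers pass to the limit.
\<close>

lemma square_bounded_subset_Smirnov:
  assumes f: "square_bounded f"
  shows "f \<in> Smirnov"
proof -
  have hf: "f holomorphic_on \<D>" using f by (simp add: square_bounded_def)
  let ?g = "boundary f" and ?I = "{0..2*pi}"
  define l where "l t = logp (cmod (?g (cis t)))" for t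
  have lm: "l \<in> borel_measurable lebesgue"
  proof -
    have "logp \<in> borel_measurable borel"
      by (intro borel_measurable_continuous_onI continuous_on_logp continuous_on_id)
    then show ?thesis unfolding l_def
      by (rule measurable_compose[OF norm_lebesgue_measurable[OF boundary_measurable[OF hf]]])
  qed
  have lc: "(\<lambda>t. complex_of_real (l t)) \<in> borel_measurable lebesgue"
    by (rule measurable_compose[OF lm]) (intro borel_measurable_continuous_onI continuous_intros)
  have li: "set_integrable lebesgue ?I l"
  proof (rule set_integrable_bound[OF set_integrable_norm[OF boundary_integrable[OF f]]])
    show "set_borel_measurable lebesgue ?I l" using lm by (rule set_borel_measurable_interval)
    have "norm (l t) \<le> norm (norm (?g (cis t)))" for t
      using logp_lipschitz[of "cmod (?g (cis t))" 0] logp_nonneg[of "cmod (?g (cis t))"]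
      by (simp add: l_def logp_def)
    then show "AE t in lebesgue. t \<in> ?I \<longrightarrow> norm (l t) \<le> norm (norm (?g (cis t)))" by simp
  qed
  define V where "V z = exp ((LINT t:?I|lebesgue. (cis t + z) / (cis t - z) * of_real (- l t)) / (2 * pi))" for z
  have out: "outer V"
    unfolding outer_def
  proof (intro exI conjI ballI)
    show "cmod 1 = 1" by simp
    show "set_integrable lebesgue ?I (\<lambda>t. - l t)" using set_integrable_mult_right[OF li, of "-1"] by simp
    show "V z = 1 * exp ((LINT t:?I|lebesgue. (cis t + z) / (cis t - z) * of_real (- l t)) / (2 * pi))" for z
      by (simp add: V_def)
  qed
  have an: "(\<lambda>z. f (of_real (radius n) * z)) analytic_on cball 0 1" for n
    by (intro analytic_dilate hf radius)
  define e where "e n = 1 / real (Suc n)" for n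
  have e: "0 < e n" for n by (simp add: e_def)
  have "\<exists>Q. Q holomorphic_on UNIV \<and> Im (Q 0) = 0 \<and>
    (\<forall>z \<in> cball 0 1. cmod (exp (- Q z)) \<le> 1) \<and>
    (\<forall>z \<in> cball 0 1. cmod (f (of_real (radius n) * z) * exp (- Q z)) \<le> 1) \<and>
    (\<forall>\<zeta> \<in> \<C>. logp (cmod (f (of_real (radius n) * \<zeta>))) \<le> Re (Q \<zeta>) \<and> 
       Re (Q \<zeta>) \<le> logp (cmod (f (of_real (radius n) * \<zeta>))) + e n)" for n
    using bounded_multiplier[OF an[of n] e[of n]] by metis
  then obtain Q where Q: "\<And>n. Q n holomorphic_on UNIV" and Q0: "\<And>n. Im (Q n 0) = 0"
    and le1: "\<And>n z. z \<in> cball 0 1 \<Longrightarrow> cmod (exp (- Q n z)) \<le> 1"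
    and le2: "\<And>n z. z \<in> cball 0 1 \<Longrightarrow> cmod (f (of_real (radius n) * z) * exp (- Q n z)) \<le> 1"
    and near: "\<And>n \<zeta>. \<zeta> \<in> \<C> \<Longrightarrow> logp (cmod (f (of_real (radius n) * \<zeta>))) \<le> Re (Q n \<zeta>) \<and> 
       Re (Q n \<zeta>) \<le> logp (cmod (f (of_real (radius n) * \<zeta>))) + e n"
    by metis
  have anQ: "Q n analytic_on cball 0 1" for n by (rule entire_imp_analytic[OF Q])
  note cQ = analytic_cball_imp_continuous(2)[OF anQ]
  \<comment> \<open>Convergence of the Herglotz integrals at each point of the disk.\<close>
  have limV: "(\<lambda>n. exp (- Q n z)) \<longlonglongrightarrow> V z" if z: "z \<in> \<D>" for z
  proof -
    let ?K = "\<lambda>\<zeta>. (\<zeta> + z) / (\<zeta> - z)"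
    define A where "A = (LINT t:?I|lebesgue. ?K (cis t) * of_real (l t))"
    have ne: "\<zeta> \<noteq> z" if "\<zeta> \<in> \<C>" for \<zeta> using that z by auto
    have Kc: "continuous_on \<C> ?K" using ne by (intro continuous_intros) auto
    have Kle: "cmod (?K (cis t)) \<le> 2 / (1 - cmod z)" for t
    proof -
      have "cmod (cis t + z) \<le> 2" using norm_triangle_ineq[of "cis t" z] z by simp
      moreover have "1 - cmod z \<le> cmod (cis t - z)" using norm_triangle_ineq2[of "cis t" z] by simp
      ultimately show ?thesis using z unfolding norm_divide by (intro frac_le) auto
    qed
    have Km: "(\<lambda>t. ?K (cis t)) \<in> borel_measurable lebesgue"
      by (intro continuous_imp_lebesgue_measurable continuous_on_circle_cis Kc)
    have Kl: "set_integrable lebesgue ?I (\<lambda>t. ?K (cis t) * of_real (l t))"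
    proof (rule set_integrable_bound[OF set_integrable_mult_right[OF li, of "2 / (1 - cmod z)"]])
      show "set_borel_measurable lebesgue ?I (\<lambda>t. ?K (cis t) * of_real (l t))"
        by (intro set_borel_measurable_interval borel_measurable_times Km lc)
      have "norm (?K (cis t) * of_real (l t)) \<le> norm (2 / (1 - cmod z) * l t)" for t
      proof -
        have eq: "norm (2 / (1 - cmod z) * l t) = 2 / (1 - cmod z) * \<bar>l t\<bar>"
          using z by (simp add: abs_mult)
        show ?thesis
          unfolding eq norm_mult[of "?K (cis t)"] norm_of_real by (rule mult_right_mono[OF Kle]) simp
      qed
      then show "AE t in lebesgue. t \<in> ?I \<longrightarrow> norm (?K (cis t) * of_real (l t)) \<le> norm (2 / (1 - cmod z) * l t)" by simp
    qed
    have est: "cmod (Q n z - A / (2 * pi)) \<le> 2 / (1 - cmod z) * (e n + sqrt (gap f n))" for n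
    proof -
      have cKQ: "continuous_on \<C> (\<lambda>\<zeta>. ?K \<zeta> * of_real (Re (Q n \<zeta>)))"
        by (intro continuous_on_mult Kc continuous_on_of_real continuous_on_Re cQ)
      note KQ = cmean_lebesgue[OF cKQ]
      let ?D = "\<lambda>t. ?K (cis t) * of_real (Re (Q n (cis t))) - ?K (cis t) * of_real (l t)"
      let ?S = "\<lambda>t. cmod (f (of_real (radius n) * cis t) - ?g (cis t))"
      have "Q n z = cmean (\<lambda>\<zeta>. ?K \<zeta> * of_real (Re (Q n \<zeta>)))"
        using herglotz_cmean[OF anQ z] Q0 by simp
      also have "\<dots> = (LINT t:?I|lebesgue. ?K (cis t) * of_real (Re (Q n (cis t)))) / (2 * pi)"
        by (simp only: KQ(2) scaleR_conv_of_real) simp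
      finally have "Q n z - A / (2 * pi) = (LINT t:?I|lebesgue. ?D t) / (2 * pi)"
        unfolding A_def set_integral_diff(2)[OF KQ(1) Kl] by (simp add: diff_divide_distrib)
      then have eqD: "cmod (Q n z - A / (2 * pi)) = cmod (LINT t:?I|lebesgue. ?D t) / (2 * pi)"
        by (simp only: norm_divide) simp
      have "cmod (LINT t:?I|lebesgue. ?D t) \<le> (LINT t:?I|lebesgue. cmod (?D t))"
        by (rule set_integral_norm_bound[OF set_integral_diff(1)[OF KQ(1) Kl]])
      also have "\<dots> \<le> (LINT t:?I|lebesgue. 2 / (1 - cmod z) * (e n + ?S t))"
      proof (rule set_integral_mono)
        show "set_integrable lebesgue ?I (\<lambda>t. cmod (?D t))"
          by (intro set_integrable_norm set_integral_diff(1) KQ(1) Kl)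
        show "set_integrable lebesgue ?I (\<lambda>t. 2 / (1 - cmod z) * (e n + ?S t))"
          by (intro set_integrable_mult_right set_integral_add(1) boundary_l1(1)[OF f]
              absolutely_integrable_continuous_real continuous_on_const)
        fix t
        have "\<bar>Re (Q n (cis t)) - l t\<bar> \<le> e n + \<bar>logp (cmod (f (of_real (radius n) * cis t))) - l t\<bar>"
          using near[of "cis t" n] by (auto simp: abs_if)
        moreover have "\<bar>logp (cmod (f (of_real (radius n) * cis t))) - l t\<bar> \<le> ?S t"
          unfolding l_def by (rule order_trans[OF logp_lipschitz norm_triangle_ineq3])
        ultimately have le: "\<bar>Re (Q n (cis t)) - l t\<bar> \<le> e n + ?S t" by linarith
        have "?D t = ?K (cis t) * of_real (Re (Q n (cis t)) - l t)"
          by (simp only: of_real_diff right_diff_distrib)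
        then have eq: "cmod (?D t) = cmod (?K (cis t)) * \<bar>Re (Q n (cis t)) - l t\<bar>"
          by (simp only: norm_mult norm_of_real)
        show "cmod (?D t) \<le> 2 / (1 - cmod z) * (e n + ?S t)"
          unfolding eq using z by (intro mult_mono Kle le) auto
      qed
      also have "\<dots> = 2 / (1 - cmod z) * ((LINT t:?I|lebesgue. e n) + (LINT t:?I|lebesgue. ?S t))"
        unfolding set_integral_mult_right
        by (subst set_integral_add(2)) (intro boundary_l1(1)[OF f] absolutely_integrable_continuous_real continuous_on_const refl)+
      also have "(LINT t:?I|lebesgue. e n) = 2 * pi * e n"
        using set_lebesgue_integral_eq_integral(2)[OF absolutely_integrable_continuous_real[OF continuous_on_const, of 0 "2*pi" "e n"]]
        by simp
      also have "2 / (1 - cmod z) * (2 * pi * e n + (LINT t:?I|lebesgue. ?S t))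
          \<le>
          2 / (1 - cmod z) * (2 * pi * e n + 2 * pi * sqrt (gap f n))"
        using boundary_l1(2)[OF f, of n] z by (intro mult_left_mono add_left_mono) auto
      finally have "cmod (Q n z - A / (2 * pi)) \<le> 2 / (1 - cmod z) * (2 * pi * e n + 2 * pi * sqrt (gap f n)) / (2 * pi)"
        unfolding eqD by (rule divide_right_mono) simp
      also have "\<dots> = 2 / (1 - cmod z) * (e n + sqrt (gap f n))"
      proof -
        have "c * (2 * pi * x + 2 * pi * y) / (2 * pi) = c * (x + y)" for c x y
          by (simp add: field_simps)
        then show ?thesis .
      qed
      finally show ?thesis .
    qed
    have "e \<longlonglongrightarrow> 0" unfolding e_def[abs_def] using LIMSEQ_inverse_real_of_nat by (simp add: inverse_eq_divide)
    then have "(\<lambda>n. 2 / (1 - cmod z) * (e n + sqrt (gap f n))) \<longlonglongrightarrow> 2 / (1 - cmod z) * (0 + sqrt 0)"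
      by (intro tendsto_intros gap_tendsto f)
    then have lim0: "(\<lambda>n. 2 / (1 - cmod z) * (e n + sqrt (gap f n))) \<longlonglongrightarrow> 0" by simp
    have "(\<lambda>n. Q n z - A / (2 * pi)) \<longlonglongrightarrow> 0"
      by (rule Lim_null_comparison[OF always_eventually lim0]) (use est in auto)
    then have "(\<lambda>n. Q n z) \<longlonglongrightarrow> A / (2 * pi)" by (rule LIM_zero_cancel)
    then have "(\<lambda>n. exp (- Q n z)) \<longlonglongrightarrow> exp (- (A / (2 * pi)))" by (intro tendsto_intros)
    moreover have "V z = exp (- (A / (2 * pi)))"
      unfolding V_def A_def by (simp add: set_lebesgue_integral_def)
    ultimately show ?thesis by simp
  qed
  have hV: "V holomorphic_on \<D>"
  proof -
    \<comment> \<open>A normal family argument supplies holomorphy of the pointwise limit.\<close>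
    obtain v k where v: "v holomorphic_on \<D>" and k: "strict_mono (k :: nat \<Rightarrow> nat)"
      and lim: "\<And>z. z \<in> \<D> \<Longrightarrow> (\<lambda>n. exp (- Q (k n) z)) \<longlonglongrightarrow> v z"
    proof (rule Montel[of "\<D>" "range (\<lambda>n z. exp (- Q n z))" "\<lambda>n z. exp (- Q n z)"])
      show "\<exists>B. \<forall>h\<in>range (\<lambda>n z. exp (- Q n z)). \<forall>z\<in>K. norm (h z) \<le> B" if "K \<subseteq> \<D>" for K
        using le1 that ball_subset_cball by (intro exI[of _ 1]) blast
      show "h holomorphic_on \<D>" if "h \<in> range (\<lambda>n z. exp (- Q n z))" for h
        using that Q holomorphic_on_subset[OF Q] by (auto intro!: holomorphic_intros)
    qed auto
    have "v z = V z" if "z \<in> \<D>" for z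
      using LIMSEQ_unique[OF lim[OF that] LIMSEQ_subseq_LIMSEQ[OF limV[OF that] k, unfolded o_def]] .
    then show ?thesis using v holomorphic_transform by blast
  qed
  have V1: "cmod (V z) \<le> 1" if "z \<in> \<D>" for z
    using tendsto_norm[OF limV[OF that]] by (rule LIMSEQ_le_const2) (use le1 that in auto)
  have V2: "cmod (f z * V z) \<le> 1" if z: "z \<in> \<D>" for z
  proof -
    have "(\<lambda>n. cmod (f (of_real (radius n) * z) * exp (- Q n z))) \<longlonglongrightarrow> cmod (f z * V z)"
      by (intro tendsto_intros limV dilate_tendsto hf z)
    then show ?thesis by (rule LIMSEQ_le_const2) (use le2 z in auto)
  qed
  have "(\<lambda>z. f z * V z) \<in> Hinf" "V \<in> Hinf"
    using V1 V2 hV hf by (auto intro!: holomorphic_intros HinfI[where B = 1])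
  moreover have "\<forall>z\<in>\<D>. f z = f z * V z / V z" by (simp add: V_def)
  ultimately show ?thesis
    unfolding Smirnov_def using out by (intro CollectI bexI[of _ "\<lambda>z. f z * V z"] bexI[of _ V] conjI)
qed

lemma garsia_subset_spaces:
  assumes f: "f \<in> garsia"
    and X: "X = BMOA \<or> (\<exists>p::real. 0 < p \<and> X = Hardy p) \<or> X = Smirnov \<or> X = Nevanlinna"
  shows "f \<in> X"
  using X garsia_subset_BMOA[OF f] garsia_subset_Hardy[OF f]
    square_bounded_subset_Smirnov[OF garsia_square_bounded[OF f]] Smirnov_subset_Nevanlinna by blast

lemma spaces_subset_Nevanlinna:
  assumes f: "f \<in> X"
    and X: "X = BMOA \<or> (\<exists>p::real. 0 < p \<and> X = Hardy p) \<or> X = Smirnov \<or> X = Nevanlinna"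
  shows "f \<in> Nevanlinna"
  using X f BMOA_subset_Nevanlinna Hardy_subset_Nevanlinna Smirnov_subset_Nevanlinna by blast

section \<open>Products of bounded functions with derivatives of bounded functions\<close>

lemma Hinf_const: "(\<lambda>_. c) \<in> Hinf"
  by (rule HinfI[where B = "cmod c"]) auto

lemma Hinf_uminus: "f \<in> Hinf \<Longrightarrow> (\<lambda>z. - f z) \<in> Hinf"
  by (erule HinfE, rule HinfI) (auto intro: holomorphic_intros)

lemma Hinf_mult:
  assumes "f \<in> Hinf" "g \<in> Hinf"
  shows "(\<lambda>z. f z * g z) \<in> Hinf"
proof -
  obtain A where A: "f holomorphic_on \<D>" "\<And>z. z \<in> \<D> \<Longrightarrow> cmod (f z) \<le> A" using assms(1) by (rule HinfE) blast
  obtain B where B: "g holomorphic_on \<D>" "\<And>z. z \<in> \<D> \<Longrightarrow> cmod (g z) \<le> B" using assms(2) by (rule HinfE) blast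
  have A0: "0 \<le> A" using order_trans[OF norm_ge_zero A(2)[of 0]] by simp
  show ?thesis
  proof (rule HinfI[where B = "A * B"])
    show "cmod (f z * g z) \<le> A * B" if "z \<in> \<D>" for z
      unfolding norm_mult by (intro mult_mono A B that A0) auto
  qed (intro holomorphic_intros A B)
qed

lemma Hinf_holomorphic: "f \<in> Hinf \<Longrightarrow> f holomorphic_on \<D>"
  by (simp add: Hinf_def)

text \<open>
  Finite sums of products \<open>g \<cdot> h'\<close>.  The members are described by their values on the disk only.
\<close>

inductive deriv_products :: "(complex \<Rightarrow> complex) \<Rightarrow> bool" where
  deriv_products_gen: "g \<in> Hinf \<Longrightarrow> h \<in> Hinf \<Longrightarrow> (\<And>z. z \<in> \<D> \<Longrightarrow> k z = g z * deriv h z) \<Longrightarrow> deriv_products k"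
| deriv_products_add: "deriv_products k1 \<Longrightarrow> deriv_products k2 \<Longrightarrow> (\<And>z. z \<in> \<D> \<Longrightarrow> k z = k1 z + k2 z) \<Longrightarrow> deriv_products k"

lemma deriv_products_mult:
  assumes "deriv_products k" "u \<in> Hinf"
  shows "deriv_products (\<lambda>z. u z * k z)"
  using assms(1)
proof induction
  case (deriv_products_gen g h k)
  show ?case
    by (rule deriv_products.deriv_products_gen[OF Hinf_mult[OF assms(2) deriv_products_gen(1)] deriv_products_gen(2)])
       (simp add: deriv_products_gen mult.assoc)
next
  case (deriv_products_add k1 k2 k)
  show ?case
    by (rule deriv_products.deriv_products_add[OF deriv_products_add.IH]) (simp add: deriv_products_add algebra_simps)
qed

lemma primitive_on_disk:
  assumes "k holomorphic_on \<D>"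
  obtains H where "H holomorphic_on \<D>" "\<And>z. z \<in> \<D> \<Longrightarrow> deriv H z = k z"
proof -
  obtain H where H: "\<And>z. z \<in> \<D> \<Longrightarrow> (H has_field_derivative k z) (at z within \<D>)"
    using holomorphic_convex_primitive'[OF convex_ball open_ball assms] by blast
  then have H': "(H has_field_derivative k z) (at z)" if "z \<in> \<D>" for z
    using that by (metis at_within_open open_ball)
  show ?thesis
  proof
    show "H holomorphic_on \<D>" unfolding holomorphic_on_open[OF open_ball] using H' by blast
    show "deriv H z = k z" if "z \<in> \<D>" for z using H'[OF that] by (rule DERIV_imp_deriv)
  qed
qed

lemma deriv_add_disk:
  assumes "f holomorphic_on \<D>" "g holomorphic_on \<D>" "z \<in> \<D>"
  shows "deriv (\<lambda>z. f z + g z) z = deriv f z + deriv g z"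
  using higher_deriv_add[OF assms(1,2) open_ball assms(3), of 1] by simp

lemma deriv_products_primitive:
  assumes "deriv_products k"
  obtains H where "H \<in> garsia" "\<And>z. z \<in> \<D> \<Longrightarrow> deriv H z = k z"
proof -
  from assms have "\<exists>H\<in>garsia. \<forall>z\<in>\<D>. deriv H z = k z"
  proof induction
    case (deriv_products_gen g h k)
    have "(\<lambda>z. g z * deriv h z) holomorphic_on \<D>"
      by (intro holomorphic_intros holomorphic_deriv Hinf_holomorphic deriv_products_gen open_ball)
    then obtain H where H: "H holomorphic_on \<D>" "\<And>z. z \<in> \<D> \<Longrightarrow> deriv H z = g z * deriv h z"
      by (rule primitive_on_disk) blast
    have "H \<in> garsia" by (rule garsia_primitive[OF deriv_products_gen(1,2) H])
    moreover have "deriv H z = k z" if "z \<in> \<D>" for z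
      by (simp only: H(2)[OF that] deriv_products_gen(3)[OF that])
    ultimately show ?case by blast
  next
    case (deriv_products_add k1 k2 k)
    then obtain H1 H2 where H: "H1 \<in> garsia" "H2 \<in> garsia" 
      "\<And>z. z \<in> \<D> \<Longrightarrow> deriv H1 z = k1 z" "\<And>z. z \<in> \<D> \<Longrightarrow> deriv H2 z = k2 z" by blast
    have "H1 holomorphic_on \<D>" "H2 holomorphic_on \<D>" using H(1,2) by (auto simp: garsia_def)
    then have "deriv (\<lambda>z. H1 z + H2 z) z = k z" if "z \<in> \<D>" for z
      using that H(3,4) deriv_products_add by (simp add: deriv_add_disk)
    moreover have "(\<lambda>z. H1 z + H2 z) \<in> garsia" by (rule garsia_add[OF H(1,2)]) simp
    ultimately show ?case by blast
  qed
  then show ?thesis using that by blast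
qed

text \<open>
  The class in which Wronskians live.  Unlike the class of numerators it is stable under multiplication by
  quotients of bounded functions and contains the derivatives of such quotients.
\<close>

definition deriv_quotient :: "(complex \<Rightarrow> complex) \<Rightarrow> bool" where
  "deriv_quotient k \<longleftrightarrow> (\<exists>A V. deriv_products A \<and> V \<in> Hinf \<and> (\<forall>z\<in>\<D>. V z \<noteq> 0) \<and> (\<forall>z\<in>\<D>. k z = A z / V z))"

lemma deriv_quotientI:
  assumes "deriv_products A" "V \<in> Hinf" "\<And>z. z \<in> \<D> \<Longrightarrow> V z \<noteq> 0" "\<And>z. z \<in> \<D> \<Longrightarrow> k z = A z / V z"
  shows "deriv_quotient k"
  unfolding deriv_quotient_def using assms by blast

lemma deriv_quotientE:
  assumes "deriv_quotient k"
  obtains A V where "deriv_products A" "V \<in> Hinf" "\<And>z. z \<in> \<D> \<Longrightarrow> V z \<noteq> 0" "\<And>z. z \<in> \<D> \<Longrightarrow> k z = A z / V z"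
  using assms unfolding deriv_quotient_def by blast

lemma NevanlinnaE:
  assumes "f \<in> Nevanlinna"
  obtains u v where "u \<in> Hinf" "v \<in> Hinf" "\<And>z. z \<in> \<D> \<Longrightarrow> v z \<noteq> 0" "\<And>z. z \<in> \<D> \<Longrightarrow> f z = u z / v z"
  using assms unfolding Nevanlinna_def by blast

lemma NevanlinnaI:
  assumes "u \<in> Hinf" "v \<in> Hinf" "\<And>z. z \<in> \<D> \<Longrightarrow> v z \<noteq> 0" "\<And>z. z \<in> \<D> \<Longrightarrow> f z = u z / v z"
  shows "f \<in> Nevanlinna"
  unfolding Nevanlinna_def using assms by (intro CollectI bexI[of _ u] bexI[of _ v]) auto

lemma Hinf_subset_Nevanlinna: "f \<in> Hinf \<Longrightarrow> f \<in> Nevanlinna"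
  by (rule NevanlinnaI[OF _ Hinf_const[of 1]]) auto

lemma Nevanlinna_mult:
  assumes "f \<in> Nevanlinna" "g \<in> Nevanlinna"
  shows "(\<lambda>z. f z * g z) \<in> Nevanlinna"
proof -
  obtain u v where f: "u \<in> Hinf" "v \<in> Hinf" "\<And>z. z \<in> \<D> \<Longrightarrow> v z \<noteq> 0" "\<And>z. z \<in> \<D> \<Longrightarrow> f z = u z / v z"
    using assms(1) by (rule NevanlinnaE) blast
  obtain u' v' where g: "u' \<in> Hinf" "v' \<in> Hinf" "\<And>z. z \<in> \<D> \<Longrightarrow> v' z \<noteq> 0" "\<And>z. z \<in> \<D> \<Longrightarrow> g z = u' z / v' z"
    using assms(2) by (rule NevanlinnaE) blast
  show ?thesis
    by (rule NevanlinnaI[OF Hinf_mult[OF f(1) g(1)] Hinf_mult[OF f(2) g(2)]]) (use f g in auto)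
qed

lemma Nevanlinna_prod:
  assumes "finite I" "\<And>i. i \<in> I \<Longrightarrow> f i \<in> Nevanlinna"
  shows "(\<lambda>z. \<Prod>i\<in>I. f i z) \<in> Nevanlinna"
  using assms
proof (induction I rule: finite_induct)
  case empty
  show ?case using Hinf_subset_Nevanlinna[OF Hinf_const[of 1]] by simp
next
  case (insert i I)
  then show ?case by (simp add: Nevanlinna_mult)
qed

lemma deriv_quotient_zero: "deriv_quotient (\<lambda>_. 0)"
proof (rule deriv_quotientI)
  show "deriv_products (\<lambda>_. 0)" by (rule deriv_products_gen[OF Hinf_const[of 0] Hinf_const[of 0]]) simp
qed (use Hinf_const[of 1] in auto)

lemma deriv_quotient_add:
  assumes "deriv_quotient f" "deriv_quotient g"
  shows "deriv_quotient (\<lambda>z. f z + g z)"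
proof -
  obtain A V where f: "deriv_products A" "V \<in> Hinf" "\<And>z. z \<in> \<D> \<Longrightarrow> V z \<noteq> 0" "\<And>z. z \<in> \<D> \<Longrightarrow> f z = A z / V z"
    using assms(1) by (rule deriv_quotientE) blast
  obtain B W where g: "deriv_products B" "W \<in> Hinf" "\<And>z. z \<in> \<D> \<Longrightarrow> W z \<noteq> 0" "\<And>z. z \<in> \<D> \<Longrightarrow> g z = B z / W z"
    using assms(2) by (rule deriv_quotientE) blast
  show ?thesis
  proof (rule deriv_quotientI)
    show "deriv_products (\<lambda>z. W z * A z + V z * B z)"
      by (rule deriv_products_add[OF deriv_products_mult[OF f(1) g(2)] deriv_products_mult[OF g(1) f(2)]]) simp
    show "(\<lambda>z. V z * W z) \<in> Hinf" by (rule Hinf_mult[OF f(2) g(2)])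
  qed (use f g in \<open>auto simp: field_simps\<close>)
qed

lemma deriv_quotient_sum:
  assumes "finite I" "\<And>i. i \<in> I \<Longrightarrow> deriv_quotient (f i)"
  shows "deriv_quotient (\<lambda>z. \<Sum>i\<in>I. f i z)"
  using assms
proof (induction I rule: finite_induct)
  case empty
  show ?case using deriv_quotient_zero by simp
next
  case (insert i I)
  then show ?case by (simp add: deriv_quotient_add)
qed

lemma deriv_quotient_mult:
  assumes "f \<in> Nevanlinna" "deriv_quotient k"
  shows "deriv_quotient (\<lambda>z. f z * k z)"
proof -
  obtain u v where f: "u \<in> Hinf" "v \<in> Hinf" "\<And>z. z \<in> \<D> \<Longrightarrow> v z \<noteq> 0" "\<And>z. z \<in> \<D> \<Longrightarrow> f z = u z / v z"
    using assms(1) by (rule NevanlinnaE) blast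
  obtain A V where k: "deriv_products A" "V \<in> Hinf" "\<And>z. z \<in> \<D> \<Longrightarrow> V z \<noteq> 0" "\<And>z. z \<in> \<D> \<Longrightarrow> k z = A z / V z"
    using assms(2) by (rule deriv_quotientE) blast
  show ?thesis
    by (rule deriv_quotientI[OF deriv_products_mult[OF k(1) f(1)] Hinf_mult[OF f(2) k(2)]]) (use f k in auto)
qed

lemma deriv_cong_disk:
  assumes "z \<in> \<D>" "\<And>z. z \<in> \<D> \<Longrightarrow> f z = g z"
  shows "deriv f z = deriv g z"
proof (rule deriv_cong_ev)
  show "\<forall>\<^sub>F w in nhds z. f w = g w"
    using eventually_nhds_in_open[OF open_ball assms(1)] by eventually_elim (rule assms(2))
qed simp

lemma deriv_quotient_deriv:
  assumes "f \<in> Nevanlinna"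
  shows "deriv_quotient (deriv f)"
proof -
  obtain u v where f: "u \<in> Hinf" "v \<in> Hinf" "\<And>z. z \<in> \<D> \<Longrightarrow> v z \<noteq> 0" "\<And>z. z \<in> \<D> \<Longrightarrow> f z = u z / v z"
    using assms by (rule NevanlinnaE) blast
  have d1: "deriv_products (\<lambda>z. v z * deriv u z)" by (rule deriv_products_gen[OF f(2,1)]) simp
  have d2: "deriv_products (\<lambda>z. - u z * deriv v z)" by (rule deriv_products_gen[OF Hinf_uminus[OF f(1)] f(2)]) simp
  show ?thesis
  proof (rule deriv_quotientI)
    show "deriv_products (\<lambda>z. v z * deriv u z + - u z * deriv v z)"
      by (rule deriv_products_add[OF d1 d2]) simp
    show "(\<lambda>z. v z * v z) \<in> Hinf" by (rule Hinf_mult[OF f(2,2)])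
    fix z assume z: "z \<in> \<D>"
    show "v z * v z \<noteq> 0" using f(3)[OF z] by simp
    have "(u has_field_derivative deriv u z) (at z)" "(v has_field_derivative deriv v z) (at z)"
      using f(1,2) z by (auto intro: holomorphic_derivI[OF Hinf_holomorphic open_ball])
    then have "((\<lambda>z. u z / v z) has_field_derivative (deriv u z * v z - u z * deriv v z) / (v z * v z)) (at z)"
      using f(3)[OF z] by (rule DERIV_divide)
    then have "deriv (\<lambda>z. u z / v z) z = (deriv u z * v z - u z * deriv v z) / (v z * v z)"
      by (rule DERIV_imp_deriv)
    moreover have "deriv f z = deriv (\<lambda>z. u z / v z) z" by (rule deriv_cong_disk[OF z f(4)])
    ultimately show "deriv f z = (v z * deriv u z + - u z * deriv v z) / (v z * v z)"
      by (simp add: mult.commute)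
  qed
qed

text \<open>
  The denominator has no zeros, so the numerator has the same zeros; its primitive \<open>h\<close> satisfies all the
  estimates above.
\<close>

lemma deriv_quotient_zeros:
  assumes "deriv_quotient k"
  obtains h where "h \<in> garsia" "\<And>z. z \<in> \<D> \<Longrightarrow> deriv h z = 0 \<longleftrightarrow> k z = 0"
proof -
  obtain A V where k: "deriv_products A" "V \<in> Hinf" "\<And>z. z \<in> \<D> \<Longrightarrow> V z \<noteq> 0" "\<And>z. z \<in> \<D> \<Longrightarrow> k z = A z / V z"
    using assms by (rule deriv_quotientE) blast
  obtain H where "H \<in> garsia" "\<And>z. z \<in> \<D> \<Longrightarrow> deriv H z = A z"
    using deriv_products_primitive[OF k(1)] by blast
  then show ?thesis using that k by (metis div_0 divide_eq_0_iff)
qed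

section \<open>Wronskians\<close>

lemma higher_deriv_combination:
  fixes n :: nat
  assumes "open S" "\<And>j. j \<le> n \<Longrightarrow> f j holomorphic_on S" "z \<in> S"
  shows "(deriv ^^ k) (\<lambda>w. \<Sum>j\<le>n. c j * f j w) z = (\<Sum>j\<le>n. c j * (deriv ^^ k) (f j) z)"
  using assms(2)
proof (induction n)
  case 0
  show ?case using higher_deriv_cmult[OF 0[of 0] assms(3,1)] by simp
next
  case (Suc n)
  have "(deriv ^^ k) (\<lambda>w. (\<Sum>j\<le>n. c j * f j w) + c (Suc n) * f (Suc n) w) z =
     (deriv ^^ k) (\<lambda>w. \<Sum>j\<le>n. c j * f j w) z + (deriv ^^ k) (\<lambda>w. c (Suc n) * f (Suc n) w) z"
    using Suc.prems by (intro higher_deriv_add[OF _ _ assms(1,3)] holomorphic_intros) auto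
  also have "(deriv ^^ k) (\<lambda>w. c (Suc n) * f (Suc n) w) z = c (Suc n) * (deriv ^^ k) (f (Suc n)) z"
    by (rule higher_deriv_cmult[OF Suc.prems assms(3,1)]) simp
  finally show ?case using Suc by simp
qed

definition wronski_mat :: "nat \<Rightarrow> (nat \<Rightarrow> complex \<Rightarrow> complex) \<Rightarrow> complex \<Rightarrow> complex Matrix.mat" where
  "wronski_mat n f z = Matrix.mat (Suc n) (Suc n) (\<lambda>(k, j). (deriv ^^ k) (f j) z)"

definition wronskian :: "nat \<Rightarrow> (nat \<Rightarrow> complex \<Rightarrow> complex) \<Rightarrow> complex \<Rightarrow> complex" where
  "wronskian n f z = Determinant.det (wronski_mat n f z)"

lemma wronski_mat_carrier: "wronski_mat n f z \<in> carrier_mat (Suc n) (Suc n)"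
  by (simp add: wronski_mat_def)

text \<open>
  The rows of \<open>wronski_mat\<close> are the conditions that the successive derivatives of a combination vanish, so
  the kernel consists of the combinations that vanish to order \<open>n + 1\<close>.
\<close>

lemma wronskian_eq_0_iff:
  assumes f: "\<And>j. j \<le> n \<Longrightarrow> f j holomorphic_on \<D>" and z: "z \<in> \<D>"
  shows "wronskian n f z = 0 \<longleftrightarrow>
     (\<exists>c. (\<exists>j\<le>n. c j \<noteq> 0) \<and> (\<forall>k\<le>n. (deriv ^^ k) (\<lambda>w. \<Sum>j\<le>n. c j * f j w) z = 0))"
proof -
  have idx: "{0..<Suc n} = {..n}" by auto
  have mv: "(wronski_mat n f z *\<^sub>v v = 0\<^sub>v (Suc n)) \<longleftrightarrow>
     (\<forall>k\<le>n. (\<Sum>j\<le>n. vec_index v j * (deriv ^^ k) (f j) z) = 0)" if v: "v \<in> carrier_vec (Suc n)" for v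
  proof -
    have "vec_index (wronski_mat n f z *\<^sub>v v) k = (\<Sum>j\<le>n. vec_index v j * (deriv ^^ k) (f j) z)" if "k \<le> n" for k
      using that v by (auto simp: wronski_mat_def scalar_prod_def idx mult.commute intro!: sum.cong)
    moreover have "dim_vec (wronski_mat n f z *\<^sub>v v) = Suc n" by (simp add: wronski_mat_def)
    ultimately show ?thesis
      by (auto simp: vec_eq_iff less_Suc_eq_le)
  qed
  have hd: "(deriv ^^ k) (\<lambda>w. \<Sum>j\<le>n. c j * f j w) z = (\<Sum>j\<le>n. c j * (deriv ^^ k) (f j) z)" for c k
    by (rule higher_deriv_combination[OF open_ball f z])
  have "wronskian n f z = 0 \<longleftrightarrow> (\<exists>v. v \<in> carrier_vec (Suc n) \<and> v \<noteq> 0\<^sub>v (Suc n) \<and> wronski_mat n f z *\<^sub>v v = 0\<^sub>v (Suc n))"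
    unfolding wronskian_def by (rule det_0_iff_vec_prod_zero[OF wronski_mat_carrier])
  also have "\<dots> \<longleftrightarrow> (\<exists>c. (\<exists>j\<le>n. c j \<noteq> 0) \<and> (\<forall>k\<le>n. (\<Sum>j\<le>n. c j * (deriv ^^ k) (f j) z) = 0))"
  proof
    assume "\<exists>v. v \<in> carrier_vec (Suc n) \<and> v \<noteq> 0\<^sub>v (Suc n) \<and> wronski_mat n f z *\<^sub>v v = 0\<^sub>v (Suc n)"
    then obtain v where v: "v \<in> carrier_vec (Suc n)" "v \<noteq> 0\<^sub>v (Suc n)" "wronski_mat n f z *\<^sub>v v = 0\<^sub>v (Suc n)" by blast
    have "\<exists>j\<le>n. vec_index v j \<noteq> 0"
    proof (rule ccontr)
      assume "\<not> ?thesis"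
      then have "v = 0\<^sub>v (Suc n)" using v(1) by (intro eq_vecI) auto
      then show False using v(2) by simp
    qed
    then show "\<exists>c. (\<exists>j\<le>n. c j \<noteq> 0) \<and> (\<forall>k\<le>n. (\<Sum>j\<le>n. c j * (deriv ^^ k) (f j) z) = 0)"
      using mv[OF v(1)] v(3) by (intro exI[of _ "vec_index v"]) simp
  next
    assume "\<exists>c. (\<exists>j\<le>n. c j \<noteq> 0) \<and> (\<forall>k\<le>n. (\<Sum>j\<le>n. c j * (deriv ^^ k) (f j) z) = 0)"
    then obtain c j where c: "j \<le> n" "c j \<noteq> 0" "\<forall>k\<le>n. (\<Sum>j\<le>n. c j * (deriv ^^ k) (f j) z) = 0" by blast
    define v where "v = Matrix.vec (Suc n) c"
    have v: "v \<in> carrier_vec (Suc n)" by (simp add: v_def)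
    have vi: "vec_index v j = c j" if "j \<le> n" for j using that by (simp add: v_def)
    have "v \<noteq> 0\<^sub>v (Suc n)"
    proof
      assume "v = 0\<^sub>v (Suc n)"
      then have "vec_index v j = 0" using c(1) by simp
      then show False using vi[OF c(1)] c(2) by simp
    qed
    moreover have "wronski_mat n f z *\<^sub>v v = 0\<^sub>v (Suc n)"
      unfolding mv[OF v] using c(3) by (simp add: vi)
    ultimately show "\<exists>v. v \<in> carrier_vec (Suc n) \<and> v \<noteq> 0\<^sub>v (Suc n) \<and> wronski_mat n f z *\<^sub>v v = 0\<^sub>v (Suc n)"
      using v by blast
  qed
  finally show ?thesis by (simp only: hd)
qed

text \<open>
  The function \<open>g\<close> is not null on the disk, which makes the order of its zero at \<open>z\<close> meaningful.
\<close>

lemma deep_zero_iff: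
  assumes g: "g holomorphic_on \<D>" and nz: "w \<in> \<D>" "g w \<noteq> 0" and z: "z \<in> \<D>"
  shows "deep_zero n g z \<longleftrightarrow> (\<forall>k\<le>n. (deriv ^^ k) g z = 0)"
proof
  assume d: "deep_zero n g z"
  show "\<forall>k\<le>n. (deriv ^^ k) g z = 0"
  proof (rule ccontr)
    assume "\<not> ?thesis"
    then have ex: "\<exists>k. k \<le> n \<and> (deriv ^^ k) g z \<noteq> 0" by blast
    define k where "k = (LEAST k. k \<le> n \<and> (deriv ^^ k) g z \<noteq> 0)"
    have k: "k \<le> n" "(deriv ^^ k) g z \<noteq> 0" using LeastI_ex[OF ex] by (auto simp: k_def)
    have small: "(deriv ^^ i) g z = 0" if "i < k" for i
      using not_less_Least[OF that[unfolded k_def]] that k(1) by auto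
    have "zorder g z = int k"
      by (rule zorder_zero_eqI[OF g open_ball z]) (use k small in auto)
    then show False using d k(1) by (simp add: deep_zero_def)
  qed
next
  assume v: "\<forall>k\<le>n. (deriv ^^ k) g z = 0"
  have "zorder g z \<ge> int (Suc n)"
  proof (rule zorder_geI[OF _ g open_ball connected_ball z nz])
    show "g analytic_on {z}" using g z by (meson analytic_at open_ball)
  qed (use v in auto)
  then show "deep_zero n g z" using v[rule_format, of 0] by (simp add: deep_zero_def)
qed

lemma vanishing_factor:
  assumes g: "g holomorphic_on \<D>" and nz: "w \<in> \<D>" "g w \<noteq> 0" and z: "z \<in> \<D>"
    and v: "\<And>k. k \<le> n \<Longrightarrow> (deriv ^^ k) g z = 0"
  obtains r G where "0 < r" "ball z r \<subseteq> \<D>" "G holomorphic_on ball z r"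
    "\<And>w. w \<in> ball z r \<Longrightarrow> g w = (w - z) ^ Suc n * G w"
proof -
  have "deep_zero n g z" using deep_zero_iff[OF g nz z] v by blast
  then have ord: "zorder g z \<ge> int (Suc n)" by (simp add: deep_zero_def)
  define N where "N = nat (zorder g z)"
  have N: "Suc n \<le> N" using ord by (simp add: N_def)
  obtain r where r: "0 < r" "cball z r \<subseteq> \<D>" "zor_poly g z holomorphic_on cball z r"
    "\<And>w. w \<in> cball z r \<Longrightarrow> g w = zor_poly g z w * (w - z) ^ N"
    using zorder_exist_zero[OF g open_ball connected_ball z] nz unfolding N_def by blast
  have hol: "zor_poly g z holomorphic_on ball z r"
    using r(3) by (rule holomorphic_on_subset) auto
  show ?thesis
  proof (rule that[OF r(1)])
    show "ball z r \<subseteq> \<D>" using r(2) ball_subset_cball by blast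
    show "(\<lambda>w. zor_poly g z w * (w - z) ^ (N - Suc n)) holomorphic_on ball z r"
      by (intro holomorphic_intros hol)
    fix w assume "w \<in> ball z r"
    then have "g w = zor_poly g z w * (w - z) ^ N" by (intro r(4)) auto
    also have "(w - z) ^ N = (w - z) ^ Suc n * (w - z) ^ (N - Suc n)"
      using N by (simp only: power_add[symmetric]) simp
    finally show "g w = (w - z) ^ Suc n * (zor_poly g z w * (w - z) ^ (N - Suc n))"
      by (simp only: mult_ac)
  qed
qed

text \<open>
  Linearly independent functions have a point at which only the trivial combination vanishes to order
  \<open>n + 1\<close>.  The induction divides by \<open>f 0\<close> near a point where it does not vanish and differentiates: this
  removes one function and lowers the order of vanishing by one, and independence survives because a
  combination of the quotients with vanishing derivative is constant.
\<close>

lemma nondegenerate_point: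
  assumes "open S" "connected S" "S \<noteq> {}" "\<And>j. j \<le> n \<Longrightarrow> f j holomorphic_on S"
    and "\<And>c. (\<forall>z\<in>S. (\<Sum>j\<le>n. c j * f j z) = 0) \<Longrightarrow> (\<forall>j\<le>n. c j = (0::complex))"
  shows "\<exists>z\<in>S. \<forall>c r G. 0 < r \<longrightarrow> ball z r \<subseteq> S \<longrightarrow> G holomorphic_on ball z r \<longrightarrow>
    (\<forall>w\<in>ball z r. (\<Sum>j\<le>n. c j * f j w) = (w - z) ^ Suc n * G w) \<longrightarrow> (\<forall>j\<le>n. c j = 0)"
  using assms
proof (induction n arbitrary: f S)
  case 0
  have "\<exists>z\<in>S. f 0 z \<noteq> 0"
    using 0(5)[of "\<lambda>_. 1"] by auto
  then obtain z where z: "z \<in> S" "f 0 z \<noteq> 0" by blast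
  show ?case
  proof (intro bexI[OF _ z(1)] allI impI)
    fix c :: "nat \<Rightarrow> complex" and r :: real and G and j :: nat
    assume "0 < r" and eq: "\<forall>w\<in>ball z r. (\<Sum>j\<le>0. c j * f j w) = (w - z) ^ Suc 0 * G w" and j: "j \<le> 0"
    then have "c 0 * f 0 z = 0" using eq[rule_format, of z] by simp
    then show "c j = 0" using z(2) j by simp
  qed
next
  case (Suc n)
  have "\<exists>z\<in>S. f 0 z \<noteq> 0"
  proof (rule ccontr)
    assume "\<not> ?thesis"
    then have z: "\<forall>z\<in>S. (\<Sum>j\<le>Suc n. (if j = 0 then 1 else 0) * f j z) = 0"
      by (auto simp: sum.atMost_Suc_shift simp del: sum.atMost_Suc)
    from Suc.prems(5)[OF this] show False by auto
  qed
  then obtain z1 where z1: "z1 \<in> S" "f 0 z1 \<noteq> 0" by blast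
  have h0: "f 0 holomorphic_on S" by (rule Suc.prems(4)) simp
  have "{w \<in> S. f 0 w \<in> - {0}} = S \<inter> f 0 -` (- {0})" by auto
  then have "open {w \<in> S. f 0 w \<in> - {0}}"
    using continuous_open_preimage[OF holomorphic_on_imp_continuous_on[OF h0] Suc.prems(1), of "- {0}"] by auto
  then obtain r1 where r1: "0 < r1" "ball z1 r1 \<subseteq> {w \<in> S. f 0 w \<in> - {0}}"
    using z1 by (metis (mono_tags, lifting) ComplI mem_Collect_eq openE singletonD)
  define B where "B = ball z1 r1"
  have B: "open B" "connected B" "B \<noteq> {}" "B \<subseteq> S" "convex B" and B0: "\<And>w. w \<in> B \<Longrightarrow> f 0 w \<noteq> 0"
    using r1 by (auto simp: B_def)
  define q where "q j w = f (Suc j) w / f 0 w" for j w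
  have hq: "q j holomorphic_on B" if "j \<le> n" for j
    unfolding q_def[abs_def] using that B B0
    by (intro holomorphic_intros holomorphic_on_subset[OF Suc.prems(4)]) auto
  have hdq: "deriv (q j) holomorphic_on B" if "j \<le> n" for j
    by (intro holomorphic_deriv hq that B)
  have comb: "((\<lambda>w. \<Sum>j\<le>n. c j * q j w) has_field_derivative (\<Sum>j\<le>n. c j * deriv (q j) w)) (at w)"
    if "w \<in> B" for c w
    by (intro DERIV_sum DERIV_cmult holomorphic_derivI[OF hq B(1) that]) auto
  have split: "(\<Sum>j\<le>Suc n. c j * f j w) = f 0 w * (c 0 + (\<Sum>j\<le>n. c (Suc j) * q j w))" if "w \<in> B" for c w
    using B0[OF that] unfolding sum.atMost_Suc_shift q_def
    by (simp add: distrib_left sum_distrib_left field_simps)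
  have ind: "\<forall>j\<le>n. c j = 0" if z: "\<forall>z\<in>B. (\<Sum>j\<le>n. c j * deriv (q j) z) = 0" for c
  proof -
    have "\<exists>K. \<forall>w\<in>B. (\<Sum>j\<le>n. c j * q j w) = K"
    proof (rule has_field_derivative_zero_constant[OF B(5)])
      show "((\<lambda>w. \<Sum>j\<le>n. c j * q j w) has_field_derivative 0) (at w within B)" if "w \<in> B" for w
        using comb[OF that, of c] z that by (auto intro: has_field_derivative_at_within)
    qed
    then obtain K where K: "\<And>w. w \<in> B \<Longrightarrow> (\<Sum>j\<le>n. c j * q j w) = K" by blast
    \<comment> \<open>The constant value \<open>K\<close> becomes the coefficient of \<open>f 0\<close>.\<close>
    define c' where "c' j = (case j of 0 \<Rightarrow> - K | Suc j \<Rightarrow> c j)" for j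
    have zB: "(\<Sum>j\<le>Suc n. c' j * f j w) = 0" if "w \<in> B" for w
      unfolding split[OF that] using K[OF that] by (simp add: c'_def)
    have "(\<Sum>j\<le>Suc n. c' j * f j w) = 0" if "w \<in> S" for w
    proof (rule analytic_continuation_open[OF B(1) Suc.prems(1) B(3) Suc.prems(2) B(4), of "\<lambda>w. \<Sum>j\<le>Suc n. c' j * f j w" "\<lambda>_. 0"])
      show "(\<lambda>w. \<Sum>j\<le>Suc n. c' j * f j w) holomorphic_on S"
        by (intro holomorphic_intros Suc.prems(4)) auto
    qed (use zB that in auto)
    then have "\<forall>j\<le>Suc n. c' j = 0" using Suc.prems(5) by blast
    then have "c' (Suc j) = 0" if "j \<le> n" for j using that by blast
    then show ?thesis by (simp add: c'_def)
  qed
  obtain z where z: "z \<in> B" and nd: "\<And>c r G j. 0 < r \<Longrightarrow> ball z r \<subseteq> B \<Longrightarrow> G holomorphic_on ball z r \<Longrightarrow>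
    (\<forall>w\<in>ball z r. (\<Sum>j\<le>n. c j * deriv (q j) w) = (w - z) ^ Suc n * G w) \<Longrightarrow> j \<le> n \<Longrightarrow> c j = 0"
    using Suc.IH[OF B(1-3), of "\<lambda>j. deriv (q j)", OF hdq ind] by blast
  show ?case
  proof (intro bexI[of _ z] allI impI)
    show "z \<in> S" using z B by blast
    fix c :: "nat \<Rightarrow> complex" and r :: real and G and j :: nat
    assume r: "0 < r" "ball z r \<subseteq> S" and G: "G holomorphic_on ball z r"
      and eq: "\<forall>w\<in>ball z r. (\<Sum>j\<le>Suc n. c j * f j w) = (w - z) ^ Suc (Suc n) * G w" and j: "j \<le> Suc n"
    obtain r2 where r2: "0 < r2" "ball z r2 \<subseteq> B" using B(1) z openE by blast
    define s where "s = min r r2"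
    have s: "0 < s" "ball z s \<subseteq> B" "ball z s \<subseteq> ball z r" using r r2 by (auto simp: s_def)
    define G1 where "G1 w = G w / f 0 w" for w
    have hG1: "G1 holomorphic_on ball z s"
      unfolding G1_def[abs_def] using B0 s B by (intro holomorphic_intros holomorphic_on_subset[OF G] holomorphic_on_subset[OF h0]) auto
    have e1: "c 0 + (\<Sum>j\<le>n. c (Suc j) * q j w) = (w - z) ^ Suc (Suc n) * G1 w" if w: "w \<in> ball z s" for w
    proof -
      have wB: "w \<in> B" using w s by blast
      have "f 0 w * (c 0 + (\<Sum>j\<le>n. c (Suc j) * q j w)) = (w - z) ^ Suc (Suc n) * G w"
        using split[OF wB, of c] eq w s(3) by (metis subsetD)
      then show ?thesis using B0[OF wB] by (simp add: G1_def field_simps del: power_Suc)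
    qed
    have dz: "(\<Sum>j\<le>n. c (Suc j) * deriv (q j) w) = (w - z) ^ Suc n * (of_nat (Suc (Suc n)) * G1 w + (w - z) * deriv G1 w)"
      if w: "w \<in> ball z s" for w
    proof -
      have "((\<lambda>w. c 0 + (\<Sum>j\<le>n. c (Suc j) * q j w)) has_field_derivative (\<Sum>j\<le>n. c (Suc j) * deriv (q j) w)) (at w)"
      proof -
        have "w \<in> B" using w s(2) by blast
        from DERIV_add[OF DERIV_const[of "c 0"] comb[OF this, of "\<lambda>j. c (Suc j)"]] show ?thesis by simp
      qed
      then have 1: "deriv (\<lambda>w. c 0 + (\<Sum>j\<le>n. c (Suc j) * q j w)) w = (\<Sum>j\<le>n. c (Suc j) * deriv (q j) w)"
        by (rule DERIV_imp_deriv)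
      have "((\<lambda>w. (w - z) ^ Suc (Suc n) * G1 w) has_field_derivative
         (of_nat (Suc (Suc n)) * (w - z) ^ Suc n * G1 w + (w - z) ^ Suc (Suc n) * deriv G1 w)) (at w)"
        using holomorphic_derivI[OF hG1 open_ball w]
        by (auto intro!: derivative_eq_intros simp del: power_Suc of_nat_Suc)
      then have 2: "deriv (\<lambda>w. (w - z) ^ Suc (Suc n) * G1 w) w =
         of_nat (Suc (Suc n)) * (w - z) ^ Suc n * G1 w + (w - z) ^ Suc (Suc n) * deriv G1 w"
        by (rule DERIV_imp_deriv)
      have "deriv (\<lambda>w. c 0 + (\<Sum>j\<le>n. c (Suc j) * q j w)) w = deriv (\<lambda>w. (w - z) ^ Suc (Suc n) * G1 w) w"
      proof (rule deriv_cong_ev)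
        show "\<forall>\<^sub>F w in nhds w. c 0 + (\<Sum>j\<le>n. c (Suc j) * q j w) = (w - z) ^ Suc (Suc n) * G1 w"
          using eventually_nhds_in_open[OF open_ball w] by eventually_elim (rule e1)
      qed simp
      then show ?thesis unfolding 1 2 by (simp add: algebra_simps)
    qed
    have cS: "c (Suc j) = 0" if "j \<le> n" for j
    proof (rule nd[OF s(1,2) _ _ that, of "\<lambda>w. of_nat (Suc (Suc n)) * G1 w + (w - z) * deriv G1 w" "\<lambda>j. c (Suc j)"])
      show "(\<lambda>w. of_nat (Suc (Suc n)) * G1 w + (w - z) * deriv G1 w) holomorphic_on ball z s"
        by (intro holomorphic_intros hG1 holomorphic_deriv open_ball)
    qed (use dz in blast)
    have "c 0 = 0" using e1[of z] s(1) cS by simp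
    then show "c j = 0" using cS j by (cases j) auto
  qed
qed

lemma lin_indep_nonnull:
  assumes "lin_indep_disk n f" "j \<le> n" "c j \<noteq> 0"
  obtains w where "w \<in> \<D>" "(\<Sum>j\<le>n. c j * f j w) \<noteq> 0"
  using assms unfolding lin_indep_disk_def by blast

lemma wronskian_nonnull:
  assumes f: "\<And>j. j \<le> n \<Longrightarrow> f j holomorphic_on \<D>" and li: "lin_indep_disk n f"
  obtains z where "z \<in> \<D>" "wronskian n f z \<noteq> 0"
proof -
  have "\<exists>z\<in>\<D>. \<forall>c r G. 0 < r \<longrightarrow> ball z r \<subseteq> \<D> \<longrightarrow> G holomorphic_on ball z r \<longrightarrow>
    (\<forall>w\<in>ball z r. (\<Sum>j\<le>n. c j * f j w) = (w - z) ^ Suc n * G w) \<longrightarrow> (\<forall>j\<le>n. c j = 0)"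
  proof (rule nondegenerate_point[OF open_ball connected_ball])
    show "\<D> \<noteq> {}" by simp
    show "f j holomorphic_on \<D>" if "j \<le> n" for j by (rule f[OF that])
    show "\<forall>j\<le>n. c j = 0" if "\<forall>z\<in>\<D>. (\<Sum>j\<le>n. c j * f j z) = 0" for c
      using li[unfolded lin_indep_disk_def, rule_format, of c] that by blast
  qed
  then obtain z where z: "z \<in> \<D>" and nd': "\<forall>c r G. 0 < r \<longrightarrow> ball z r \<subseteq> \<D> \<longrightarrow> G holomorphic_on ball z r \<longrightarrow>
    (\<forall>w\<in>ball z r. (\<Sum>j\<le>n. c j * f j w) = (w - z) ^ Suc n * G w) \<longrightarrow> (\<forall>j\<le>n. c j = 0)"
    by (rule bexE)
  note nd = nd'[rule_format]
  have "wronskian n f z \<noteq> 0"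
  proof
    assume W: "wronskian n f z = 0"
    have "wronskian n f z = 0 \<longleftrightarrow>
        (\<exists>c. (\<exists>j\<le>n. c j \<noteq> 0) \<and> (\<forall>k\<le>n. (deriv ^^ k) (\<lambda>w. \<Sum>j\<le>n. c j * f j w) z = 0))"
      by (rule wronskian_eq_0_iff[OF _ z]) (rule f)
    from this[THEN iffD1, OF W] obtain c where
      cc: "(\<exists>j\<le>n. c j \<noteq> 0) \<and> (\<forall>k\<le>n. (deriv ^^ k) (\<lambda>w. \<Sum>j\<le>n. c j * f j w) z = 0)"
      by (rule exE)
    note van = cc[THEN conjunct2]
    from cc obtain j where "j \<le> n" "c j \<noteq> 0" by blast
    note c = this van[rule_format]
    obtain w where w: "w \<in> \<D>" "(\<Sum>j\<le>n. c j * f j w) \<noteq> 0"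
      using lin_indep_nonnull[of n f j c, OF li c(1,2)] by blast
    have "(\<lambda>w. \<Sum>j\<le>n. c j * f j w) holomorphic_on \<D>" by (intro holomorphic_intros f) auto
    from vanishing_factor[OF this w z c(3)] obtain r G where "0 < r" "ball z r \<subseteq> \<D>" "G holomorphic_on ball z r"
      "\<And>w. w \<in> ball z r \<Longrightarrow> (\<Sum>j\<le>n. c j * f j w) = (w - z) ^ Suc n * G w" by blast
    then show False using nd[of r G c j] c(1,2) by blast
  qed
  then show ?thesis using that z by blast
qed

lemma deep_zero_set_wronskian:
  assumes f: "\<And>j. j \<le> n \<Longrightarrow> f j holomorphic_on \<D>" and li: "lin_indep_disk n f"
  shows "deep_zero_set n f = {z \<in> \<D>. wronskian n f z = 0}"
proof -
  have h: "(\<lambda>w. \<Sum>j\<le>n. c j * f j w) holomorphic_on \<D>" for c by (intro holomorphic_intros f) auto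
  have "(\<exists>j\<le>n. c j \<noteq> 0) \<and> deep_zero n (\<lambda>w. \<Sum>j\<le>n. c j * f j w) z \<longleftrightarrow>
        (\<exists>j\<le>n. c j \<noteq> 0) \<and> (\<forall>k\<le>n. (deriv ^^ k) (\<lambda>w. \<Sum>j\<le>n. c j * f j w) z = 0)" if z: "z \<in> \<D>" for c z
  proof (cases "\<exists>j\<le>n. c j \<noteq> 0")
    case True
    then obtain w where "w \<in> \<D>" "(\<Sum>j\<le>n. c j * f j w) \<noteq> 0" using lin_indep_nonnull[OF li] by blast
    then show ?thesis using deep_zero_iff[OF h _ _ z, of w c n] by simp
  qed auto
  note eq = this
  have "(\<exists>c. (\<exists>j\<le>n. c j \<noteq> 0) \<and> deep_zero n (\<lambda>w. \<Sum>j\<le>n. c j * f j w) z) \<longleftrightarrow> wronskian n f z = 0"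
    if z: "z \<in> \<D>" for z
  proof -
    have w: "wronskian n f z = 0 \<longleftrightarrow>
        (\<exists>c. (\<exists>j\<le>n. c j \<noteq> 0) \<and> (\<forall>k\<le>n. (deriv ^^ k) (\<lambda>w. \<Sum>j\<le>n. c j * f j w) z = 0))"
      by (rule wronskian_eq_0_iff[OF _ z]) (rule f)
    show ?thesis unfolding w by (simp only: eq[OF z])
  qed
  then show ?thesis
    unfolding deep_zero_set_def by (intro Collect_cong conj_cong refl)
qed

text \<open>
  In the Leibniz expansion the row of the highest derivatives contributes one factor \<open>deriv\<close> of a quotient of
  bounded functions; the remaining factors of each term are such quotients.
\<close>

lemma wronskian_deriv_quotient:
  assumes f: "\<And>j k. j \<le> Suc m \<Longrightarrow> k \<le> m \<Longrightarrow> (deriv ^^ k) (f j) \<in> Nevanlinna"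
  shows "deriv_quotient (wronskian (Suc m) f)"
proof -
  let ?P = "{p. p permutes {0..<Suc (Suc m)}}"
  have "wronskian (Suc m) f z = (\<Sum>p\<in>?P. (of_int (sign p) * (\<Prod>k\<in>{0..<Suc m}. (deriv ^^ k) (f (p k)) z)) * deriv ((deriv ^^ m) (f (p (Suc m)))) z)" for z
  proof -
    have "(\<Prod>k = 0..<Suc (Suc m). wronski_mat (Suc m) f z $$ (k, p k)) =
       (\<Prod>k\<in>{0..<Suc m}. (deriv ^^ k) (f (p k)) z) * deriv ((deriv ^^ m) (f (p (Suc m)))) z" if p: "p \<in> ?P" for p
    proof -
      have "p k < Suc (Suc m)" if "k < Suc (Suc m)" for k using p that permutes_in_image[of p] by fastforce
      then have "(\<Prod>k = 0..<Suc (Suc m). wronski_mat (Suc m) f z $$ (k, p k)) = (\<Prod>k = 0..<Suc (Suc m). (deriv ^^ k) (f (p k)) z)"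
        by (intro prod.cong) (auto simp: wronski_mat_def)
      then show ?thesis by (simp add: prod.atLeast0_lessThan_Suc mult_ac)
    qed
    then show ?thesis
      unfolding wronskian_def det_def'[OF wronski_mat_carrier]
      by (intro sum.cong) (auto simp: mult.assoc)
  qed
  then have "wronskian (Suc m) f = (\<lambda>z. \<Sum>p\<in>?P. (of_int (sign p) * (\<Prod>k\<in>{0..<Suc m}. (deriv ^^ k) (f (p k)) z)) * deriv ((deriv ^^ m) (f (p (Suc m)))) z)"
    by (rule ext)
  moreover have "deriv_quotient (\<lambda>z. \<Sum>p\<in>?P. (of_int (sign p) * (\<Prod>k\<in>{0..<Suc m}. (deriv ^^ k) (f (p k)) z)) * deriv ((deriv ^^ m) (f (p (Suc m)))) z)"
  proof (intro deriv_quotient_sum deriv_quotient_mult deriv_quotient_deriv Nevanlinna_mult Nevanlinna_prod)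
    fix p assume "p \<in> ?P"
    then have pp: "p permutes {0..<Suc (Suc m)}" by simp
    have p: "p k \<le> Suc m" if "k \<le> Suc m" for k
      using that permutes_in_image[OF pp, of k] by simp
    show "(deriv ^^ m) (f (p (Suc m))) \<in> Nevanlinna" by (intro f p) auto
    show "(deriv ^^ k) (f (p k)) \<in> Nevanlinna" if "k \<in> {0..<Suc m}" for k
      using that by (intro f p) auto
  qed (auto simp: finite_permutations intro: Hinf_subset_Nevanlinna Hinf_const)
  ultimately show ?thesis by simp
qed

section \<open>Iterated primitives and powers\<close>

lemma garsia_cong:
  assumes "f \<in> garsia" "\<And>z. z \<in> \<D> \<Longrightarrow> g z = f z"
  shows "g \<in> garsia"
  by (rule garsia_add[OF assms(1) Hinf_subset_garsia[OF Hinf_const[of 0]]]) (simp add: assms(2))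

lemma higher_deriv_cong_disk:
  assumes "z \<in> \<D>" "\<And>z. z \<in> \<D> \<Longrightarrow> f z = g z"
  shows "(deriv ^^ k) f z = (deriv ^^ k) g z"
  using assms(1)
proof (induction k arbitrary: z)
  case 0 then show ?case using assms(2) by simp
next
  case (Suc k)
  have "deriv ((deriv ^^ k) f) z = deriv ((deriv ^^ k) g) z"
    by (rule deriv_cong_disk[OF Suc.prems Suc.IH])
  then show ?case by simp
qed

text \<open>
  Each further primitive is bounded by \<open>primitive_of_garsia_bounded\<close>, hence again in \<open>garsia\<close>.
\<close>

lemma iterated_primitive:
  assumes h: "h \<in> garsia"
  shows "\<exists>F. F holomorphic_on \<D> \<and> (\<forall>k\<le>m. (deriv ^^ k) F \<in> garsia) \<and> (\<forall>z\<in>\<D>. (deriv ^^ m) F z = h z)"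
proof (induction m)
  case 0
  show ?case using h by (intro exI[of _ h]) (auto simp: garsia_def)
next
  case (Suc m)
  then obtain F where F: "F holomorphic_on \<D>" "\<And>k. k \<le> m \<Longrightarrow> (deriv ^^ k) F \<in> garsia"
    "\<And>z. z \<in> \<D> \<Longrightarrow> (deriv ^^ m) F z = h z" by blast
  obtain H where H: "H holomorphic_on \<D>" "\<And>z. z \<in> \<D> \<Longrightarrow> deriv H z = F z"
    using primitive_on_disk[OF F(1)] by blast
  have HS: "(deriv ^^ Suc k) H z = (deriv ^^ k) F z" if "z \<in> \<D>" for k z
    using higher_deriv_cong_disk[OF that, of "deriv H" F k] H(2) by (simp add: funpow_swap1)
  have "H \<in> garsia"
    by (rule Hinf_subset_garsia[OF primitive_of_garsia_bounded[OF _ H]]) (use F(2)[of 0] in simp)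
  then have "(deriv ^^ k) H \<in> garsia" if "k \<le> Suc m" for k
  proof (cases k)
    case (Suc k')
    then show ?thesis using that HS by (intro garsia_cong[OF F(2)[of k']]) auto
  qed (use \<open>H \<in> garsia\<close> in simp)
  moreover have "(deriv ^^ Suc m) H z = h z" if "z \<in> \<D>" for z
    using HS[OF that, of m] F(3)[OF that] by (simp only:)
  ultimately show ?case using H(1) by blast
qed

text \<open>
  For \<open>k > j\<close> truncated subtraction produces a factor zero.
\<close>

lemma higher_deriv_power_fn:
  "(deriv ^^ k) (\<lambda>w::complex. w ^ j) = (\<lambda>w. (\<Prod>i<k. of_nat (j - i)) * w ^ (j - k))"
proof (induction k)
  case (Suc k)
  have "deriv (\<lambda>w::complex. (\<Prod>i<k. of_nat (j - i)) * w ^ (j - k)) w = (\<Prod>i<Suc k. of_nat (j - i)) * w ^ (j - Suc k)" for w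
    by (rule DERIV_imp_deriv) (auto intro!: derivative_eq_intros)
  then have "deriv (\<lambda>w::complex. (\<Prod>i<k. of_nat (j - i)) * w ^ (j - k)) = (\<lambda>w. (\<Prod>i<Suc k. of_nat (j - i)) * w ^ (j - Suc k))"
    by (rule ext)
  then show ?case by (simp only: funpow.simps o_apply Suc.IH)
qed simp

lemma higher_deriv_power_Hinf: "(deriv ^^ k) (\<lambda>w::complex. w ^ j) \<in> Hinf"
proof (rule HinfI[where B = "cmod (\<Prod>i<k. of_nat (j - i))"])
  show "cmod ((deriv ^^ k) (\<lambda>w. w ^ j) z) \<le> cmod (\<Prod>i<k. of_nat (j - i))" if "z \<in> \<D>" for z
    unfolding higher_deriv_power_fn norm_mult norm_power using that
    by (intro mult_left_le power_le_one) auto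
qed (auto simp: higher_deriv_power_fn intro!: holomorphic_intros)

text \<open>
  The matrix of derivatives is upper triangular, and its first \<open>m + 1\<close> diagonal entries are factorials.
\<close>

lemma wronskian_powers:
  assumes f: "\<And>j. j \<le> m \<Longrightarrow> f j = (\<lambda>w. w ^ j)"
  shows "wronskian (Suc m) f z = 0 \<longleftrightarrow> (deriv ^^ Suc m) (f (Suc m)) z = 0"
proof -
  let ?A = "wronski_mat (Suc m) f z"
  have ut: "upper_triangular ?A"
  proof (rule upper_triangularI)
    fix i j assume "j < i" "i < dim_row ?A"
    then have ij: "j < i" "i \<le> Suc m" "j \<le> m" by (auto simp: wronski_mat_def)
    have "(\<Prod>l<i. of_nat (j - l) :: complex) = 0"
      using ij by (intro prod_zero) auto
    then show "?A $$ (i, j) = 0"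
      using ij by (simp add: wronski_mat_def f higher_deriv_power_fn)
  qed
  have "wronskian (Suc m) f z = prod_list (diag_mat ?A)"
    unfolding wronskian_def by (rule det_upper_triangular[OF ut wronski_mat_carrier])
  also have "\<dots> = (\<Prod>i = 0..<Suc (Suc m). ?A $$ (i, i))"
    by (simp add: prod_list_diag_prod wronski_mat_def)
  also have "\<dots> = 0 \<longleftrightarrow> (\<exists>i\<le>Suc m. (deriv ^^ i) (f i) z = 0)"
    by (auto simp: prod_zero_iff wronski_mat_def less_Suc_eq_le simp del: prod.atLeast0_lessThan_Suc prod.op_ivl_Suc)
  also have "\<dots> \<longleftrightarrow> (deriv ^^ Suc m) (f (Suc m)) z = 0"
  proof -
    have "(deriv ^^ i) (f i) z \<noteq> 0" if "i \<le> m" for i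
      using that by (simp add: f higher_deriv_power_fn)
    then show ?thesis by (metis le_Suc_eq order_refl)
  qed
  finally show ?thesis .
qed

section \<open>Deep zeros and zeros of derivatives\<close>

theorem theorem5p8:
  fixes X :: "(complex \<Rightarrow> complex) set" and m :: nat
  assumes "X = BMOA \<or> (\<exists>p::real. 0 < p \<and> X = Hardy p) \<or> X = Smirnov \<or> X = Nevanlinna"
  shows "deep_zero_sets (m + 1) (order_space m X) = zero_sets (deriv_space BMOA)"
proof (intro subset_antisym subsetI)
  fix Z assume "Z \<in> deep_zero_sets (m + 1) (order_space m X)"
  then obtain f where Z: "Z = deep_zero_set (Suc m) f" and fX: "\<And>j. j \<le> Suc m \<Longrightarrow> f j \<in> order_space m X"
    and li: "lin_indep_disk (Suc m) f" unfolding deep_zero_sets_def by auto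
  have hf: "f j holomorphic_on \<D>" if "j \<le> Suc m" for j using fX[OF that] by (simp add: order_space_def)
  have "deriv_quotient (wronskian (Suc m) f)"
  proof (rule wronskian_deriv_quotient)
    fix j k assume "j \<le> Suc m" "k \<le> m"
    then have "(deriv ^^ k) (f j) \<in> X" using fX[of j] by (simp add: order_space_def)
    then show "(deriv ^^ k) (f j) \<in> Nevanlinna" by (rule spaces_subset_Nevanlinna[OF _ assms])
  qed
  then obtain h where h: "h \<in> garsia" "\<And>z. z \<in> \<D> \<Longrightarrow> deriv h z = 0 \<longleftrightarrow> wronskian (Suc m) f z = 0"
    by (rule deriv_quotient_zeros) blast
  obtain w where w: "w \<in> \<D>" "wronskian (Suc m) f w \<noteq> 0" using wronskian_nonnull[OF hf li] by blast
  have "Z = {z \<in> \<D>. deriv h z = 0}"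
  proof -
    have "Z = {z \<in> \<D>. wronskian (Suc m) f z = 0}"
      unfolding Z by (rule deep_zero_set_wronskian[OF _ li]) (rule hf)
    then show ?thesis using h(2) by blast
  qed
  moreover have "deriv h \<in> deriv_space BMOA"
    using garsia_subset_BMOA[OF h(1)] unfolding deriv_space_def by blast
  moreover have "\<exists>z\<in>\<D>. deriv h z \<noteq> 0" using w h(2) by blast
  ultimately show "Z \<in> zero_sets (deriv_space BMOA)" unfolding zero_sets_def by blast
next
  fix Z assume "Z \<in> zero_sets (deriv_space BMOA)"
  then obtain g where Z: "Z = {z \<in> \<D>. g z = 0}" and "g \<in> deriv_space BMOA"
    and nn: "\<exists>z\<in>\<D>. g z \<noteq> 0" unfolding zero_sets_def by blast
  then obtain B where B: "B \<in> BMOA" and g: "\<And>z. z \<in> \<D> \<Longrightarrow> g z = deriv B z"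
    unfolding deriv_space_def by blast
  obtain h where h: "h \<in> garsia" "\<And>z. z \<in> \<D> \<Longrightarrow> deriv h z = 0 \<longleftrightarrow> deriv B z = 0"
    using deriv_quotient_zeros[OF deriv_quotient_deriv[OF BMOA_subset_Nevanlinna[OF B]]] by blast
  obtain F where F: "F holomorphic_on \<D>" "\<And>k. k \<le> m \<Longrightarrow> (deriv ^^ k) F \<in> garsia"
    "\<And>z. z \<in> \<D> \<Longrightarrow> (deriv ^^ m) F z = h z" using iterated_primitive[OF h(1), of m] by blast
  define f where "f j = (if j \<le> m then (\<lambda>w. w ^ j) else F)" for j
  have hf: "f j holomorphic_on \<D>" for j using F(1) by (auto simp: f_def intro: holomorphic_intros)
  have W: "wronskian (Suc m) f z = 0 \<longleftrightarrow> g z = 0" if z: "z \<in> \<D>" for z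
  proof -
    have "deriv ((deriv ^^ m) F) z = deriv h z" by (rule deriv_cong_disk[OF z F(3)])
    then show ?thesis
      using wronskian_powers[of m f z] h(2)[OF z] g[OF z] by (simp add: f_def)
  qed
  have li: "lin_indep_disk (Suc m) f"
    unfolding lin_indep_disk_def
  proof (intro allI impI, rule ccontr)
    fix c :: "nat \<Rightarrow> complex" and j
    assume zero: "\<forall>z\<in>\<D>. (\<Sum>j\<le>Suc m. c j * f j z) = 0" and j: "j \<le> Suc m" "c j \<noteq> 0"
    obtain z where z: "z \<in> \<D>" "g z \<noteq> 0" using nn by blast
    have "(deriv ^^ k) (\<lambda>w. \<Sum>j\<le>Suc m. c j * f j w) z = 0" for k
      using higher_deriv_cong_disk[OF z(1), of "\<lambda>w. \<Sum>j\<le>Suc m. c j * f j w" "\<lambda>_. 0" k] zero by simp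
    then have "wronskian (Suc m) f z = 0"
      unfolding wronskian_eq_0_iff[OF hf z(1)] using j by blast
    then show False using W[OF z(1)] z(2) by simp
  qed
  have "(deriv ^^ k) (f j) \<in> X" if "k \<le> m" for j k
  proof (rule garsia_subset_spaces[OF _ assms])
    show "(deriv ^^ k) (f j) \<in> garsia"
      using F(2)[OF that] Hinf_subset_garsia[OF higher_deriv_power_Hinf[of k j]] by (simp add: f_def)
  qed
  then have "f j \<in> order_space m X" for j using hf by (simp add: order_space_def)
  moreover have "Z = deep_zero_set (Suc m) f"
    unfolding Z deep_zero_set_wronskian[OF hf li] using W by blast
  ultimately show "Z \<in> deep_zero_sets (m + 1) (order_space m X)"
    unfolding deep_zero_sets_def using li by auto
qed

end
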